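(* Let $I,J\in X^{\mathsf T}$ be fixed points, regarded as permutations in $\mathfrak S_n$, and let $I^{-1},J^{-1}\in (X')^{\mathsf T'}$ be the corresponding fixed points on the dual variety $X'$. Then $$\mathbf{Stab}(I)\big|_{\widehat{\mathsf O}_{J}}=\kappa^{*}\Big(\mathbf{Stab}'(J^{-1})\big|_{\widehat{\mathsf O}'_{I^{-1}}}\Big),$$ where $\kappa:\widehat{\mathsf O}_J\to\widehat{\mathsf O}'_{I^{-1}}$ is the isomorphism given in coordinates by $\mu_i'\mapsto z_i$, $z_i'\mapsto \mu_i$, $\hbar'\mapsto\hbar$ ($i=1,\dots,n$); the equality means that the two sections coincide after this change of variables.
   Context: Elliptic curve and theta function. Fix $q\in\mathbb C^*$, $|q|<1$, $E=\mathbb C^*/q^{\mathbb Z}$, and $$\vartheta(x)=(x^{1/2}-x^{-1/2})\,\phi(qx)\,\phi(q/x),\qquad \phi(x)=\prod_{s\ge 0}(1-q^s x),$$ so that $\vartheta(1/x)=-\vartheta(x)$. (Functions involving $x^{1/2}$ are understood as functions of the logarithms of the variables, i.e. as sections of line bundles over products of copies of $E$.) Permutations. A permutation $I\in\mathfrak S_n$ is written $I=(I_1,\dots,I_n)$, $I_k=I(k)$. For $1\le k\le n$ write $\{i^{(k)}_1<\dots<i^{(k)}_k\}=\{I_1,\dots,I_k\}$. $\sigma_0=(n,n-1,\dots,1)$ is the longest permutation. For variables $z=(z_1,\dots,z_n)$ put $z_\sigma=(z_{\sigma(1)},\dots,z_{\sigma(n)})$ and $1/z=(1/z_1,\dots,1/z_n)$;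 for $\sigma\in\mathfrak S_n$, $\sigma^{-1}(I)=(\sigma^{-1}(I_1),\dots,\sigma^{-1}(I_n))$. Elliptic weight functions. Let $t=(t^{(k)}_a)_{1\le a\le k\le n-1}$, $t^{(n)}_i=z_i$, and $\mu=(\mu_1,\dots,\mu_n)$. Define $W_I(t,z,\hbar,\mu)=\mathrm{Sym}_{t^{(1)}}\cdots\mathrm{Sym}_{t^{(n-1)}}U_I(t,z,\hbar,\mu)$, where $\mathrm{Sym}_{t^{(k)}}$ is the sum over all permutations of $t^{(k)}_1,\dots,t^{(k)}_k$ and $$U_I=\prod_{k=1}^{n-1}\frac{\prod_{a=1}^{k}\prod_{c=1}^{k+1}\psi_{I,k,a,c}\big(t^{(k+1)}_c/t^{(k)}_a\big)}{\prod_{1\le a<b\le k}\vartheta\big(\hbar t^{(k)}_a/t^{(k)}_b\big)\,\vartheta\big(t^{(k)}_b/t^{(k)}_a\big)},$$ $$\psi_{I,k,a,c}(x)=\begin{cases}\vartheta(\hbar x), & i^{(k+1)}_c<i^{(k)}_a,\\ \vartheta\big(x\,\hbar^{1-p_{I,k+1}(i^{(k)}_a)}\,\mu_{k+1}/\mu_{j(I,k,a)}\big), & i^{(k+1)}_c=i^{(k)}_a,\\ \vartheta(x), & i^{(k+1)}_c>i^{(k)}_a.\end{cases}$$ Here $j(I,k,a)$ is the index with $I_{j(I,k,a)}=i^{(k)}_a$, and $p_{I,j}(m)=1$ if $I_j<m$, $p_{I,j}(m)=0$ if $I_j\ge m$. For $\sigma\in\mathfrak S_n$ put $W_{\sigma,I}(t,z,\hbar,\mu)=W_{\sigma^{-1}(I)}(t,z_\sigma,\hbar,\mu)$.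 The variety $X$ and its extended elliptic cohomology. $X$ is the cotangent bundle of the variety of complete flags in $\mathbb C^n$, with the torus $\mathsf T=(\mathbb C^* )^n\times\mathbb C^*_\hbar$, where $(\mathbb C^* )^n$ acts through its action on $\mathbb C^n$ by $(x_1,\dots,x_n)\mapsto(x_1z_1^{-1},\dots,x_nz_n^{-1})$ and $\mathbb C_\hbar^*$ scales the cotangent fibers by $\hbar^{-1}$. Fixed points $X^{\mathsf T}$ are the coordinate flags $V_k(I)=\mathrm{Span}(e_{I_1},\dots,e_{I_k})$, $I\in\mathfrak S_n$. Let $\mathscr E_{\mathsf T}$ (coordinates $z_1,\dots,z_n,\hbar$, the equivariant parameters) be the $\mathsf T$-equivariant elliptic cohomology of a point and let $\mathscr E_{\mathrm{Pic}(X)}=\mathrm{Pic}(X)\otimes_{\mathbb Z}E$ (coordinates $\mu_1,\dots,\mu_n$, the Kähler parameters). The extended elliptic cohomology $\mathsf E_{\mathsf T}(X)=\mathrm{Ell}_{\mathsf T}(X)\times\mathscr E_{\mathrm{Pic}(X)}$ is embedded by the elliptic Chern classes of the tautological bundles, $c_X:\mathsf E_{\mathsf T}(X)\hookrightarrow \mathsf S(X)\times\mathscr E_{\mathsf T}\times\mathscr E_{\mathrm{Pic}(X)}$, $\mathsf S(X)=\prod_{k=1}^{n-1}S^kE$, where $t^{(k)}_1,\dots,t^{(k)}_k$ (Chern roots of the rank $k$ tautological bundle) are the coordinates on the $k$-th factor. It is the union of components $\widehat{\mathsf O}_I\cong\mathscr E_{\mathsf T}\times\mathscr E_{\mathrm{Pic}(X)}$,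 $I\in\mathfrak S_n$, where $\widehat{\mathsf O}_I$ is cut out by $t^{(k)}_l=z_{i^{(k)}_l}$, $1\le l\le k\le n-1$; restriction of a section to $\widehat{\mathsf O}_I$ is this substitution. Stable envelopes. The normalized (holomorphic) elliptic stable envelope of $I$ is the restriction of the weight function to elliptic cohomology: $\mathbf{Stab}(I)=c_X^*W_{I}(t,z,\hbar,\mu)$ (chamber $\sigma=\mathrm{id}$). Dual variety. $X'$ is a second copy of $X$, with torus $\mathsf T'$, equivariant parameters $z_1',\dots,z_n',\hbar'$, Kähler parameters $\mu_1',\dots,\mu_n'$, Chern roots $t'$, and components $\widehat{\mathsf O}'_I\subset\mathsf E_{\mathsf T'}(X')$ (all defined in the same way). Its elliptic stable envelope (chamber $\sigma_0$) is $$\mathbf{Stab}'(I)=(-1)^{n(n-1)/2}\,c_{X'}^*W_{\sigma_0,I}(t',z',\hbar',1/\mu').$$ The fixed point of $X'$ corresponding to $I\in X^{\mathsf T}$ is $I^{-1}$. *)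

theory Defs
  imports "HOL-Analysis.Analysis" "HOL-Combinatorics.Permutations"
begin

text \<open>
  Conventions. All variables are represented by their logarithms: a variable \<open>x\<close> of the
  elliptic curve \<open>E = \<complex>\<^sup>* / q\<^sup>\<int>\<close> is \<open>exp u\<close> for a complex number \<open>u\<close>, products and quotients of
  variables become sums and differences, and \<open>x\<^sup>1\<^sup>/\<^sup>2 = exp (u / 2)\<close>. Sections of line bundles over
  products of copies of \<open>E\<close> are thus functions of complex numbers, and two sections coincide
  (including their multipliers) iff these functions do.

  Families indexed by \<open>{1..n}\<close> are functions on \<open>nat\<close> of which only the values at \<open>1, \<dots>, n\<close> are
  used. A permutation \<open>I \<in> S\<^sub>n\<close> is a function with \<open>I permutes {1..n}\<close>.
\<close>

section \<open>The theta function\<close>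

definition phi :: "complex \<Rightarrow> complex \<Rightarrow> complex" where
  "phi q x = (\<Prod>s. 1 - q ^ s * x)"

definition theta :: "complex \<Rightarrow> complex \<Rightarrow> complex" where
  "theta q u = (exp (u / 2) - exp (- u / 2)) * phi q (q * exp u) * phi q (q * exp (- u))"


section \<open>Elliptic weight functions\<close>

text \<open>\<open>idx I k c\<close> is the \<open>c\<close>-th smallest element of \<open>{I\<^sub>1, \<dots>, I\<^sub>k}\<close>, for \<open>1 \<le> c \<le> k\<close>.\<close>

definition idx :: "(nat \<Rightarrow> nat) \<Rightarrow> nat \<Rightarrow> nat \<Rightarrow> nat" where
  "idx I k c = sorted_list_of_set (I ` {1..k}) ! (c - 1)"

definition p_ind :: "(nat \<Rightarrow> nat) \<Rightarrow> nat \<Rightarrow> nat \<Rightarrow> nat" where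
  "p_ind I j m = (if I j < m then 1 else 0)"

definition j_ind :: "(nat \<Rightarrow> nat) \<Rightarrow> nat \<Rightarrow> nat \<Rightarrow> nat" where
  "j_ind I k a = inv I (idx I k a)"

text \<open>The triple consists of the equivariant parameters \<open>z\<close> and \<open>h\<close> (for \<open>\<hbar>\<close>) and the Kaehler parameters
  \<open>\<mu>\<close>; it is a point of \<open>\<E>\<^sub>T \<times> \<E>\<^sub>P\<^sub>i\<^sub>c\<close>, in logarithmic coordinates.\<close>

type_synonym params = "(nat \<Rightarrow> complex) \<times> complex \<times> (nat \<Rightarrow> complex)"

text \<open>\<open>t k a\<close> is \<open>t\<^sup>(\<^sup>k\<^sup>)\<^sub>a\<close> for \<open>1 \<le> a \<le> k \<le> n - 1\<close>.\<close>

type_synonym chern_roots = "nat \<Rightarrow> nat \<Rightarrow> complex"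

definition psi ::
  "complex \<Rightarrow> (nat \<Rightarrow> nat) \<Rightarrow> complex \<Rightarrow> (nat \<Rightarrow> complex) \<Rightarrow> nat \<Rightarrow> nat \<Rightarrow> nat \<Rightarrow> complex \<Rightarrow> complex"
where
  "psi q I h \<mu> k a c x =
     (if idx I (k + 1) c < idx I k a then theta q (h + x)
      else if idx I (k + 1) c = idx I k a then
        theta q (x + (1 - of_nat (p_ind I (k + 1) (idx I k a))) * h + \<mu> (k + 1) - \<mu> (j_ind I k a))
      else theta q x)"

text \<open>The update \<open>t(n := z)\<close> below is the convention \<open>t\<^sup>(\<^sup>n\<^sup>)\<^sub>i = z\<^sub>i\<close>.\<close>

definition U_fun :: "complex \<Rightarrow> nat \<Rightarrow> (nat \<Rightarrow> nat) \<Rightarrow> params \<Rightarrow> chern_roots \<Rightarrow> complex" where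
  "U_fun q n I = (\<lambda>(z, h, \<mu>) t. let T = t(n := z) in
     \<Prod>k = 1..n - 1.
       (\<Prod>a = 1..k. \<Prod>c = 1..k + 1. psi q I h \<mu> k a c (T (k + 1) c - T k a)) /
       (\<Prod>(a, b) \<in> {(a, b). 1 \<le> a \<and> a < b \<and> b \<le> k}.
          theta q (h + T k a - T k b) * theta q (T k b - T k a)))"

definition Sym :: "nat \<Rightarrow> (chern_roots \<Rightarrow> complex) \<Rightarrow> chern_roots \<Rightarrow> complex" where
  "Sym k f t = (\<Sum>\<pi> | \<pi> permutes {1..k}. f (t(k := t k \<circ> \<pi>)))"

definition W :: "complex \<Rightarrow> nat \<Rightarrow> (nat \<Rightarrow> nat) \<Rightarrow> params \<Rightarrow> chern_roots \<Rightarrow> complex" where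
  "W q n I P = foldr Sym [1..<n] (U_fun q n I P)"

definition W_chamber ::
  "complex \<Rightarrow> nat \<Rightarrow> (nat \<Rightarrow> nat) \<Rightarrow> (nat \<Rightarrow> nat) \<Rightarrow> params \<Rightarrow> chern_roots \<Rightarrow> complex" where
  "W_chamber q n \<sigma> I = (\<lambda>(z, h, \<mu>). W q n (inv \<sigma> \<circ> I) (z \<circ> \<sigma>, h, \<mu>))"

definition longest_perm :: "nat \<Rightarrow> nat \<Rightarrow> nat" where
  "longest_perm n i = (if i \<in> {1..n} then n + 1 - i else i)"


section \<open>Stable envelopes and their restrictions\<close>

text \<open>
  The extended elliptic cohomology is embedded by \<open>c\<^sub>X\<close> into the space with coordinates
  \<open>t, z, h, \<mu>\<close>, and its component indexed by \<open>J\<close> is cut out by \<open>t\<^sup>(\<^sup>k\<^sup>)\<^sub>l = z\<^sub>i\<close>, where \<open>i\<close> is the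
  \<open>l\<close>-th smallest element of \<open>{J\<^sub>1, \<dots>, J\<^sub>k}\<close>. Hence the component is parametrized by
  \<open>(z, h, \<mu>)\<close> and a section over it is a function of type \<^typ>\<open>params \<Rightarrow> complex\<close>, while a
  section on the ambient space is a function of type \<^typ>\<open>params \<Rightarrow> chern_roots \<Rightarrow> complex\<close>.
\<close>

definition fixed_chern_roots :: "(nat \<Rightarrow> nat) \<Rightarrow> params \<Rightarrow> chern_roots" where
  "fixed_chern_roots J = (\<lambda>(z, h, \<mu>) k l. z (idx J k l))"

text \<open>
  The denominators \<open>\<theta>(h t\<^sub>a / t\<^sub>b) \<theta>(t\<^sub>b / t\<^sub>a)\<close> of the summands of a weight function, restricted to
  a component, do not vanish on the following dense open set.
\<close>

definition generic_params :: "complex \<Rightarrow> nat \<Rightarrow> params set" where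
  "generic_params q n = {(z, h, \<mu>). \<forall>a \<in> {1..n}. \<forall>b \<in> {1..n}. a \<noteq> b \<longrightarrow>
     theta q (z a - z b) \<noteq> 0 \<and> theta q (h + z a - z b) \<noteq> 0}"

text \<open>
  Outside this set the formula for the restriction involves divisions by zero, although its
  singularities are removable. The value of the restricted section at an arbitrary point is
  therefore the limit along generic points (compare \<open>remove_sings\<close> in one complex variable).
  At a generic point the formula is continuous, and the limit is the value of the formula.
\<close>

definition restrict_to_component ::
  "complex \<Rightarrow> nat \<Rightarrow> (nat \<Rightarrow> nat) \<Rightarrow> (params \<Rightarrow> chern_roots \<Rightarrow> complex) \<Rightarrow> params \<Rightarrow> complex" where
  "restrict_to_component q n J s P =
     (let f = (\<lambda>P. s P (fixed_chern_roots J P)); F = at P within generic_params q n in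
      if \<exists>l. (f \<longlongrightarrow> l) F then Lim F f else 0)"

text \<open>
  The stable envelopes are given as sections on the ambient space; pulling back along \<open>c\<^sub>X\<close> and
  restricting to a component is \<^const>\<open>restrict_to_component\<close>.
\<close>

definition Stab :: "complex \<Rightarrow> nat \<Rightarrow> (nat \<Rightarrow> nat) \<Rightarrow> params \<Rightarrow> chern_roots \<Rightarrow> complex" where
  "Stab q n I P t = W q n I P t"

definition Stab_dual :: "complex \<Rightarrow> nat \<Rightarrow> (nat \<Rightarrow> nat) \<Rightarrow> params \<Rightarrow> chern_roots \<Rightarrow> complex" where
  "Stab_dual q n I = (\<lambda>(z, h, \<mu>) t.
     (- 1) ^ (n * (n - 1) div 2) * W_chamber q n (longest_perm n) I (z, h, \<lambda>i. - \<mu> i) t)"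

text \<open>A point \<open>(z, h, \<mu>)\<close> is sent to the point with coordinates \<open>z' = \<mu>\<close>, \<open>h' = h\<close>, \<open>\<mu>' = z\<close>.\<close>

definition kappa :: "params \<Rightarrow> params" where
  "kappa = (\<lambda>(z, h, \<mu>). (\<mu>, h, z))"

lemma bij_kappa: "bij kappa"
  by (rule involuntory_imp_bij) (auto simp: kappa_def)

lemma longest_perm_permutes: "longest_perm n permutes {1..n}"
  by (rule bij_imp_permutes)
     (auto simp: longest_perm_def intro!: bij_betw_byWitness[where f' = "longest_perm n"])

end

theory Submission
  imports Defs "HOL-Complex_Analysis.Cauchy_Integral_Formula"
begin

text \<open>
  Label the variables \<open>t\<^sup>(\<^sup>k\<^sup>)\<close> of \<open>W\<^sub>I\<close> by the positions \<open>1, \<dots>, k\<close> instead of by the increasing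
  enumeration of \<open>{I\<^sub>1, \<dots>, I\<^sub>k}\<close>. Let \<open>A\<^sub>I\<^sub>J(z, \<mu>)\<close> be the restriction of \<open>W\<^sub>I\<close> to the component of \<open>J\<close>. It satisfies
  two three-term recursions. The first (R-matrix) one changes \<open>z\<close> and the rows: it relates
  \<open>A\<^sub>I\<^sub>,\<^sub>s\<^sub>J(zs, \<mu>)\<close>, \<open>A\<^sub>I\<^sub>,\<^sub>J(z, \<mu>)\<close> and \<open>A\<^sub>s\<^sub>I\<^sub>,\<^sub>J(z, \<mu>)\<close> for a simple reflection \<open>s\<close>, and it is proved level by
  level from the Weierstrass three-term identity of \<open>\<theta>\<close>. The second one changes \<open>\<mu>\<close> and the columns: it
  relates \<open>A\<^sub>I\<^sub>s\<^sub>,\<^sub>J(z, \<mu>s)\<close>, \<open>A\<^sub>I\<^sub>,\<^sub>J(z, \<mu>)\<close> and \<open>A\<^sub>I\<^sub>,\<^sub>J\<^sub>s(z, \<mu>)\<close>. Its defect satisfies the first recursion, since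
  left and right multiplications commute, and it vanishes for \<open>I = id\<close>. The mirror map exchanges the two
  recursions, so both sides of the theorem satisfy the first one, and they agree for \<open>I = id\<close>, where both
  are diagonal.

  This gives the equality where both \<open>z\<close> and \<open>\<mu>\<close> are generic. The two sides are continuous where \<open>z\<close>,
  respectively \<open>\<mu>\<close>, is generic, so their limits at an arbitrary point exist simultaneously and agree.
\<close>

section \<open>The theta function\<close>

text \<open>Labels by positions suit the row recursion: \<open>s I\<close> is \<open>I\<close>
  composed with the transposition of the two positions \<open>a < b\<close> that carry the values
  \<open>m\<close> and \<open>m + 1\<close>. Weights on fewer than \<open>b\<close> positions do not
  see the change, and from there on the swapped variables meet in a 2x2 block of factors; the
  remaining factors of a level are together symmetric in them. In the row recursion the term of row
  \<open>s I\<close> has the coefficient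
  \<open>\<theta> (h + M) * \<theta> (z m - z (Suc m))\<close>. It is nonzero when \<open>z\<close>
  and \<open>\<mu>\<close> are both generic, and then row \<open>I\<close> determines row
  \<open>s I\<close>. This needs row \<open>I\<close> at two points, \<open>(J, z)\<close> and
  \<open>(s J, z s)\<close>, so the inductions on \<open>I\<close> keep \<open>J\<close> and
  \<open>z\<close> arbitrary and \<open>\<mu>\<close> fixed. The mirror map exchanges the recursions
  because inversion turns left multiplication by \<open>s\<close> into right multiplication, and
  because replacing the Kaehler parameters by \<open>- z\<close> turns
  \<open>h + \<mu> (Suc m) - \<mu> m\<close> into \<open>h + z m - z (Suc m)\<close>.\<close>

lemma convergent_prod_phi:
  fixes q x :: complex
  assumes "norm q < 1"
  shows "convergent_prod (\<lambda>s. 1 - q ^ s * x)"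
proof -
  have "summable (\<lambda>s. norm ((1 - q ^ s * x) - 1))"
    using assms by (simp add: norm_mult norm_power summable_mult2 summable_geometric)
  then show ?thesis
    using abs_convergent_prod_conv_summable abs_convergent_prod_imp_convergent_prod by blast
qed

lemma phi_split_head:
  assumes "norm q < 1"
  shows "phi q x = (1 - x) * phi q (q * x)"
proof -
  have eq: "(\<lambda>s. 1 - q ^ s * (q * x)) = (\<lambda>s. 1 - q ^ Suc s * x)"
    by (simp add: fun_eq_iff mult_ac)
  have "(\<lambda>s. 1 - q ^ Suc s * x) has_prod phi q (q * x)"
    using convergent_prod_has_prod[OF convergent_prod_phi[OF assms, of "q * x"]]
    unfolding phi_def eq .
  from has_prod_Suc_imp[OF this] show ?thesis
    by (simp add: phi_def has_prod_unique[symmetric] mult.commute)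
qed

lemma phi_eq_0_iff:
  assumes "norm q < 1"
  shows "phi q x = 0 \<longleftrightarrow> (\<exists>s. q ^ s * x = 1)"
  unfolding phi_def has_prod_eq_0_iff[OF convergent_prod_has_prod[OF convergent_prod_phi[OF assms]]]
  by (auto simp: image_iff)

lemma holomorphic_phi:
  assumes "norm q < 1"
  shows "phi q holomorphic_on UNIV"
proof (rule holomorphic_uniform_sequence)
  fix x :: complex
  have "uniformly_convergent_on (cball x 1) (\<lambda>N x. \<Prod>s<N. 1 - q ^ s * x)"
  proof (rule uniformly_convergent_on_prod')
    have "uniformly_convergent_on (cball x 1) (\<lambda>N y. \<Sum>s<N. norm q ^ s * norm y)"
    proof (rule Weierstrass_m_test')
      show "norm (norm q ^ s * norm y) \<le> norm q ^ s * (norm x + 1)" if "y \<in> cball x 1" for s y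
      proof -
        have "norm y \<le> norm x + 1"
          using that norm_triangle_sub[of y x] by (simp add: dist_norm norm_minus_commute)
        then show ?thesis
          by (simp add: mult_left_mono norm_mult norm_power)
      qed
      show "summable (\<lambda>s. norm q ^ s * (norm x + 1))"
        using assms by (simp add: summable_mult2 summable_geometric)
    qed
    then show "uniformly_convergent_on (cball x 1) (\<lambda>N y. \<Sum>s<N. norm (1 - q ^ s * y - 1))"
      by (simp add: norm_mult norm_power)
  qed (auto intro!: continuous_intros)
  then obtain g where g: "uniform_limit (cball x 1) (\<lambda>N x. \<Prod>s<N. 1 - q ^ s * x) g sequentially"
    using uniformly_convergent_on_def by blast
  have "g y = phi q y" if "y \<in> cball x 1" for y
  proof -
    have "(\<lambda>N. \<Prod>s<N. 1 - q ^ s * y) \<longlonglongrightarrow> g y"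
      using tendsto_uniform_limitI[OF g that] .
    then have "(\<lambda>N. \<Prod>s\<le>N. 1 - q ^ s * y) \<longlonglongrightarrow> g y"
      using LIMSEQ_Suc[of "\<lambda>N. \<Prod>s<N. 1 - q ^ s * y"] by (simp only: lessThan_Suc_atMost)
    moreover have "(\<lambda>N. \<Prod>s\<le>N. 1 - q ^ s * y) \<longlonglongrightarrow> phi q y"
      unfolding phi_def by (rule convergent_prod_LIMSEQ[OF convergent_prod_phi[OF assms]])
    ultimately show ?thesis
      by (rule LIMSEQ_unique)
  qed
  then have "uniform_limit (cball x 1) (\<lambda>N x. \<Prod>s<N. 1 - q ^ s * x) (phi q) sequentially"
    using g by (metis (no_types, lifting) uniform_limit_cong')
  then show "\<exists>d>0. cball x d \<subseteq> UNIV \<and> uniform_limit (cball x d) (\<lambda>N x. \<Prod>s<N. 1 - q ^ s * x) (phi q) sequentially"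
    by (intro exI[of _ 1]) auto
qed (auto intro!: holomorphic_intros)

section \<open>Quasi-periods and zeros of theta\<close>

lemma theta_minus: "theta q (- u) = - theta q u"
  by (simp add: theta_def algebra_simps)

lemma theta_0 [simp]: "theta q 0 = 0"
  by (simp add: theta_def)

lemma holomorphic_theta:
  assumes "norm q < 1"
  shows "theta q holomorphic_on UNIV"
proof -
  have *: "(\<lambda>u. phi q (f u)) holomorphic_on UNIV" if "f holomorphic_on UNIV" for f
    using holomorphic_on_compose_gen[OF that holomorphic_phi[OF assms]] by (simp add: o_def)
  show ?thesis
    unfolding theta_def by (intro holomorphic_intros *) auto
qed

lemma theta_add_2pi_i: "theta q (u + 2 * pi * \<i>) = - theta q u"
proof -
  have a: "exp (u + 2 * pi * \<i>) = exp u" "exp (- (u + 2 * pi * \<i>)) = exp (- u)"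
    by (simp_all add: exp_add exp_diff exp_minus)
  have "exp ((u + 2 * pi * \<i>) / 2) = exp (u / 2 + pi * \<i>)" by (simp add: add_divide_distrib)
  then have b: "exp ((u + 2 * pi * \<i>) / 2) = - exp (u / 2)" by (simp add: exp_add)
  have "exp (- (u + 2 * pi * \<i>) / 2) = exp (- u / 2 - pi * \<i>)" by (simp add: add_divide_distrib diff_divide_distrib)
  then have c: "exp (- (u + 2 * pi * \<i>) / 2) = - exp (- u / 2)" by (simp add: exp_diff)
  show ?thesis
    unfolding theta_def a b c by (simp add: algebra_simps)
qed

lemma theta_add_Ln:
  assumes "q \<noteq> 0" "norm q < 1"
  shows "theta q (u + Ln q) = - exp (- u - Ln q / 2) * theta q u"
proof -
  \<comment> \<open>Square roots \<open>e\<close> of \<open>exp u\<close> and \<open>r\<close> of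
    \<open>q\<close>: in them the shift becomes an identity of rational functions, once
    \<open>phi_split_head\<close> has split off the first factors of the two products.\<close>
  define e where "e = exp (u / 2)"
  define r where "r = exp (Ln q / 2)"
  have e0: "e \<noteq> 0" "r \<noteq> 0" by (simp_all add: e_def r_def)
  have eu: "exp u = e\<^sup>2"
    by (simp add: e_def power2_eq_square flip: exp_add)
  have eu': "exp (- u) = 1 / e\<^sup>2"
    by (simp add: exp_minus eu inverse_eq_divide)
  have eh: "exp (u / 2) = e" "exp (- u / 2) = 1 / e"
    by (simp_all add: e_def exp_minus inverse_eq_divide)
  have q: "q = r\<^sup>2"
    using assms by (simp add: r_def power2_eq_square flip: exp_add)
  have f1: "exp (u + Ln q) = q * exp u"
    using assms(1) by (simp add: exp_add)
  have f2: "exp (- (u + Ln q)) = exp (- u) / q"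
    using assms(1) by (simp add: exp_diff)
  have f3: "exp ((u + Ln q) / 2) = e * r"
    by (simp only: add_divide_distrib exp_add e_def r_def)
  have f4: "exp (- (u + Ln q) / 2) = 1 / (e * r)"
    by (simp only: minus_divide_left[symmetric] exp_minus f3 inverse_eq_divide)
  have "exp (- u - Ln q / 2) = exp (- u) * inverse r"
    by (simp only: diff_conv_add_uminus exp_add exp_minus r_def)
  then have f5: "exp (- u - Ln q / 2) = 1 / (e\<^sup>2 * r)"
    by (simp add: eu' inverse_eq_divide)
  have p1: "phi q (q * exp u) = (1 - q * exp u) * phi q (q * (q * exp u))"
    by (rule phi_split_head[OF assms(2)])
  have p2: "phi q (q * (exp (- u) / q)) = (1 - exp (- u)) * phi q (q * exp (- u))"
    using phi_split_head[OF assms(2), of "exp (-u)"] assms(1) by simp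
  have "theta q (u + Ln q) = (e * r - 1 / (e * r)) * phi q (q * (q * exp u)) * ((1 - exp (- u)) * phi q (q * exp (- u)))"
    unfolding theta_def f1 f2 f3 f4 p2 ..
  also have "(e * r - 1 / (e * r)) = - (1 / (e * r)) * (1 - q * exp u)"
    unfolding eu q using e0 by (simp add: field_simps power2_eq_square)
  also have "1 - exp (-u) = (1 / e) * (e - 1 / e)"
    unfolding eu' using e0 by (simp add: field_simps power2_eq_square)
  finally have L: "theta q (u + Ln q) = - (1 / (e * r)) * (1 - q * exp u) * phi q (q * (q * exp u)) *
      (1 / e * (e - 1 / e) * phi q (q * exp (- u)))" .
  have T: "theta q u = (e - 1 / e) * ((1 - q * exp u) * phi q (q * (q * exp u))) * phi q (q * exp (- u))"
    unfolding theta_def eh p1 ..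
  show ?thesis
    unfolding L T f5 using e0 by (simp add: power2_eq_square mult_ac)
qed

text \<open>Only applied to entire functions, where \<open>deriv\<close> is the true derivative.
  Simplicity of the zeros of a denominator is what makes the quotient below entire.\<close>

definition simple_zero :: "(complex \<Rightarrow> complex) \<Rightarrow> complex \<Rightarrow> bool" where
  "simple_zero f p \<longleftrightarrow> f p = 0 \<and> deriv f p \<noteq> 0"

text \<open>At a zero of \<open>f\<close> the product rule leaves only
  \<open>deriv f p * g p\<close>, so translation by a quasi-period preserves simple zeros.\<close>

lemma simple_zero_shift:
  assumes f: "f holomorphic_on UNIV" and g: "g holomorphic_on UNIV"
    and "\<And>u. f (u + w) = g u * f u" and "g p \<noteq> 0"
  shows "simple_zero f (p + w) \<longleftrightarrow> simple_zero f p"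
proof -
  have df: "(f has_field_derivative deriv f u) (at u)" for u
    using f by (simp add: holomorphic_derivI)
  have dg: "(g has_field_derivative deriv g u) (at u)" for u
    using g by (simp add: holomorphic_derivI)
  have "((\<lambda>u. f (u + w)) has_field_derivative deriv f (p + w)) (at p)"
    using df[of "p + w"] by (simp add: DERIV_shift)
  moreover have "((\<lambda>u. g u * f u) has_field_derivative (deriv g p * f p + deriv f p * g p)) (at p)"
    by (rule DERIV_mult[OF dg df])
  ultimately have "deriv f (p + w) = deriv g p * f p + deriv f p * g p"
    using assms(3) by (simp add: DERIV_unique)
  then show ?thesis
    using assms(3)[of p] assms(4) by (auto simp: simple_zero_def)
qed

text \<open>At 0 the derivative of \<open>theta q\<close> is the square of \<open>phi q q\<close>,
  which is nonzero because \<open>norm q < 1\<close> excludes \<open>q ^ Suc s = 1\<close>. The two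
  quasi-periods carry this simple zero to every lattice point.\<close>

lemma simple_zero_theta_lattice:
  assumes q: "q \<noteq> 0" "norm q < 1"
  shows "simple_zero (theta q) (of_int m * Ln q + of_int k * (2 * pi * \<i>))"
proof -
  note hol = holomorphic_theta[OF q(2)]
  have sh1: "simple_zero (theta q) (p + Ln q) \<longleftrightarrow> simple_zero (theta q) p" for p
    by (rule simple_zero_shift[OF hol _ theta_add_Ln[OF q]]) (auto intro!: holomorphic_intros)
  have sh2: "simple_zero (theta q) (p + 2 * pi * \<i>) \<longleftrightarrow> simple_zero (theta q) p" for p
    by (rule simple_zero_shift[OF hol, where g = "\<lambda>_. - 1"]) (simp_all add: theta_add_2pi_i[simplified])
  have "((\<lambda>u. phi q (q * exp u) * phi q (q * exp (- u))) has_field_derivative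
      deriv (\<lambda>u. phi q (q * exp u) * phi q (q * exp (- u))) 0) (at 0)"
  proof (rule holomorphic_derivI[where S = UNIV])
    have *: "(\<lambda>u. phi q (f u)) holomorphic_on UNIV" if "f holomorphic_on UNIV" for f
      using holomorphic_on_compose_gen[OF that holomorphic_phi[OF q(2)]] by (simp add: o_def)
    show "(\<lambda>u. phi q (q * exp u) * phi q (q * exp (- u))) holomorphic_on UNIV"
      by (intro holomorphic_intros *)
  qed auto
  moreover have "((\<lambda>u. exp (u / 2) - exp (- u / 2)) has_field_derivative 1) (at (0::complex))"
    by (auto intro!: derivative_eq_intros)
  ultimately have "((\<lambda>u. (exp (u / 2) - exp (- u / 2)) * (phi q (q * exp u) * phi q (q * exp (- u))))
      has_field_derivative phi q q * phi q q) (at 0)"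
    using DERIV_mult by fastforce
  then have "(theta q has_field_derivative phi q q * phi q q) (at 0)"
    by (simp add: theta_def[abs_def] mult.assoc)
  moreover have "phi q q \<noteq> 0"
  proof
    assume "phi q q = 0"
    then obtain s where "q ^ Suc s = 1" using phi_eq_0_iff[OF q(2)] by (auto simp: mult.commute)
    then have "norm q ^ Suc s = 1" by (metis norm_one norm_power)
    then show False using q(2) power_Suc_less_one[of "norm q" s] by (metis less_irrefl norm_ge_zero power_less_one_iff zero_less_Suc)
  qed
  ultimately have "simple_zero (theta q) 0"
    by (simp add: simple_zero_def DERIV_imp_deriv)
  then have "simple_zero (theta q) (of_int m * Ln q)"
  proof (induction m rule: int_induct[where k = 0])
    case (step1 i)
    then show ?case using sh1[of "of_int i * Ln q"] by (simp add: algebra_simps)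
  next
    case (step2 i)
    then show ?case using sh1[of "of_int (i - 1) * Ln q"] by (simp add: algebra_simps)
  qed simp
  then show ?thesis
  proof (induction k rule: int_induct[where k = 0])
    case (step1 i)
    then show ?case using sh2[of "of_int m * Ln q + of_int i * (2 * pi * \<i>)"] by (simp add: algebra_simps)
  next
    case (step2 i)
    then show ?case using sh2[of "of_int m * Ln q + of_int (i - 1) * (2 * pi * \<i>)"] by (simp add: algebra_simps)
  qed simp
qed

text \<open>A convergent infinite product vanishes only if one of its factors does. Each factor
  fixes \<open>exp u\<close> as a power of \<open>q\<close>, and this determines \<open>u\<close> up
  to multiples of \<open>2 * pi * \<i>\<close>.\<close>

lemma theta_zero_in_lattice:
  assumes q: "q \<noteq> 0" "norm q < 1" and "theta q u = 0"
  obtains m k :: int where "u = of_int m * Ln q + of_int k * (2 * pi * \<i>)"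
proof -
  have "\<exists>m::int. exp u = exp (of_int m * Ln q)"
  proof -
    consider "exp (u/2) = exp (-u/2)" | "phi q (q * exp u) = 0" | "phi q (q * exp (- u)) = 0"
      using assms(3) by (auto simp: theta_def)
    then show ?thesis
    proof cases
      case 1
      then have "exp (u/2) * exp (u/2) = exp (-u/2) * exp (u/2)" by simp
      then have "exp u = 1" by (simp flip: exp_add)
      then show ?thesis by (intro exI[of _ 0]) simp
    next
      case 2
      then obtain s where "q ^ s * (q * exp u) = 1" using phi_eq_0_iff[OF q(2)] by auto
      then have "exp (of_nat (Suc s) * Ln q) * exp u = 1"
        using q(1) by (simp only: exp_of_nat_mult exp_Ln power_Suc2 mult.assoc simp_thms)
      then have "exp u = exp (- (of_nat (Suc s) * Ln q))"
        unfolding exp_minus by (rule inverse_unique[symmetric])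
      then show ?thesis by (intro exI[of _ "- int (Suc s)"]) (simp only: of_int_minus of_int_of_nat_eq minus_mult_left)
    next
      case 3
      then obtain s where "q ^ s * (q * exp (- u)) = 1" using phi_eq_0_iff[OF q(2)] by auto
      then have "exp (of_nat (Suc s) * Ln q) * exp (-u) = 1"
        using q(1) by (simp only: exp_of_nat_mult exp_Ln power_Suc2 mult.assoc simp_thms)
      then have "exp (of_nat (Suc s) * Ln q) = inverse (exp (- u))"
        by (metis inverse_unique mult.commute)
      then have "exp u = exp (of_nat (Suc s) * Ln q)"
        by (simp only: exp_minus inverse_inverse_eq)
      then show ?thesis by (intro exI[of _ "int (Suc s)"]) simp
    qed
  qed
  then obtain m :: int where "exp u = exp (of_int m * Ln q)" by blast
  then obtain k :: int where "u = of_int m * Ln q + of_real (of_int (2 * k) * pi) * \<i>"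
    unfolding exp_eq by blast
  then have "u = of_int m * Ln q + of_int k * (2 * pi * \<i>)"
    by simp
  then show ?thesis by (rule that)
qed

lemma countable_theta_zeros:
  assumes "q \<noteq> 0" "norm q < 1"
  shows "countable {u. theta q u = 0}"
proof -
  have "{u. theta q u = 0} \<subseteq> (\<lambda>(m::int, k::int). of_int m * Ln q + of_int k * (2 * pi * \<i>)) ` UNIV"
  proof
    fix u assume "u \<in> {u. theta q u = 0}"
    then obtain m k :: int where "u = of_int m * Ln q + of_int k * (2 * pi * \<i>)"
      using theta_zero_in_lattice[OF assms] by auto
    then show "u \<in> (\<lambda>(m::int, k::int). of_int m * Ln q + of_int k * (2 * pi * \<i>)) ` UNIV"
      by (intro image_eqI[of _ _ "(m, k)"]) simp_all
  qed
  then show ?thesis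
    by (rule countable_subset) (rule countable_image, simp)
qed

lemma theta_zero_diff:
  assumes "q \<noteq> 0" "norm q < 1" "theta q u = 0" "theta q v = 0"
  shows "theta q (u - v) = 0"
proof -
  obtain m k :: int where u: "u = of_int m * Ln q + of_int k * (2 * pi * \<i>)"
    using theta_zero_in_lattice[OF assms(1-3)] .
  obtain m' k' :: int where v: "v = of_int m' * Ln q + of_int k' * (2 * pi * \<i>)"
    using theta_zero_in_lattice[OF assms(1,2,4)] .
  show ?thesis
    using simple_zero_theta_lattice[OF assms(1,2), of "m - m'" "k - k'"]
    by (simp add: u v simple_zero_def algebra_simps)
qed

lemma simple_zero_theta:
  assumes "q \<noteq> 0" "norm q < 1" "theta q u = 0"
  shows "deriv (theta q) u \<noteq> 0"
  using theta_zero_in_lattice[OF assms] simple_zero_theta_lattice[OF assms(1,2)] simple_zero_def by metis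

section \<open>Entire functions: quotients, equality off a countable set, double periodicity\<close>

lemma entire_quotient:
  assumes f: "f holomorphic_on UNIV" and g: "g holomorphic_on UNIV"
    and zeros: "\<And>p. g p = 0 \<Longrightarrow> f p = 0 \<and> simple_zero g p"
  obtains h where "h holomorphic_on UNIV" "\<And>x. f x = h x * g x"
proof
  \<comment> \<open>At a common zero the value is the one predicted by l'Hopital's rule, so
    \<open>Q\<close> is already the holomorphic extension.\<close>
  define Q where "Q x = (if g x = 0 then deriv f x / deriv g x else f x / g x)" for x
  have "Q field_differentiable at p" for p
  proof -
    \<comment> \<open>Difference quotients at \<open>p\<close>, completed by the derivative. Near a
      zero \<open>p\<close> of \<open>g\<close> they represent \<open>Q\<close> as
      \<open>f1 / g1\<close>, with \<open>g1 p\<close> nonzero.\<close>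
    define f1 where "f1 x = (if x = p then deriv f p else (f x - f p) / (x - p))" for x
    define g1 where "g1 x = (if x = p then deriv g p else (g x - g p) / (x - p))" for x
    show ?thesis
    proof (cases "g p = 0")
      case False
      have "open {x. g x \<noteq> 0}"
        using g by (intro open_Collect_neq holomorphic_on_imp_continuous_on) auto
      moreover have "(\<lambda>x. f x / g x) holomorphic_on {x. g x \<noteq> 0}"
        using f g by (auto intro!: holomorphic_intros elim: holomorphic_on_subset)
      then have "Q holomorphic_on {x. g x \<noteq> 0}"
        by (rule holomorphic_transform) (auto simp: Q_def)
      ultimately show ?thesis
        using False holomorphic_on_imp_differentiable_at by blast
    next
      case True
      have hol: "f1 holomorphic_on UNIV" "g1 holomorphic_on UNIV"
        unfolding f1_def g1_def using f g by (auto intro: pole_lemma)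
      have fg: "f p = 0" "deriv g p \<noteq> 0"
        using zeros[OF True] by (auto simp: simple_zero_def)
      have op: "open {x. g1 x \<noteq> 0}"
        using hol(2) by (intro open_Collect_neq holomorphic_on_imp_continuous_on) auto
      have "(\<lambda>x. f1 x / g1 x) holomorphic_on {x. g1 x \<noteq> 0}"
        using hol by (auto intro!: holomorphic_intros elim: holomorphic_on_subset)
      then have "Q holomorphic_on {x. g1 x \<noteq> 0}"
        by (rule holomorphic_transform) (auto simp: Q_def f1_def g1_def True fg)
      then show ?thesis
        using op fg holomorphic_on_imp_differentiable_at by (fastforce simp: g1_def)
    qed
  qed
  then show "Q holomorphic_on UNIV"
    by (simp add: holomorphic_on_def field_differentiable_at_within)
  show "f x = Q x * g x" for x
    using zeros[of x] by (auto simp: Q_def)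
qed

text \<open>The set where the two functions differ is open, and a ball is uncountable.\<close>

lemma entire_eqI_countable:
  assumes f: "f holomorphic_on UNIV" and g: "g holomorphic_on UNIV"
    and "countable S" and eq: "\<And>x. x \<notin> S \<Longrightarrow> f x = g x"
  shows "f x = g x"
proof (rule ccontr)
  assume "f x \<noteq> g x"
  moreover have "open {x. f x \<noteq> g x}"
    using f g by (intro open_Collect_neq holomorphic_on_imp_continuous_on) auto
  ultimately obtain e where "e > 0" "ball x e \<subseteq> {x. f x \<noteq> g x}"
    by (auto simp: open_contains_ball)
  moreover have "\<not> ball x e \<subseteq> S"
    using uncountable_ball[OF \<open>e > 0\<close>] \<open>countable S\<close> countable_subset by blast
  ultimately show False using eq by blast
qed

text \<open>Liouville's theorem: all values are taken on the compact parallelogram \<open>K\<close>.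
  The conditions on \<open>a\<close> and \<open>b\<close> are linear independence over the reals in
  the form it has for \<open>Ln q\<close> and \<open>2 * pi * \<i>\<close>.\<close>

lemma doubly_periodic_entire_constant:
  assumes hol: "f holomorphic_on UNIV"
    and per: "\<And>x. f (x + a) = f x" "\<And>x. f (x + b) = f x"
    and a: "Re a \<noteq> 0" and b: "Re b = 0" "Im b \<noteq> 0"
  shows "f x = f y"
proof -
  have pa: "f (x + of_int m * a) = f x" for x m
  proof (induction m rule: int_induct[where k = 0])
    case (step1 i)
    then show ?case using per(1)[of "x + of_int i * a"] by (simp add: algebra_simps)
  next
    case (step2 i)
    then show ?case using per(1)[of "x + of_int (i - 1) * a"] by (simp add: algebra_simps)
  qed simp
  have pb: "f (x + of_int m * b) = f x" for x m
  proof (induction m rule: int_induct[where k = 0])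
    case (step1 i)
    then show ?case using per(2)[of "x + of_int i * b"] by (simp add: algebra_simps)
  next
    case (step2 i)
    then show ?case using per(2)[of "x + of_int (i - 1) * b"] by (simp add: algebra_simps)
  qed simp
  define K where "K = (\<lambda>(s, t). of_real s * a + of_real t * b) ` ({0..1} \<times> {0..1::real})"
  have "compact K"
    unfolding K_def
    by (intro compact_continuous_image compact_Times) (auto intro!: continuous_intros simp: case_prod_beta)
  then have "bounded (f ` K)"
    using hol by (meson compact_continuous_image compact_imp_bounded continuous_on_subset
        holomorphic_on_imp_continuous_on subset_UNIV)
  moreover have "range f \<subseteq> f ` K"
  proof safe
    fix x
    define s where "s = Re x / Re a"
    define t where "t = (Im x - s * Im a) / Im b"
    have x: "x = of_real s * a + of_real t * b"
      using a b by (simp add: complex_eq_iff s_def t_def)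
    have "f x = f (of_real (frac s) * a + of_real (frac t) * b)"
      using pb[of "of_real (frac s) * a + of_real (frac t) * b" "\<lfloor>t\<rfloor>"]
        pa[of "of_real (frac s) * a + of_real t * b" "\<lfloor>s\<rfloor>"]
      by (simp add: x frac_def algebra_simps)
    moreover have "of_real (frac s) * a + of_real (frac t) * b \<in> K"
      unfolding K_def by (intro image_eqI[of _ _ "(frac s, frac t)"]) (auto simp: frac_lt_1 less_imp_le)
    ultimately show "f x \<in> f ` K" by simp
  qed
  ultimately have "bounded (range f)"
    by (rule bounded_subset)
  then show ?thesis
    using Liouville_theorem[OF hol] by (auto simp: constant_on_def)
qed

text \<open>As functions of \<open>x\<close>, the three terms have the same quasi-periods, and their alternating sum
  vanishes at the zeros of \<open>\<vartheta>(x + z) \<vartheta>(x - z)\<close>. The quotient is an elliptic function without poles, hence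
  constant, and it vanishes at \<open>x = y\<close>.\<close>

lemma theta_three_term:
  assumes q: "q \<noteq> 0" "norm q < 1"
  defines "f \<equiv> \<lambda>x y. theta q (x + y) * theta q (x - y)"
  shows "f x z * f y w = f x y * f z w + f x w * f y z"
proof -
  note hol = holomorphic_theta[OF q(2)]
  have hol': "(\<lambda>u. theta q (g u)) holomorphic_on UNIV" if "g holomorphic_on UNIV" for g
    using holomorphic_on_compose_gen[OF that hol] by (simp add: o_def)
  have anti: "f y x = - f x y" for x y
    using theta_minus[of q "x - y"] by (simp add: f_def add.commute)
  have even: "f (- x) y = f x y" for x y
    using theta_minus[of q "x - y"] theta_minus[of q "x + y"] by (simp add: f_def)
  \<comment> \<open>Translation by \<open>a\<close> in the first argument multiplies
    \<open>f\<close> by a nonvanishing \<open>g\<close> independent of the second argument. Each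
    term of the identity contains \<open>x\<close> in exactly one \<open>f\<close>, so all three get
    the same multiplier. Such \<open>a\<close> form a group that contains \<open>Ln q\<close> and
    \<open>2 * pi * \<i>\<close>, hence every zero of theta.\<close>
  let ?factor = "\<lambda>a g. (\<forall>x y. f (x + a) y = g x * f x y) \<and> (\<forall>x. g x \<noteq> 0)"
  have add: "\<exists>g. ?factor (a + b) g" if "\<exists>g. ?factor a g" "\<exists>g. ?factor b g" for a b
  proof -
    from that(1) obtain g where g: "?factor a g" ..
    from that(2) obtain g' where g': "?factor b g'" ..
    have "?factor (a + b) (\<lambda>x. g' (x + a) * g x)"
      using g g' by (simp flip: add.assoc)
    then show ?thesis by (rule exI[where x = "\<lambda>x. g' (x + a) * g x"])
  qed
  have minus: "\<exists>g. ?factor (- a) g" if "\<exists>g. ?factor a g" for a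
  proof -
    from that obtain g where g: "?factor a g" ..
    have "f (x + - a) y = 1 / g (x - a) * f x y" for x y
      using g[THEN conjunct1, rule_format, of "x - a" y] g[THEN conjunct2, rule_format, of "x - a"] by simp
    then have "?factor (- a) (\<lambda>x. 1 / g (x - a))"
      using g by simp
    then show ?thesis by (rule exI[where x = "\<lambda>x. 1 / g (x - a)"])
  qed
  have zero: "\<exists>g. ?factor 0 g"
    by (rule exI[of _ "\<lambda>_. 1"]) simp
  have mult: "\<exists>g. ?factor (of_int m * a) g" if "\<exists>g. ?factor a g" for a and m :: int
  proof (induction m rule: int_induct[where k = 0])
    case (step1 i)
    from add[OF step1(2) that] show ?case
      by (simp only: of_int_add of_int_1 distrib_right mult_1_left)
  next
    case (step2 i)
    from add[OF step2(2) minus[OF that]] show ?case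
      by (simp only: of_int_diff of_int_1 left_diff_distrib mult_1_left diff_conv_add_uminus[of "of_int i * a"])
  qed (use zero in \<open>simp only: of_int_0 mult_zero_left\<close>)
  have shift: "x + a + y = x + y + a" "x + a - y = x - y + a" for x y a :: complex
    by simp_all
  have "f (x + Ln q) y = exp (- 2 * x - Ln q) * f x y" for x y
  proof -
    have "exp (- (x + y) - Ln q / 2) * exp (- (x - y) - Ln q / 2) = exp (- 2 * x - Ln q)"
      by (simp flip: exp_add)
    moreover have "f (x + Ln q) y = exp (- (x + y) - Ln q / 2) * exp (- (x - y) - Ln q / 2) * f x y"
      by (simp only: f_def shift theta_add_Ln[OF q]) simp
    ultimately show ?thesis by simp
  qed
  then have per1: "\<exists>g. ?factor (Ln q) g"
    by (intro exI[of _ "\<lambda>x. exp (- 2 * x - Ln q)"] conjI allI) simp_all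
  have "f (x + 2 * pi * \<i>) y = 1 * f x y" for x y
    by (simp only: f_def shift theta_add_2pi_i) simp
  then have per2: "\<exists>g. ?factor (2 * pi * \<i>) g"
    by (intro exI[of _ "\<lambda>x. 1"] conjI allI) simp_all
  have period: "\<exists>g. ?factor a g" if "theta q a = 0" for a
    using theta_zero_in_lattice[OF q that] add[OF mult[OF per1] mult[OF per2]] by metis
  \<comment> \<open>The first condition keeps the zeros of the two factors of \<open>f x z\<close>
    apart, so that they are simple; the second one allows the quotient to be evaluated at
    \<open>x = y\<close>.\<close>
  have generic: "f x z * f y w = f x y * f z w + f x w * f y z"
    if nz: "theta q (2 * z) \<noteq> 0" "f y z \<noteq> 0" for z
  proof -
    define H where "H x = f x z * f y w - f x y * f z w - f x w * f y z" for x
    define D where "D x = f x z" for x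
    have holH: "H holomorphic_on UNIV" and holD: "D holomorphic_on UNIV"
      unfolding H_def D_def f_def by (intro holomorphic_intros hol')+
    have "H z = 0"
      using anti[of z y] by (simp add: H_def) (simp add: f_def)
    have Hz: "H p = 0" if "D p = 0" for p
    proof -
      have "theta q (p + z) = 0 \<or> theta q (p - z) = 0"
        using that by (simp add: D_def f_def)
      then obtain a z' where a: "theta q a = 0" "p = z' + a" and z': "z' = z \<or> z' = - z"
        by (metis add.commute add_diff_cancel diff_add_cancel uminus_add_conv_diff)
      obtain g where g: "\<And>x y. f (x + a) y = g x * f x y"
        using period[OF a(1)] by auto
      then have "H p = g z' * H z'"
        by (simp only: H_def a(2) g) (simp add: algebra_simps)
      then show ?thesis using \<open>H z = 0\<close> z' by (auto simp: H_def even)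
    qed
    have simp: "simple_zero D p" if "D p = 0" for p
    proof -
      have d: "(theta q has_field_derivative deriv (theta q) u) (at u)" for u
        using hol by (simp add: holomorphic_derivI)
      have "((\<lambda>x. theta q (x + z)) has_field_derivative deriv (theta q) (p + z)) (at p)"
        using DERIV_shift[of "theta q" "deriv (theta q) (p + z)" p z] d[of "p + z"] by simp
      moreover have "((\<lambda>x. theta q (x - z)) has_field_derivative deriv (theta q) (p - z)) (at p)"
        using DERIV_shift[of "theta q" "deriv (theta q) (p - z)" p "- z"] d[of "p - z"] by simp
      ultimately have "((\<lambda>x. theta q (x + z) * theta q (x - z)) has_field_derivative
          deriv (theta q) (p + z) * theta q (p - z) + deriv (theta q) (p - z) * theta q (p + z)) (at p)"
        by (rule DERIV_mult)
      then have d: "deriv D p = deriv (theta q) (p + z) * theta q (p - z) + deriv (theta q) (p - z) * theta q (p + z)"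
        unfolding D_def f_def by (rule DERIV_imp_deriv)
      \<comment> \<open>If both factors vanished, theta would vanish at their difference
        \<open>2 * z\<close>.\<close>
      have "\<not> (theta q (p + z) = 0 \<and> theta q (p - z) = 0)"
        using theta_zero_diff[OF q, of "p + z" "p - z"] nz(1) by auto
      then show ?thesis
        using that simple_zero_theta[OF q] d by (auto simp: simple_zero_def D_def f_def)
    qed
    obtain Q where Q: "Q holomorphic_on UNIV" "\<And>x. H x = Q x * D x"
      using entire_quotient[OF holH holD] Hz simp by blast
    have per: "Q (x + a) = Q x" if a: "\<exists>g. ?factor a g" for x a
    proof (rule entire_eqI_countable[where f = "\<lambda>x. Q (x + a)" and S = "{x. D x = 0}"])
      show "(\<lambda>x. Q (x + a)) holomorphic_on UNIV"
        by (rule holomorphic_on_compose_gen[of "\<lambda>x. x + a" UNIV Q UNIV, unfolded o_def])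
          (auto intro!: holomorphic_intros Q(1))
      have "{x. D x = 0} = (\<lambda>u. u - z) ` {u. theta q u = 0} \<union> (\<lambda>u. u + z) ` {u. theta q u = 0}"
        by (force simp: D_def f_def image_iff)
      then show "countable {x. D x = 0}"
        using countable_theta_zeros[OF q] by simp
      show "Q (x + a) = Q x" if "x \<notin> {x. D x = 0}" for x
      proof -
        obtain g where g: "\<And>x y. f (x + a) y = g x * f x y" "\<And>x. g x \<noteq> 0" using a by auto
        have "H (x + a) = g x * H x" by (simp only: H_def g(1)) (simp add: algebra_simps)
        moreover have "D (x + a) = g x * D x" by (simp add: D_def g(1))
        ultimately show ?thesis using Q(2)[of x] Q(2)[of "x + a"] g(2)[of x] that by simp
      qed
    qed (rule Q(1))
    have "Q x = Q y"
    proof (rule doubly_periodic_entire_constant[where f = Q and a = "Ln q" and b = "2 * pi * \<i>"])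
      show "Q (x + Ln q) = Q x" "Q (x + 2 * pi * \<i>) = Q x" for x
        using per[OF per1] per[OF per2] by auto
      show "Re (Ln q) \<noteq> 0" using q by simp
    qed (use Q in auto)
    moreover have "Q y = 0"
    proof -
      have "H y = 0" using theta_0 by (simp add: H_def anti[of z y] f_def)
      then show ?thesis using Q(2)[of y] nz(2) by (simp add: D_def)
    qed
    ultimately have "H x = 0" using Q(2) by simp
    then show ?thesis by (simp add: H_def algebra_simps)
  qed
  show ?thesis
  proof (rule entire_eqI_countable[where f = "\<lambda>z. f x z * f y w"])
    \<comment> \<open>Both sides are entire in \<open>z\<close>, and only countably many
      \<open>z\<close> violate the two conditions.\<close>
    let ?Z = "{u. theta q u = 0}"
    show "countable ((\<lambda>u. u / 2) ` ?Z \<union> (\<lambda>u. u - y) ` ?Z \<union> (\<lambda>u. y - u) ` ?Z)"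
      using countable_theta_zeros[OF q] by simp
    show "f x z * f y w = f x y * f z w + f x w * f y z"
      if "z \<notin> (\<lambda>u. u / 2) ` ?Z \<union> (\<lambda>u. u - y) ` ?Z \<union> (\<lambda>u. y - u) ` ?Z" for z
    proof (rule generic)
      show "theta q (2 * z) \<noteq> 0"
        using that image_eqI[of z "\<lambda>u. u / 2" "2 * z" ?Z] by auto
      have "theta q (y + z) \<noteq> 0" "theta q (y - z) \<noteq> 0"
        using that image_eqI[of z "\<lambda>u. u - y" "y + z" ?Z] image_eqI[of z "\<lambda>u. y - u" "y - z" ?Z] by auto
      then show "f y z \<noteq> 0" by (simp add: f_def)
    qed
  qed (unfold f_def, (intro holomorphic_intros hol')+)
qed

section \<open>Exchange identities\<close>

text \<open>The algebra up to the mirror identity at generic points rests on these two properties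
  alone.\<close>

locale theta_function =
  fixes \<theta> :: "complex \<Rightarrow> complex"
  assumes minus: "\<theta> (- u) = - \<theta> u"
    and three_term: "\<theta> (x + z) * \<theta> (x - z) * (\<theta> (y + w) * \<theta> (y - w)) =
      \<theta> (x + y) * \<theta> (x - y) * (\<theta> (z + w) * \<theta> (z - w)) +
      \<theta> (x + w) * \<theta> (x - w) * (\<theta> (y + z) * \<theta> (y - z))"
begin

lemma zero [simp]: "\<theta> 0 = 0"
  using minus[of 0] by simp

lemma diff_commute: "\<theta> (v - u) = - \<theta> (u - v)"
  using minus[of "u - v"] by simp

text \<open>The three-term identity at the half sums and half differences of \<open>a, b\<close> and
  of \<open>c, d\<close>. The \<open>p\<close> are the half sums with an even number of minus signs,
  the \<open>r\<close> those with an odd number. As hypotheses they reduce each application to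
  linear identities.\<close>

lemma four_term:
  assumes "a + b + c + d = 2 * p1" "a + b - c - d = 2 * p2" "a - b + c - d = 2 * p3" "a - b - c + d = 2 * p4"
    and "a + b + c - d = 2 * r1" "a + b - c + d = 2 * r2" "a - b + c + d = 2 * r3" "- a + b + c + d = 2 * r4"
  shows "\<theta> a * \<theta> b * \<theta> c * \<theta> d = \<theta> p1 * \<theta> p2 * \<theta> p3 * \<theta> p4 + \<theta> r1 * \<theta> r2 * \<theta> r3 * \<theta> r4"
proof -
  have p: "p1 = (a + b + c + d) / 2" "p2 = (a + b - c - d) / 2"
    "p3 = (a - b + c - d) / 2" "p4 = (a - b - c + d) / 2"
    "r1 = (a + b + c - d) / 2" "r2 = (a + b - c + d) / 2"
    "r3 = (a - b + c + d) / 2" "r4 = (- a + b + c + d) / 2"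
    unfolding assms by simp_all
  have e: "(a + b) / 2 + (a - b) / 2 = a" "(a + b) / 2 - (a - b) / 2 = b"
    "(c + d) / 2 + (c - d) / 2 = c" "(c + d) / 2 - (c - d) / 2 = d"
    "(a + b) / 2 + (c + d) / 2 = p1" "(a + b) / 2 - (c + d) / 2 = p2"
    "(a - b) / 2 + (c - d) / 2 = p3" "(a - b) / 2 - (c - d) / 2 = p4"
    "(a + b) / 2 + (c - d) / 2 = r1" "(a + b) / 2 - (c - d) / 2 = r2"
    "(c + d) / 2 + (a - b) / 2 = r3" "(c + d) / 2 - (a - b) / 2 = r4"
    unfolding p by (simp_all add: field_simps)
  show ?thesis
    using three_term[of "(a + b) / 2" "(a - b) / 2" "(c + d) / 2" "(c - d) / 2"]
    unfolding e by (simp add: mult.assoc)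
qed

text \<open>Start of the row recursion: \<open>u\<close> and \<open>v\<close> are the variables to
  be swapped, and \<open>x\<close> is the variable at the first of the two positions one level
  below, where the second position does not occur yet.\<close>

lemma exchange_base:
  "\<theta> (h + u - v) * \<theta> m * (\<theta> (v - x + h + m) * \<theta> (u - x)) =
   \<theta> h * \<theta> (v - u + m) * (\<theta> (u - x + h + m) * \<theta> (v - x)) +
   \<theta> (h + m) * \<theta> (u - v) * (\<theta> (v - x + m) * \<theta> (h + u - x))"
proof -
  have "\<theta> (v - x + h + m) * \<theta> (u - x) * \<theta> (h + u - v) * \<theta> m =
    \<theta> (u - x + h + m) * \<theta> (v - x) * \<theta> h * \<theta> (v - u + m) +
    \<theta> (h + u - x) * \<theta> (v - x + m) * \<theta> (h + m) * \<theta> (u - v)"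
    by (rule four_term) (simp_all add: algebra_simps)
  then show ?thesis by (simp add: mult_ac)
qed

text \<open>The block of four factors of a level for two positions with increasing values:
  \<open>x, y\<close> are their variables on the lower level, \<open>u, v\<close> those on the upper
  level, \<open>\<alpha>, \<beta>\<close> their dynamical shifts.\<close>

definition pair_factor ::
  "complex \<Rightarrow> complex \<Rightarrow> complex \<Rightarrow> complex \<Rightarrow> complex \<Rightarrow> complex \<Rightarrow> complex \<Rightarrow> complex" where
  "pair_factor h x y u v \<alpha> \<beta> = \<theta> (u - x + \<alpha>) * \<theta> (v - x) * \<theta> (h + u - y) * \<theta> (v - y + \<beta>) /
     (\<theta> (h + x - y) * \<theta> (y - x))"

text \<open>Trades the swap of the upper variables for swaps of the shifts and of the lower
  variables; this is how the exchange passes from one level to the next.\<close>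

lemma pair_factor_exchange:
  assumes nz: "\<theta> (h + x - y) \<noteq> 0" "\<theta> (h + y - x) \<noteq> 0" "\<theta> (y - x) \<noteq> 0" and m: "m = \<alpha> - \<beta>"
  shows "\<theta> (h + u - v) * \<theta> m * pair_factor h x y v u \<alpha> \<beta> =
    \<theta> h * \<theta> (v - u + m) * pair_factor h x y u v \<alpha> \<beta> +
    \<theta> (u - v) * (\<theta> (h + y - x) * \<theta> m * pair_factor h y x u v \<beta> \<alpha> +
      \<theta> h * \<theta> (y - x + m) * pair_factor h x y u v \<beta> \<alpha>) / \<theta> (y - x)"
proof -
  define A where "A = \<theta> (y - x)"
  define B where "B = \<theta> (h + x - y)"
  define C where "C = \<theta> (h + y - x)"
  \<comment> \<open>The factor common to the identities 1 and 2 below; eliminating it yields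
    3.\<close>
  define e where "e = \<theta> (y - x + u - v)"
  have xy: "\<theta> (x - y) = - A" by (simp add: A_def diff_commute[of x y])
  have "\<theta> m * \<theta> (v - x + \<alpha>) * \<theta> (u - y + \<beta>) * \<theta> (y - x + u - v) =
    \<theta> (u - x + \<alpha>) * \<theta> (v - u + m) * \<theta> (- (y - x)) * \<theta> (- (v - y + \<beta>)) +
    \<theta> (v - y + \<alpha>) * \<theta> (y - x + m) * \<theta> (u - v) * \<theta> (u - x + \<beta>)"
    unfolding m by (rule four_term) (simp_all add: algebra_simps)
  then have 1: "\<theta> (u - x + \<alpha>) * \<theta> (v - u + m) * A * \<theta> (v - y + \<beta>) +
      \<theta> (v - y + \<alpha>) * \<theta> (y - x + m) * \<theta> (u - v) * \<theta> (u - x + \<beta>) =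
    \<theta> m * \<theta> (v - x + \<alpha>) * \<theta> (u - y + \<beta>) * e"
    by (simp only: minus A_def e_def) simp
  have "\<theta> (h + u - v) * \<theta> (u - x) * \<theta> (h + v - y) * \<theta> (y - x) =
    \<theta> (h + u - x) * \<theta> (u - v) * \<theta> (h + x - y) * \<theta> (- (v - y)) +
    \<theta> (h + u - y) * \<theta> (y - x + u - v) * \<theta> h * \<theta> (v - x)"
    by (rule four_term) (simp_all add: algebra_simps)
  then have 2: "\<theta> (h + u - v) * \<theta> (u - x) * \<theta> (h + v - y) * A =
    \<theta> (h + u - y) * e * \<theta> h * \<theta> (v - x) - \<theta> (h + u - x) * \<theta> (u - v) * B * \<theta> (v - y)"
    by (simp only: minus A_def B_def e_def) simp
  have "\<theta> (h + u - v) * \<theta> m * (\<theta> (v - x + \<alpha>) * \<theta> (u - x) * \<theta> (h + v - y) * \<theta> (u - y + \<beta>)) * A =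
    \<theta> m * \<theta> (v - x + \<alpha>) * \<theta> (u - y + \<beta>) * (\<theta> (h + u - v) * \<theta> (u - x) * \<theta> (h + v - y) * A)"
    by (simp add: mult_ac)
  also have "\<dots> = (\<theta> m * \<theta> (v - x + \<alpha>) * \<theta> (u - y + \<beta>) * e) * (\<theta> (h + u - y) * \<theta> h * \<theta> (v - x)) -
     \<theta> m * \<theta> (v - x + \<alpha>) * \<theta> (u - y + \<beta>) * (\<theta> (h + u - x) * \<theta> (u - v) * B * \<theta> (v - y))"
    unfolding 2 by (simp add: algebra_simps)
  also have "\<dots> = \<theta> h * \<theta> (v - u + m) * (\<theta> (u - x + \<alpha>) * \<theta> (v - x) * \<theta> (h + u - y) * \<theta> (v - y + \<beta>)) * A
    + \<theta> (u - v) * (\<theta> h * \<theta> (y - x + m) * (\<theta> (u - x + \<beta>) * \<theta> (v - x) * \<theta> (h + u - y) * \<theta> (v - y + \<alpha>)))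
    - \<theta> (u - v) * (\<theta> m * (\<theta> (u - y + \<beta>) * \<theta> (v - y) * \<theta> (h + u - x) * \<theta> (v - x + \<alpha>)) * B)"
    unfolding 1[symmetric] by (simp add: algebra_simps)
  finally have 3: "\<theta> (h + u - v) * \<theta> m * (\<theta> (v - x + \<alpha>) * \<theta> (u - x) * \<theta> (h + v - y) * \<theta> (u - y + \<beta>)) * A =
    \<theta> h * \<theta> (v - u + m) * (\<theta> (u - x + \<alpha>) * \<theta> (v - x) * \<theta> (h + u - y) * \<theta> (v - y + \<beta>)) * A
    + \<theta> (u - v) * (\<theta> h * \<theta> (y - x + m) * (\<theta> (u - x + \<beta>) * \<theta> (v - x) * \<theta> (h + u - y) * \<theta> (v - y + \<alpha>)))
    - \<theta> (u - v) * (\<theta> m * (\<theta> (u - y + \<beta>) * \<theta> (v - y) * \<theta> (h + u - x) * \<theta> (v - x + \<alpha>)) * B)" .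
  have nz': "A \<noteq> 0" "B \<noteq> 0" "C \<noteq> 0" using nz by (simp_all add: A_def B_def C_def)
  have key: "\<And>l r1 r2 r3 c d g t. l * A = r1 * A + t * r2 - t * (d * g * B) \<Longrightarrow>
     l / (B * A) = r1 / (B * A) + t * (C * d * (g / (C * - A)) + r2 / (B * A)) / A"
  proof -
    fix l r1 r2 r3 c d g t
    assume *: "l * A = r1 * A + t * r2 - t * (d * g * B)"
    have "l / (B * A) = l * A / (B * A * A)" using nz' by simp
    also have "\<dots> = r1 / (B * A) + t * (C * d * (g / (C * - A)) + r2 / (B * A)) / A"
      unfolding * using nz' by (simp add: field_simps)
    finally show "l / (B * A) = r1 / (B * A) + t * (C * d * (g / (C * - A)) + r2 / (B * A)) / A" .
  qed
  show ?thesis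
    using key[OF 3] unfolding pair_factor_def A_def[symmetric] B_def[symmetric] C_def[symmetric] xy
    by simp
qed

text \<open>
  The hypotheses express \<open>r\<close> and \<open>r'\<close> through \<open>p\<close> and \<open>p'\<close>. The coefficients of \<open>p\<close> and of \<open>p'\<close> in the
  conclusion are the identity of the preceding lemma and its image under \<open>x \<leftrightarrow> y\<close>.
\<close>

lemma exchange_step:
  assumes nz: "\<theta> (h + x - y) \<noteq> 0" "\<theta> (h + y - x) \<noteq> 0" "\<theta> (y - x) \<noteq> 0" "\<theta> (h + m) \<noteq> 0"
    and m: "m = \<alpha> - \<beta>"
    and p: "\<theta> (h + x - y) * \<theta> m * p' = \<theta> h * \<theta> (y - x + m) * p + \<theta> (h + m) * \<theta> (x - y) * r"
    and p': "\<theta> (h + y - x) * \<theta> m * p = \<theta> h * \<theta> (x - y + m) * p' + \<theta> (h + m) * \<theta> (y - x) * r'"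
  shows "\<theta> (h + u - v) * \<theta> m * (pair_factor h x y v u \<alpha> \<beta> * p + pair_factor h y x v u \<alpha> \<beta> * p') =
    \<theta> h * \<theta> (v - u + m) * (pair_factor h x y u v \<alpha> \<beta> * p + pair_factor h y x u v \<alpha> \<beta> * p') +
    \<theta> (h + m) * \<theta> (u - v) * (pair_factor h x y u v \<beta> \<alpha> * r + pair_factor h y x u v \<beta> \<alpha> * r')"
proof -
  have xy: "\<theta> (x - y) = - \<theta> (y - x)" by (rule diff_commute)
  have r: "\<theta> (h + m) * r = (\<theta> h * \<theta> (y - x + m) * p - \<theta> (h + x - y) * \<theta> m * p') / \<theta> (y - x)"
    using p nz(3) unfolding xy by (simp add: field_simps)
  have r': "\<theta> (h + m) * r' = (\<theta> (h + y - x) * \<theta> m * p - \<theta> h * \<theta> (x - y + m) * p') / \<theta> (y - x)"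
    using p' nz(3) by (simp add: field_simps)
  have e1: "\<theta> (h + u - v) * \<theta> m * pair_factor h x y v u \<alpha> \<beta> =
    \<theta> h * \<theta> (v - u + m) * pair_factor h x y u v \<alpha> \<beta> +
    \<theta> (u - v) * (\<theta> (h + y - x) * \<theta> m * pair_factor h y x u v \<beta> \<alpha> +
      \<theta> h * \<theta> (y - x + m) * pair_factor h x y u v \<beta> \<alpha>) / \<theta> (y - x)"
    by (rule pair_factor_exchange[OF nz(1-3) m])
  have e2: "\<theta> (h + u - v) * \<theta> m * pair_factor h y x v u \<alpha> \<beta> =
    \<theta> h * \<theta> (v - u + m) * pair_factor h y x u v \<alpha> \<beta> -
    \<theta> (u - v) * (\<theta> (h + x - y) * \<theta> m * pair_factor h x y u v \<beta> \<alpha> +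
      \<theta> h * \<theta> (x - y + m) * pair_factor h y x u v \<beta> \<alpha>) / \<theta> (y - x)"
    using pair_factor_exchange[OF nz(2,1) _ m, of u v] nz(3) unfolding xy by simp
  have "\<theta> (h + m) * \<theta> (u - v) * (pair_factor h x y u v \<beta> \<alpha> * r + pair_factor h y x u v \<beta> \<alpha> * r') =
    \<theta> (u - v) * (pair_factor h x y u v \<beta> \<alpha> * (\<theta> (h + m) * r) + pair_factor h y x u v \<beta> \<alpha> * (\<theta> (h + m) * r'))"
    by (simp add: algebra_simps)
  also have "\<dots> = p * (\<theta> (u - v) * (\<theta> (h + y - x) * \<theta> m * pair_factor h y x u v \<beta> \<alpha> +
      \<theta> h * \<theta> (y - x + m) * pair_factor h x y u v \<beta> \<alpha>) / \<theta> (y - x)) -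
    p' * (\<theta> (u - v) * (\<theta> (h + x - y) * \<theta> m * pair_factor h x y u v \<beta> \<alpha> +
      \<theta> h * \<theta> (x - y + m) * pair_factor h y x u v \<beta> \<alpha>) / \<theta> (y - x))"
    unfolding r r' using nz(3) by (simp add: field_simps)
  also have "\<dots> = p * (\<theta> (h + u - v) * \<theta> m * pair_factor h x y v u \<alpha> \<beta> -
      \<theta> h * \<theta> (v - u + m) * pair_factor h x y u v \<alpha> \<beta>) +
    p' * (\<theta> (h + u - v) * \<theta> m * pair_factor h y x v u \<alpha> \<beta> -
      \<theta> h * \<theta> (v - u + m) * pair_factor h y x u v \<alpha> \<beta>)"
    unfolding e1 e2 by (simp add: algebra_simps)
  finally show ?thesis by (simp add: algebra_simps)
qed

end

section \<open>Weight functions labelled by positions\<close>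

lemma prod_double_pair:
  fixes F :: "'a \<Rightarrow> 'b \<Rightarrow> 'c::comm_monoid_mult"
  assumes "finite P" "finite Q" "a \<in> P" "b \<in> P" "a \<noteq> b" "c \<in> Q" "d \<in> Q" "c \<noteq> d"
  shows "(\<Prod>p\<in>P. \<Prod>r\<in>Q. F p r) =
    (\<Prod>p\<in>P-{a,b}. \<Prod>r\<in>Q-{c,d}. F p r) * (\<Prod>p\<in>P-{a,b}. F p c * F p d) *
    (\<Prod>r\<in>Q-{c,d}. F a r * F b r) * (F a c * F a d * F b c * F b d)"
proof -
  have P: "(\<Prod>p\<in>P. g p) = g a * g b * (\<Prod>p\<in>P-{a,b}. g p)" for g :: "'a \<Rightarrow> 'c"
    using assms by (simp add: prod.remove[of P a] prod.remove[of "P - {a}" b] mult.assoc Diff_insert2[symmetric] insert_commute)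
  have Q: "(\<Prod>r\<in>Q. g r) = g c * g d * (\<Prod>r\<in>Q-{c,d}. g r)" for g :: "'b \<Rightarrow> 'c"
    using assms by (simp add: prod.remove[of Q c] prod.remove[of "Q - {c}" d] mult.assoc Diff_insert2[symmetric] insert_commute)
  show ?thesis
    unfolding P Q by (simp add: prod.distrib mult_ac)
qed

lemma prod_double_single:
  fixes F :: "'a \<Rightarrow> 'b \<Rightarrow> 'c::comm_monoid_mult"
  assumes "finite P" "finite Q" "a \<in> P" "c \<in> Q" "d \<in> Q" "c \<noteq> d"
  shows "(\<Prod>p\<in>P. \<Prod>r\<in>Q. F p r) =
    (\<Prod>p\<in>P-{a}. \<Prod>r\<in>Q-{c,d}. F p r) * (\<Prod>p\<in>P-{a}. F p c * F p d) *
    (\<Prod>r\<in>Q-{c,d}. F a r) * (F a c * F a d)"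
proof -
  have P: "(\<Prod>p\<in>P. g p) = g a * (\<Prod>p\<in>P-{a}. g p)" for g :: "'a \<Rightarrow> 'c"
    using assms by (simp add: prod.remove[of P a])
  have Q: "(\<Prod>r\<in>Q. g r) = g c * g d * (\<Prod>r\<in>Q-{c,d}. g r)" for g :: "'b \<Rightarrow> 'c"
    using assms by (simp add: prod.remove[of Q c] prod.remove[of "Q - {c}" d] mult.assoc Diff_insert2[symmetric] insert_commute)
  show ?thesis
    unfolding P Q by (simp add: prod.distrib mult_ac)
qed

text \<open>Reindexing by \<open>\<tau>\<close> shows that twice the sum vanishes.\<close>

lemma sum_permutations_pairing:
  fixes F :: "('a \<Rightarrow> 'a) \<Rightarrow> 'b::field_char_0"
  assumes "\<tau> permutes S" and "\<And>\<pi>. \<pi> permutes S \<Longrightarrow> F \<pi> + F (\<pi> \<circ> \<tau>) = 0"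
  shows "(\<Sum>\<pi> | \<pi> permutes S. F \<pi>) = 0"
proof -
  have "(\<Sum>\<pi> | \<pi> permutes S. F \<pi>) + (\<Sum>\<pi> | \<pi> permutes S. F \<pi>) =
    (\<Sum>\<pi> | \<pi> permutes S. F \<pi>) + (\<Sum>\<pi> | \<pi> permutes S. F (\<pi> \<circ> \<tau>))"
    using sum_permutations_compose_right[OF assms(1), of F] by simp
  also have "\<dots> = 0"
    using assms(2) by (simp add: sum.distrib[symmetric])
  finally show ?thesis by (simp flip: mult_2)
qed

context theta_function
begin

text \<open>
  The position \<open>p \<le> k\<close> stands for the index \<open>a\<close> with \<open>i\<^sup>(\<^sup>k\<^sup>)\<^sub>a = I\<^sub>p\<close>; \<open>s\<close> and \<open>t\<close> are the variables of levels
  \<open>k + 1\<close> and \<open>k\<close>. The denominators of \<open>U\<^sub>I\<close> are distributed over the pairs with \<open>I\<^sub>p < I\<^sub>r\<close>, so that a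
  level is a single product over all pairs.
\<close>

definition weight_factor :: "complex \<Rightarrow> (nat \<Rightarrow> nat) \<Rightarrow> (nat \<Rightarrow> complex) \<Rightarrow> nat \<Rightarrow> (nat \<Rightarrow> complex) \<Rightarrow> (nat \<Rightarrow> complex) \<Rightarrow>
    nat \<Rightarrow> nat \<Rightarrow> complex" where
  "weight_factor h I \<mu> k s t p r =
    (if I r < I p then \<theta> (h + s r - t p)
     else if r = p then \<theta> (s p - t p + ((if I (Suc k) < I p then 0 else h) + \<mu> (Suc k) - \<mu> p))
     else \<theta> (s r - t p)) /
    (if r \<le> k \<and> I p < I r then \<theta> (h + t p - t r) * \<theta> (t r - t p) else 1)"

definition level :: "complex \<Rightarrow> (nat \<Rightarrow> nat) \<Rightarrow> (nat \<Rightarrow> complex) \<Rightarrow> nat \<Rightarrow> (nat \<Rightarrow> complex) \<Rightarrow> (nat \<Rightarrow> complex) \<Rightarrow>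
    complex" where
  "level h I \<mu> k s t = (\<Prod>p = 1..k. \<Prod>r = 1..Suc k. weight_factor h I \<mu> k s t p r)"

text \<open>
  On the component of \<open>J\<close> the variables of level \<open>k\<close> run over the rearrangements of the first \<open>k\<close> entries
  of \<open>y = z \<circ> J\<close>; only those of the top level \<open>s\<close> are free.
\<close>

primrec weight :: "complex \<Rightarrow> (nat \<Rightarrow> nat) \<Rightarrow> (nat \<Rightarrow> complex) \<Rightarrow> (nat \<Rightarrow> complex) \<Rightarrow> nat \<Rightarrow> (nat \<Rightarrow> complex) \<Rightarrow>
    complex" where
  "weight h I \<mu> y 0 s = 1"
| "weight h I \<mu> y (Suc k) s =
    (\<Sum>\<pi> | \<pi> permutes {1..k}. level h I \<mu> k s (y \<circ> \<pi>) * weight h I \<mu> y k (y \<circ> \<pi>))"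

lemma weight_factor_cong:
  assumes "I r < I p \<longleftrightarrow> I' r < I' p" "I p < I r \<longleftrightarrow> I' p < I' r" "I (Suc k) < I p \<longleftrightarrow> I' (Suc k) < I' p"
    and "s r = s' r" "t p = t' p" "r \<le> k \<Longrightarrow> t r = t' r" "\<mu> (Suc k) = \<mu>' (Suc k)" "\<mu> p = \<mu>' p"
  shows "weight_factor h I \<mu> k s t p r = weight_factor h I' \<mu>' k s' t' p r"
  unfolding weight_factor_def using assms by (cases "r = p"; cases "r \<le> k"; simp)

lemma level_cong:
  assumes "\<And>p r. p \<in> {1..Suc k} \<Longrightarrow> r \<in> {1..Suc k} \<Longrightarrow> I p < I r \<longleftrightarrow> I' p < I' r"
    and "\<And>r. r \<in> {1..Suc k} \<Longrightarrow> s r = s' r" "\<And>p. p \<in> {1..k} \<Longrightarrow> t p = t' p"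
    and "\<And>p. p \<in> {1..Suc k} \<Longrightarrow> \<mu> p = \<mu>' p"
  shows "level h I \<mu> k s t = level h I' \<mu>' k s' t'"
  unfolding level_def
proof (intro prod.cong refl)
  fix p r assume "p \<in> {1..k}" "r \<in> {1..Suc k}"
  then show "weight_factor h I \<mu> k s t p r = weight_factor h I' \<mu>' k s' t' p r"
    by (intro weight_factor_cong assms) auto
qed

text \<open>Of \<open>I\<close> only the relative order of its first \<open>k\<close> values enters.
  Hence weights on fewer than \<open>b\<close> positions do not distinguish \<open>I\<close> from
  \<open>I \<circ> \<tau>\<close> below.\<close>

lemma weight_cong:
  assumes "\<And>p r. p \<in> {1..k} \<Longrightarrow> r \<in> {1..k} \<Longrightarrow> I p < I r \<longleftrightarrow> I' p < I' r"
    and "\<And>r. r \<in> {1..k} \<Longrightarrow> s r = s' r"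
    and "\<And>p. p \<in> {1..k} \<Longrightarrow> \<mu> p = \<mu>' p" "\<And>p. p \<in> {1..k} \<Longrightarrow> y p = y' p"
  shows "weight h I \<mu> y k s = weight h I' \<mu>' y' k s'"
  using assms
proof (induction k arbitrary: s s')
  case (Suc k)
  show ?case
    unfolding weight.simps
  proof (intro sum.cong refl arg_cong2[where f = "(*)"])
    fix \<pi> assume "\<pi> \<in> {\<pi>. \<pi> permutes {1..k}}"
    then have "\<pi> p \<in> {1..Suc k}" if "p \<in> {1..k}" for p
      using that permutes_in_image[of \<pi> "{1..k}" p] by simp
    then have y: "(y \<circ> \<pi>) p = (y' \<circ> \<pi>) p" if "p \<in> {1..k}" for p
      using that Suc.prems(4)[of "\<pi> p"] by (simp del: atLeastAtMost_iff)
    show "level h I \<mu> k s (y \<circ> \<pi>) = level h I' \<mu>' k s' (y' \<circ> \<pi>)"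
      by (rule level_cong) (use Suc.prems y in auto)
    show "weight h I \<mu> y k (y \<circ> \<pi>) = weight h I' \<mu>' y' k (y' \<circ> \<pi>)"
      by (rule Suc.IH) (use Suc.prems y in auto)
  qed
qed simp

end

text \<open>In the application \<open>a\<close> and \<open>b\<close> carry consecutive values
  \<open>m\<close> and \<open>m + 1\<close>. \<open>adj1\<close> and \<open>adj2\<close> retain what
  matters: every other value compares alike with both.\<close>

locale adjacent_positions = theta_function \<theta> for \<theta> +
  fixes I :: "nat \<Rightarrow> nat" and n a b :: nat and \<tau> :: "nat \<Rightarrow> nat"
  defines "\<tau> \<equiv> Transposition.transpose a b"
  assumes ab: "1 \<le> a" "a < b" "b \<le> n" and lt: "I a < I b"
    and adj1: "\<And>c. c \<in> {1..n} \<Longrightarrow> c \<noteq> a \<Longrightarrow> c \<noteq> b \<Longrightarrow> I c < I b \<longleftrightarrow> I c < I a"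
    and adj2: "\<And>c. c \<in> {1..n} \<Longrightarrow> c \<noteq> a \<Longrightarrow> c \<noteq> b \<Longrightarrow> I b < I c \<longleftrightarrow> I a < I c"
begin

lemma tau [simp]: "\<tau> a = b" "\<tau> b = a" "c \<noteq> a \<Longrightarrow> c \<noteq> b \<Longrightarrow> \<tau> c = c" "\<tau> (\<tau> c) = c"
  by (auto simp: \<tau>_def Transposition.transpose_def)

lemma tau_permutes: "b \<le> k \<Longrightarrow> \<tau> permutes {1..k}"
  unfolding \<tau>_def using ab by (intro permutes_swap_id) auto

text \<open>All cells outside the 2x2 block, grouped so that a swap at \<open>a, b\<close> of the
  upper variables, the lower variables or the values of \<open>I\<close> only permutes theta factors
  within a group.\<close>

definition rest where
  "rest h K \<mu> k s t =
    (\<Prod>p\<in>{1..k}-{a,b}. \<Prod>r\<in>{1..Suc k}-{a,b}. weight_factor h K \<mu> k s t p r) *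
    (\<Prod>p\<in>{1..k}-{a,b}. weight_factor h K \<mu> k s t p a * weight_factor h K \<mu> k s t p b) *
    (\<Prod>r\<in>{1..Suc k}-{a,b}. weight_factor h K \<mu> k s t a r * weight_factor h K \<mu> k s t b r)"

lemma level_split:
  assumes "b \<le> k"
  shows "level h I' \<mu> k s t = rest h I' \<mu> k s t *
    (weight_factor h I' \<mu> k s t a a * weight_factor h I' \<mu> k s t a b * weight_factor h I' \<mu> k s t b a * weight_factor h I' \<mu> k s t b b)"
  unfolding level_def rest_def by (rule prod_double_pair) (use assms ab in auto)

lemma rest_eqI:
  assumes "\<And>p r. p \<in> {1..k} \<Longrightarrow> p \<noteq> a \<Longrightarrow> p \<noteq> b \<Longrightarrow> r \<in> {1..Suc k} \<Longrightarrow> r \<noteq> a \<Longrightarrow> r \<noteq> b \<Longrightarrow>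
      weight_factor h K \<mu> k s t p r = weight_factor h K' \<mu> k s' t' p r"
    and "\<And>p. p \<in> {1..k} \<Longrightarrow> p \<noteq> a \<Longrightarrow> p \<noteq> b \<Longrightarrow>
      weight_factor h K \<mu> k s t p a * weight_factor h K \<mu> k s t p b = weight_factor h K' \<mu> k s' t' p a * weight_factor h K' \<mu> k s' t' p b"
    and "\<And>r. r \<in> {1..Suc k} \<Longrightarrow> r \<noteq> a \<Longrightarrow> r \<noteq> b \<Longrightarrow>
      weight_factor h K \<mu> k s t a r * weight_factor h K \<mu> k s t b r = weight_factor h K' \<mu> k s' t' a r * weight_factor h K' \<mu> k s' t' b r"
  shows "rest h K \<mu> k s t = rest h K' \<mu> k s' t'"
  unfolding rest_def by (intro arg_cong2[where f = "(*)"] prod.cong refl assms) auto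

lemma tau_other: "c \<noteq> a \<Longrightarrow> c \<noteq> b \<Longrightarrow> (f \<circ> \<tau>) c = f c"
  by simp

lemma rest_swap:
  assumes k: "b \<le> k" "Suc k \<le> n"
  shows "rest h I \<mu> k (s \<circ> \<tau>) t = rest h I \<mu> k s t"
    and "rest h I \<mu> k s (t \<circ> \<tau>) = rest h I \<mu> k s t"
    and "rest h (I \<circ> \<tau>) \<mu> k s t = rest h I \<mu> k s t"
proof -
  have adj: "I b < I c \<longleftrightarrow> I a < I c" "I c < I b \<longleftrightarrow> I c < I a" if "Suc 0 \<le> c" "c \<le> Suc k" "c \<noteq> a" "c \<noteq> b" for c
    using that adj1 adj2 k by auto
  have ne: "Suc k \<noteq> a" "Suc k \<noteq> b" "a \<le> k" "b \<le> k"
    using ab k by auto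
  note simps = weight_factor_def adj ne tau_other mult.commute
  show "rest h I \<mu> k (s \<circ> \<tau>) t = rest h I \<mu> k s t"
    by (rule rest_eqI) (simp_all add: simps)
  show "rest h I \<mu> k s (t \<circ> \<tau>) = rest h I \<mu> k s t"
    by (rule rest_eqI) (simp_all add: simps)
  show "rest h (I \<circ> \<tau>) \<mu> k s t = rest h I \<mu> k s t"
    by (rule rest_eqI) (simp_all add: simps)
qed

lemma core_eq_pair_factor:
  assumes k: "b \<le> k" "Suc k \<le> n"
    and \<alpha>: "\<alpha> = (if I (Suc k) < I a then 0 else h) + \<mu> (Suc k) - \<mu> a"
    and \<beta>: "\<beta> = (if I (Suc k) < I a then 0 else h) + \<mu> (Suc k) - \<mu> b"
  shows "weight_factor h I \<mu> k s t a a * weight_factor h I \<mu> k s t a b * weight_factor h I \<mu> k s t b a * weight_factor h I \<mu> k s t b b =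
      pair_factor h (t a) (t b) (s a) (s b) \<alpha> \<beta>"
    and "weight_factor h (I \<circ> \<tau>) \<mu> k s t a a * weight_factor h (I \<circ> \<tau>) \<mu> k s t a b * weight_factor h (I \<circ> \<tau>) \<mu> k s t b a * weight_factor h (I \<circ> \<tau>) \<mu> k s t b b =
      pair_factor h (t b) (t a) (s b) (s a) \<beta> \<alpha>"
proof -
  have adj: "I (Suc k) < I b \<longleftrightarrow> I (Suc k) < I a"
    using adj1[of "Suc k"] ab k by auto
  have ne: "Suc k \<noteq> a" "Suc k \<noteq> b" "a \<le> k" "b \<le> k" "a \<noteq> b" "b \<noteq> a" "\<not> I b < I a"
    using ab k lt by auto
  show "weight_factor h I \<mu> k s t a a * weight_factor h I \<mu> k s t a b * weight_factor h I \<mu> k s t b a * weight_factor h I \<mu> k s t b b =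
      pair_factor h (t a) (t b) (s a) (s b) \<alpha> \<beta>"
    unfolding \<alpha> \<beta> by (simp add: weight_factor_def pair_factor_def adj ne lt mult_ac)
  show "weight_factor h (I \<circ> \<tau>) \<mu> k s t a a * weight_factor h (I \<circ> \<tau>) \<mu> k s t a b * weight_factor h (I \<circ> \<tau>) \<mu> k s t b a * weight_factor h (I \<circ> \<tau>) \<mu> k s t b b =
      pair_factor h (t b) (t a) (s b) (s a) \<beta> \<alpha>"
    unfolding \<alpha> \<beta> by (simp add: weight_factor_def pair_factor_def adj ne lt mult_ac)
qed

text \<open>Here \<open>b\<close> is the new position of the upper level, so it occurs as a column
  but not as a row, and the block shrinks to the two cells of row \<open>a\<close>. The rest
  \<open>R\<close> is common to all three terms.\<close>

lemma level_base:
  assumes b: "b = Suc k" and M: "M = \<mu> b - \<mu> a"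
  obtains R where "level h I \<mu> k s t = R * (\<theta> (s a - t a + h + M) * \<theta> (s b - t a))"
    "level h I \<mu> k (s \<circ> \<tau>) t = R * (\<theta> (s b - t a + h + M) * \<theta> (s a - t a))"
    "level h (I \<circ> \<tau>) \<mu> k (s \<circ> \<tau>) t = R * (\<theta> (s b - t a + M) * \<theta> (h + s a - t a))"
proof
  define R where "R K s = (\<Prod>p\<in>{1..k}-{a}. \<Prod>r\<in>{1..Suc k}-{a,b}. weight_factor h K \<mu> k s t p r) *
      (\<Prod>p\<in>{1..k}-{a}. weight_factor h K \<mu> k s t p a * weight_factor h K \<mu> k s t p b) *
      (\<Prod>r\<in>{1..Suc k}-{a,b}. weight_factor h K \<mu> k s t a r)" for K s
  have split: "level h K \<mu> k s t = R K s * (weight_factor h K \<mu> k s t a a * weight_factor h K \<mu> k s t a b)" for K s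
    unfolding level_def R_def by (rule prod_double_single) (use ab b in auto)
  have adj: "I (Suc k) < I c \<longleftrightarrow> I a < I c" "I c < I (Suc k) \<longleftrightarrow> I c < I a"
    if "Suc 0 \<le> c" "c \<le> k" "c \<noteq> a" for c
    using that adj1[of c] adj2[of c] ab b by auto
  have ne: "Suc k \<noteq> a" "a \<noteq> Suc k" "a \<le> k" "\<not> I (Suc k) < I a" "I a < I (Suc k)"
    using ab b lt by auto
  have t: "\<tau> a = Suc k" "\<tau> (Suc k) = a" "\<And>c. c \<noteq> a \<Longrightarrow> c \<noteq> Suc k \<Longrightarrow> \<tau> c = c"
    using tau[unfolded b] by simp_all
  have RI: "R K' s' = R K s" if
    "\<And>p r. Suc 0 \<le> p \<Longrightarrow> p \<le> k \<Longrightarrow> p \<noteq> a \<Longrightarrow> Suc 0 \<le> r \<Longrightarrow> r \<le> k \<Longrightarrow> r \<noteq> a \<Longrightarrow>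
      weight_factor h K' \<mu> k s' t p r = weight_factor h K \<mu> k s t p r"
    "\<And>p. Suc 0 \<le> p \<Longrightarrow> p \<le> k \<Longrightarrow> p \<noteq> a \<Longrightarrow>
      weight_factor h K' \<mu> k s' t p a * weight_factor h K' \<mu> k s' t p (Suc k) = weight_factor h K \<mu> k s t p a * weight_factor h K \<mu> k s t p (Suc k)"
    "\<And>r. Suc 0 \<le> r \<Longrightarrow> r \<le> k \<Longrightarrow> r \<noteq> a \<Longrightarrow> weight_factor h K' \<mu> k s' t a r = weight_factor h K \<mu> k s t a r"
    for K' s' K s
    unfolding R_def by (intro arg_cong2[where f = "(*)"] prod.cong refl that[folded b]) (use b in auto)
  have R1: "R I (s \<circ> \<tau>) = R I s"
    by (rule RI) (simp_all add: weight_factor_def adj ne t b mult.commute)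
  have R2: "R (I \<circ> \<tau>) (s \<circ> \<tau>) = R I (s \<circ> \<tau>)"
    by (rule RI) (simp_all add: weight_factor_def adj ne t b mult.commute)
  show "level h I \<mu> k s t = R I s * (\<theta> (s a - t a + h + M) * \<theta> (s b - t a))"
    unfolding split b M by (simp add: weight_factor_def ne algebra_simps)
  show "level h I \<mu> k (s \<circ> \<tau>) t = R I s * (\<theta> (s b - t a + h + M) * \<theta> (s a - t a))"
    unfolding split R1 b M by (simp add: weight_factor_def ne t b algebra_simps)
  show "level h (I \<circ> \<tau>) \<mu> k (s \<circ> \<tau>) t = R I s * (\<theta> (s b - t a + M) * \<theta> (h + s a - t a))"
    unfolding split R2 R1 b M by (simp add: weight_factor_def ne t b algebra_simps)
qed

text \<open>Induction on the number of positions, from the first one at which both \<open>a\<close>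
  and \<open>b\<close> are present. In the step the summands of \<open>\<pi>\<close> and
  \<open>\<pi> \<circ> \<tau>\<close> are taken together: they share \<open>rest\<close>, and
  \<open>exchange_step\<close> combines their blocks with the induction hypothesis at
  \<open>t\<close> and at \<open>t \<circ> \<tau>\<close>.\<close>

lemma weight_exchange:
  assumes k: "b \<le> k" "k \<le> n"
    and gen: "\<And>i j. i \<in> {1..n} \<Longrightarrow> j \<in> {1..n} \<Longrightarrow> i \<noteq> j \<Longrightarrow> \<theta> (y i - y j) \<noteq> 0 \<and> \<theta> (h + y i - y j) \<noteq> 0"
    and M: "M = \<mu> b - \<mu> a" "\<theta> (h + M) \<noteq> 0"
  shows "\<theta> (h + s a - s b) * \<theta> M * weight h I \<mu> y k (s \<circ> \<tau>) =
    \<theta> h * \<theta> (s b - s a + M) * weight h I \<mu> y k s + \<theta> (h + M) * \<theta> (s a - s b) * weight h (I \<circ> \<tau>) \<mu> y k (s \<circ> \<tau>)"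
  using k
proof (induction k arbitrary: s rule: dec_induct)
  case base
  obtain k where b: "b = Suc k" using ab by (cases b) auto
  have w: "weight h (I \<circ> \<tau>) \<mu> y k t = weight h I \<mu> y k t" for t
  proof (rule weight_cong)
    show "(I \<circ> \<tau>) p < (I \<circ> \<tau>) r \<longleftrightarrow> I p < I r" if "p \<in> {1..k}" "r \<in> {1..k}" for p r
      using that adj1[of p] adj2[of r] ab b by (cases "p = a"; cases "r = a") auto
  qed auto
  have "\<theta> (h + s a - s b) * \<theta> M * level h I \<mu> k (s \<circ> \<tau>) t =
    \<theta> h * \<theta> (s b - s a + M) * level h I \<mu> k s t + \<theta> (h + M) * \<theta> (s a - s b) * level h (I \<circ> \<tau>) \<mu> k (s \<circ> \<tau>) t" for t
  proof -
    obtain R where R: "level h I \<mu> k s t = R * (\<theta> (s a - t a + h + M) * \<theta> (s b - t a))"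
      "level h I \<mu> k (s \<circ> \<tau>) t = R * (\<theta> (s b - t a + h + M) * \<theta> (s a - t a))"
      "level h (I \<circ> \<tau>) \<mu> k (s \<circ> \<tau>) t = R * (\<theta> (s b - t a + M) * \<theta> (h + s a - t a))"
      using level_base[OF b M(1)] .
    have "\<theta> (h + s a - s b) * \<theta> M * level h I \<mu> k (s \<circ> \<tau>) t =
      R * (\<theta> (h + s a - s b) * \<theta> M * (\<theta> (s b - t a + h + M) * \<theta> (s a - t a)))"
      unfolding R by (simp only: mult_ac)
    also have "\<dots> = \<theta> h * \<theta> (s b - s a + M) * level h I \<mu> k s t + \<theta> (h + M) * \<theta> (s a - s b) * level h (I \<circ> \<tau>) \<mu> k (s \<circ> \<tau>) t"
      unfolding exchange_base R by (simp only: distrib_left mult_ac)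
    finally show ?thesis .
  qed
  then have "\<theta> (h + s a - s b) * \<theta> M * (level h I \<mu> k (s \<circ> \<tau>) t * x) =
    \<theta> h * \<theta> (s b - s a + M) * (level h I \<mu> k s t * x) +
    \<theta> (h + M) * \<theta> (s a - s b) * (level h (I \<circ> \<tau>) \<mu> k (s \<circ> \<tau>) t * x)" for t x
    by (simp only: mult.assoc[symmetric] distrib_right[symmetric])
  moreover have "weight h K \<mu> y b s = (\<Sum>\<pi> | \<pi> permutes {1..k}. level h K \<mu> k s (y \<circ> \<pi>) * weight h K \<mu> y k (y \<circ> \<pi>))" for K s
    by (simp only: b weight.simps)
  ultimately show ?case
    by (simp only: w sum_distrib_left sum.distrib[symmetric])
next
  case (step k)
  define e where "e = (if I (Suc k) < I a then 0 else h) + \<mu> (Suc k)"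
  \<comment> \<open>The contribution of \<open>\<pi>\<close> to the defect of the recursion; only
    the sum over a pair \<open>\<pi>\<close>, \<open>\<pi> \<circ> \<tau>\<close> is shown to
    vanish.\<close>
  define F where "F \<pi> = \<theta> (h + s a - s b) * \<theta> M * (level h I \<mu> k (s \<circ> \<tau>) (y \<circ> \<pi>) * weight h I \<mu> y k (y \<circ> \<pi>))
    - \<theta> h * \<theta> (s b - s a + M) * (level h I \<mu> k s (y \<circ> \<pi>) * weight h I \<mu> y k (y \<circ> \<pi>))
    - \<theta> (h + M) * \<theta> (s a - s b) * (level h (I \<circ> \<tau>) \<mu> k (s \<circ> \<tau>) (y \<circ> \<pi>) * weight h (I \<circ> \<tau>) \<mu> y k (y \<circ> \<pi>))" for \<pi>
  have k: "b \<le> k" "Suc k \<le> n" using step by auto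
  have "F \<pi> + F (\<pi> \<circ> \<tau>) = 0" if \<pi>: "\<pi> permutes {1..k}" for \<pi>
  proof -
    define t where "t = y \<circ> \<pi>"
    have t: "y \<circ> (\<pi> \<circ> \<tau>) = t \<circ> \<tau>" by (simp add: t_def o_assoc)
    define R where "R = rest h I \<mu> k s t"
    define \<alpha> where "\<alpha> = e - \<mu> a"
    define \<beta> where "\<beta> = e - \<mu> b"
    note core = core_eq_pair_factor[OF k, of \<alpha> h \<mu> \<beta>, folded e_def, OF \<alpha>_def \<beta>_def]
    have L: "level h I \<mu> k s' t' = R * pair_factor h (t' a) (t' b) (s' a) (s' b) \<alpha> \<beta>"
      "level h (I \<circ> \<tau>) \<mu> k s' t' = R * pair_factor h (t' b) (t' a) (s' b) (s' a) \<beta> \<alpha>"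
      if "s' \<in> {s, s \<circ> \<tau>}" "t' \<in> {t, t \<circ> \<tau>}" for s' t'
      using that by (auto simp only: level_split[OF k(1)] core R_def rest_swap[OF k] insert_iff empty_iff)
    have range: "\<pi> a \<in> {1..n}" "\<pi> b \<in> {1..n}" "\<pi> a \<noteq> \<pi> b"
      using permutes_in_image[OF \<pi>, of a] permutes_in_image[OF \<pi>, of b] inj_eq[OF permutes_inj[OF \<pi>], of a b] ab k
      by simp_all
    have nz: "\<theta> (h + t a - t b) \<noteq> 0" "\<theta> (h + t b - t a) \<noteq> 0" "\<theta> (t b - t a) \<noteq> 0"
      using gen range by (simp_all add: t_def)
    have IH: "\<theta> (h + s a - s b) * \<theta> M * weight h I \<mu> y k (s \<circ> \<tau>) =
      \<theta> h * \<theta> (s b - s a + M) * weight h I \<mu> y k s + \<theta> (h + M) * \<theta> (s a - s b) * weight h (I \<circ> \<tau>) \<mu> y k (s \<circ> \<tau>)" for s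
      by (rule step.IH) (use k in simp)
    have tt: "t \<circ> \<tau> \<circ> \<tau> = t" by (auto simp: fun_eq_iff)
    have m: "M = \<alpha> - \<beta>" by (simp add: \<alpha>_def \<beta>_def M)
    have "\<theta> (h + s a - s b) * \<theta> M * (pair_factor h (t a) (t b) (s b) (s a) \<alpha> \<beta> * weight h I \<mu> y k t +
        pair_factor h (t b) (t a) (s b) (s a) \<alpha> \<beta> * weight h I \<mu> y k (t \<circ> \<tau>)) =
      \<theta> h * \<theta> (s b - s a + M) * (pair_factor h (t a) (t b) (s a) (s b) \<alpha> \<beta> * weight h I \<mu> y k t +
        pair_factor h (t b) (t a) (s a) (s b) \<alpha> \<beta> * weight h I \<mu> y k (t \<circ> \<tau>)) +
      \<theta> (h + M) * \<theta> (s a - s b) * (pair_factor h (t a) (t b) (s a) (s b) \<beta> \<alpha> * weight h (I \<circ> \<tau>) \<mu> y k (t \<circ> \<tau>) +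
        pair_factor h (t b) (t a) (s a) (s b) \<beta> \<alpha> * weight h (I \<circ> \<tau>) \<mu> y k t)"
      by (rule exchange_step[OF nz M(2) m]) (use IH[of t] IH[of "t \<circ> \<tau>"] in \<open>simp_all add: tt\<close>)
    from arg_cong[OF this, of "\<lambda>x. R * x"] show ?thesis
      unfolding F_def t t_def[symmetric] by (simp add: L algebra_simps)
  qed
  then have "(\<Sum>\<pi> | \<pi> permutes {1..k}. F \<pi>) = 0"
    by (intro sum_permutations_pairing[OF tau_permutes[OF k(1)]])
  then show ?case
    unfolding F_def sum_subtractf sum_distrib_left[symmetric] weight.simps(2)[symmetric]
    by (simp only: diff_diff_eq right_minus_eq)
qed

end

section \<open>The row recursion\<close>

abbreviation adj_swap :: "nat \<Rightarrow> nat \<Rightarrow> nat" where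
  "adj_swap m \<equiv> Transposition.transpose m (Suc m)"

lemma adj_swap_permutes: "1 \<le> m \<Longrightarrow> Suc m \<le> n \<Longrightarrow> adj_swap m permutes {1..n}"
  by (rule permutes_swap_id) auto

text \<open>The transposition of \<open>a\<close> and \<open>b + 1\<close> is the conjugate by
  \<open>adj_swap b\<close> of that of \<open>a\<close> and \<open>b\<close>. Factors are added on
  the left, where the row recursion acts.\<close>

lemma permutes_adjacent_induct [consumes 1, case_names id adj]:
  fixes P :: "(nat \<Rightarrow> nat) \<Rightarrow> bool"
  assumes "I permutes {1..n}" and "P id"
    and step: "\<And>m I. 1 \<le> m \<Longrightarrow> Suc m \<le> n \<Longrightarrow> I permutes {1..n} \<Longrightarrow> P I \<Longrightarrow> P (adj_swap m \<circ> I)"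
  shows "P I"
  using assms(1) finite_atLeastAtMost \<open>P id\<close>
proof (induction rule: permutes_induct)
  case (swap a b I)
  have less: "P (Transposition.transpose a b \<circ> I)"
    if "a < b" "1 \<le> a" "b \<le> n" "I permutes {1..n}" "P I" for a b I
  proof -
    have "Suc a \<le> b" using that by simp
    then show ?thesis
      using that(3-)
    proof (induction b arbitrary: I rule: dec_induct)
      case base
      show ?case by (rule assms(3)) (use base that(2) in auto)
    next
      case (step b I)
      have s: "adj_swap b permutes {1..n}"
        using step that by (intro adj_swap_permutes) auto
      have 1: "adj_swap b \<circ> I permutes {1..n}" "P (adj_swap b \<circ> I)"
        by (rule permutes_compose[OF step.prems(2) s], rule assms(3)) (use step that in simp_all)
      then have 2: "P (Transposition.transpose a b \<circ> (adj_swap b \<circ> I))"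
        by (intro step.IH[OF _ 1]) (use step in simp)
      have "Transposition.transpose a b permutes {1..n}"
        using step that by (intro permutes_swap_id) auto
      then have "P (adj_swap b \<circ> (Transposition.transpose a b \<circ> (adj_swap b \<circ> I)))"
        by (intro assms(3) 2 permutes_compose[OF 1(1)]) (use step that in simp_all)
      moreover have "adj_swap b \<circ> (Transposition.transpose a b \<circ> (adj_swap b \<circ> I)) = Transposition.transpose a (Suc b) \<circ> I"
        using step by (auto simp: fun_eq_iff Transposition.transpose_def)
      ultimately show ?case by (simp only:)
    qed
  qed
  show ?case
  proof (cases "a < b")
    case True
    then show ?thesis by (rule less) (use swap in simp_all)
  next
    case False
    then have "b < a" using swap by auto
    then have "P (Transposition.transpose b a \<circ> I)" by (rule less) (use swap in simp_all)
    then show ?thesis by (simp only: Transposition.transpose_commute)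
  qed
qed

lemma prod_antisym_cells:
  fixes c :: "'a \<Rightarrow> 'a \<Rightarrow> 'b::comm_monoid_mult"
  assumes "finite P" "\<And>p r. p \<in> P \<Longrightarrow> r \<in> P \<Longrightarrow> p \<noteq> r \<Longrightarrow> c p r * c r p = 1"
  shows "(\<Prod>p\<in>P. \<Prod>r\<in>P. c p r) = (\<Prod>p\<in>P. c p p)"
  using assms
proof (induction P rule: finite_induct)
  case (insert x P)
  have "(\<Prod>r\<in>P. c x r) * (\<Prod>p\<in>P. c p x) = (\<Prod>r\<in>P. 1)"
    unfolding prod.distrib[symmetric] using insert.prems insert.hyps by (intro prod.cong) auto
  then have 1: "(\<Prod>r\<in>P. c x r) * (\<Prod>p\<in>P. c p x) = 1" by simp
  have "(\<Prod>p\<in>insert x P. \<Prod>r\<in>insert x P. c p r) =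
    c x x * ((\<Prod>r\<in>P. c x r) * (\<Prod>p\<in>P. c p x)) * (\<Prod>p\<in>P. \<Prod>r\<in>P. c p r)"
    using insert.hyps by (simp add: prod.distrib mult_ac)
  then show ?case
    using insert by (simp add: 1)
qed simp

context theta_function
begin

definition generic :: "nat \<Rightarrow> complex \<Rightarrow> (nat \<Rightarrow> complex) \<Rightarrow> bool" where
  "generic n h z \<longleftrightarrow> (\<forall>a\<in>{1..n}. \<forall>b\<in>{1..n}. a \<noteq> b \<longrightarrow> \<theta> (z a - z b) \<noteq> 0 \<and> \<theta> (h + z a - z b) \<noteq> 0)"

lemma genericD:
  assumes "generic n h z" "a \<in> {1..n}" "b \<in> {1..n}" "a \<noteq> b"
  shows "\<theta> (z a - z b) \<noteq> 0" "\<theta> (h + z a - z b) \<noteq> 0"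
  using assms by (auto simp: generic_def)

lemma generic_permute:
  assumes "generic n h z" "\<pi> permutes {1..n}"
  shows "generic n h (z \<circ> \<pi>)"
  unfolding generic_def
  using genericD[OF assms(1)] permutes_in_image[OF assms(2)] inj_eq[OF permutes_inj[OF assms(2)]]
  by (simp del: atLeastAtMost_iff)

lemma generic_minus:
  assumes "generic n h z"
  shows "generic n h (\<lambda>i. - z i)"
  unfolding generic_def
proof (intro ballI impI)
  fix a b assume "a \<in> {1..n}" "b \<in> {1..n}" "a \<noteq> b"
  then show "\<theta> (- z a - - z b) \<noteq> 0 \<and> \<theta> (h + - z a - - z b) \<noteq> 0"
    using genericD[OF assms, of b a] by (simp add: algebra_simps)
qed

text \<open>The matrix entry \<open>A\<close> of the overview. At the top level position
  \<open>p\<close> stands for the index \<open>I p\<close>, hence the variables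
  \<open>z \<circ> I\<close>.\<close>

definition restricted_weight ::
  "nat \<Rightarrow> complex \<Rightarrow> (nat \<Rightarrow> nat) \<Rightarrow> (nat \<Rightarrow> nat) \<Rightarrow> (nat \<Rightarrow> complex) \<Rightarrow> (nat \<Rightarrow> complex) \<Rightarrow> complex" where
  "restricted_weight n h I J z \<mu> = weight h I \<mu> (z \<circ> J) n (z \<circ> I)"

text \<open>
  The row recursion for \<open>I\<close> at \<open>(u, v)\<close> and at \<open>(v, u)\<close> implies the one for \<open>s I\<close>, in which \<open>m\<close> changes
  sign; so the recursion has the same form whatever the order of the two positions.
\<close>

lemma exchange_reverse:
  assumes 1: "\<theta> (h + u - v) * \<theta> (- m) * p' = \<theta> h * \<theta> (v - u + - m) * p + \<theta> (h + - m) * \<theta> (u - v) * r"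
    and 2: "\<theta> (h + v - u) * \<theta> (- m) * p = \<theta> h * \<theta> (u - v + - m) * p' + \<theta> (h + - m) * \<theta> (v - u) * r'"
    and nz: "\<theta> (h + - m) \<noteq> 0" "\<theta> (u - v) \<noteq> 0"
  shows "\<theta> (h + u - v) * \<theta> m * r' = \<theta> h * \<theta> (v - u + m) * r + \<theta> (h + m) * \<theta> (u - v) * p"
proof -
  \<comment> \<open>The unitarity relation of the R-matrix; it matches the coefficients of
    \<open>p\<close> once \<open>p'\<close> has been eliminated.\<close>
  have "\<theta> (h + u - v) * \<theta> (h + v - u) * \<theta> m * \<theta> m =
    \<theta> (h + m) * \<theta> (h - m) * \<theta> (u - v) * \<theta> (u - v) + \<theta> h * \<theta> h * \<theta> (u - v + m) * \<theta> (v - u + m)"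
    by (rule four_term) (simp_all add: algebra_simps)
  then have 3: "\<theta> (h + u - v) * \<theta> (h + v - u) * \<theta> m * \<theta> m =
    \<theta> (h + m) * \<theta> (h + - m) * \<theta> (u - v) * \<theta> (u - v) + \<theta> h * \<theta> h * \<theta> (u - v + m) * \<theta> (v - u + m)" by simp
  have s: "\<theta> (v - u) = - \<theta> (u - v)" "\<theta> (v - u + - m) = - \<theta> (u - v + m)" "\<theta> (u - v + - m) = - \<theta> (v - u + m)"
    using minus[of "u - v"] minus[of "u - v + m"] minus[of "v - u + m"] by (simp_all add: algebra_simps)
  have p1: "\<theta> (h + u - v) * \<theta> m * p' = \<theta> h * \<theta> (u - v + m) * p - \<theta> (h + - m) * \<theta> (u - v) * r"
    using 1 unfolding s minus by (simp add: algebra_simps)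
  have p2: "\<theta> (h + - m) * \<theta> (u - v) * r' = \<theta> (h + v - u) * \<theta> m * p - \<theta> h * \<theta> (v - u + m) * p'"
    using 2 unfolding s minus by (simp add: algebra_simps)
  have "(\<theta> (h + - m) * \<theta> (u - v)) * (\<theta> (h + u - v) * \<theta> m * r') =
    \<theta> (h + u - v) * \<theta> m * (\<theta> (h + - m) * \<theta> (u - v) * r')"
    by (simp only: mult_ac)
  also have "\<dots> = (\<theta> (h + u - v) * \<theta> (h + v - u) * \<theta> m * \<theta> m) * p - \<theta> h * \<theta> (v - u + m) * (\<theta> (h + u - v) * \<theta> m * p')"
    unfolding p2 by (simp add: algebra_simps)
  also have "\<dots> = (\<theta> (h + - m) * \<theta> (u - v)) * (\<theta> h * \<theta> (v - u + m) * r + \<theta> (h + m) * \<theta> (u - v) * p)"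
    unfolding p1 3 by (simp add: algebra_simps)
  finally show ?thesis using nz by simp
qed

text \<open>All three terms have the lower variables \<open>z \<circ> J\<close>, because
  \<open>z \<circ> s \<circ> (s \<circ> J) = z \<circ> J\<close>. Their top variables are
  \<open>z \<circ> I\<close>, with or without the swap of \<open>a\<close> and \<open>b\<close>. So
  this is \<open>weight_exchange\<close> at \<open>s = z \<circ> I\<close>.\<close>

lemma restricted_weight_row_less:
  assumes I: "I permutes {1..n}" and J: "J permutes {1..n}" and m: "1 \<le> m" "Suc m \<le> n"
    and z: "generic n h z" and \<mu>: "generic n h \<mu>"
    and M: "M = \<mu> (inv I (Suc m)) - \<mu> (inv I m)" and less: "inv I m < inv I (Suc m)"
  shows "\<theta> (h + z m - z (Suc m)) * \<theta> M * restricted_weight n h I (adj_swap m \<circ> J) (z \<circ> adj_swap m) \<mu> =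
    \<theta> h * \<theta> (z (Suc m) - z m + M) * restricted_weight n h I J z \<mu> +
    \<theta> (h + M) * \<theta> (z m - z (Suc m)) * restricted_weight n h (adj_swap m \<circ> I) J z \<mu>"
proof -
  define a where "a = inv I m"
  define b where "b = inv I (Suc m)"
  have Iab: "I a = m" "I b = Suc m"
    using permutes_inverses(1)[OF I] by (simp_all add: a_def b_def)
  have abn: "a \<in> {1..n}" "b \<in> {1..n}"
    using m permutes_in_image[OF permutes_inv[OF I]] by (simp_all add: a_def b_def)
  have ne: "I c \<noteq> m" "I c \<noteq> Suc m" if "c \<noteq> a" "c \<noteq> b" for c
    using that permutes_inj[OF I] Iab by (metis injD)+
  interpret adjacent_positions \<theta> I n a b "Transposition.transpose a b"
  proof unfold_locales
    fix c assume "c \<in> {1..n}" "c \<noteq> a" "c \<noteq> b"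
    then show "I c < I b \<longleftrightarrow> I c < I a" "I b < I c \<longleftrightarrow> I a < I c"
      using ne[of c] by (auto simp: Iab)
  qed (use abn less Iab in \<open>auto simp: a_def b_def\<close>)
  have y: "\<theta> ((z \<circ> J) i - (z \<circ> J) j) \<noteq> 0 \<and> \<theta> (h + (z \<circ> J) i - (z \<circ> J) j) \<noteq> 0"
    if "i \<in> {1..n}" "j \<in> {1..n}" "i \<noteq> j" for i j
    using genericD[OF generic_permute[OF z J]] that by blast
  have "\<theta> (h + \<mu> b - \<mu> a) \<noteq> 0"
    using genericD(2)[OF \<mu> abn(2,1)] less by (simp add: a_def b_def)
  then have hM: "\<theta> (h + M) \<noteq> 0"
    by (simp add: M a_def b_def add_diff_eq)
  have It: "I \<circ> Transposition.transpose a b = adj_swap m \<circ> I"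
    using transpose_comp_eq[OF permutes_bij[OF I], of m "Suc m"] by (simp add: a_def b_def)
  have zJ: "z \<circ> adj_swap m \<circ> (adj_swap m \<circ> J) = z \<circ> J"
    by (simp add: fun_eq_iff)
  have "\<theta> (h + (z \<circ> I) a - (z \<circ> I) b) * \<theta> M * weight h I \<mu> (z \<circ> J) n (z \<circ> I \<circ> Transposition.transpose a b) =
    \<theta> h * \<theta> ((z \<circ> I) b - (z \<circ> I) a + M) * weight h I \<mu> (z \<circ> J) n (z \<circ> I) +
    \<theta> (h + M) * \<theta> ((z \<circ> I) a - (z \<circ> I) b) *
      weight h (I \<circ> Transposition.transpose a b) \<mu> (z \<circ> J) n (z \<circ> I \<circ> Transposition.transpose a b)"
    by (rule weight_exchange[OF _ order_refl]) (use abn y hM in \<open>auto simp: M a_def b_def\<close>)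
  then show ?thesis
    unfolding restricted_weight_def comp_assoc It by (simp add: Iab zJ[unfolded comp_assoc] comp_assoc)
qed

lemma restricted_weight_row:
  assumes I: "I permutes {1..n}" and J: "J permutes {1..n}" and m: "1 \<le> m" "Suc m \<le> n"
    and z: "generic n h z" and \<mu>: "generic n h \<mu>"
    and M: "M = \<mu> (inv I (Suc m)) - \<mu> (inv I m)"
  shows "\<theta> (h + z m - z (Suc m)) * \<theta> M * restricted_weight n h I (adj_swap m \<circ> J) (z \<circ> adj_swap m) \<mu> =
    \<theta> h * \<theta> (z (Suc m) - z m + M) * restricted_weight n h I J z \<mu> +
    \<theta> (h + M) * \<theta> (z m - z (Suc m)) * restricted_weight n h (adj_swap m \<circ> I) J z \<mu>"
proof (cases "inv I m < inv I (Suc m)")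
  case True
  then show ?thesis using restricted_weight_row_less[OF assms] by simp
next
  case False
  let ?s = "adj_swap m" and ?I = "adj_swap m \<circ> I"
  have s: "?s permutes {1..n}" using m by (rule adj_swap_permutes)
  have ss: "?s \<circ> (?s \<circ> f) = f" "g \<circ> ?s \<circ> ?s = g" for f :: "nat \<Rightarrow> nat" and g :: "nat \<Rightarrow> complex"
    by (simp_all add: fun_eq_iff)
  have I': "?I permutes {1..n}" by (rule permutes_compose[OF I s])
  have inv: "inv ?I c = inv I (?s c)" for c
    using permutes_inv_o(1)[OF I] by (simp add: o_inv_distrib permutes_bij[OF I])
  have inv': "inv ?I m = inv I (Suc m)" "inv ?I (Suc m) = inv I m"
    by (simp_all add: inv)
  have ne: "inv I m \<noteq> inv I (Suc m)"
    using inj_eq[OF permutes_inj[OF permutes_inv[OF I]]] by simp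
  have less: "inv ?I m < inv ?I (Suc m)"
    using False ne by (simp add: inv')
  have M': "- M = \<mu> (inv ?I (Suc m)) - \<mu> (inv ?I m)"
    by (simp add: inv' M)
  have zs: "generic n h (z \<circ> ?s)" by (rule generic_permute[OF z s])
  note r1 = restricted_weight_row_less[OF I' J m z \<mu> M' less, unfolded ss]
  note r2 = restricted_weight_row_less[OF I' permutes_compose[OF J s] m zs \<mu> M' less, unfolded ss, simplified]
  have "inv I m \<in> {1..n}" "inv I (Suc m) \<in> {1..n}"
    using m permutes_in_image[OF permutes_inv[OF I]] by simp_all
  then have "\<theta> (h + - M) \<noteq> 0"
    using genericD(2)[OF \<mu>, of "inv I m" "inv I (Suc m)"] ne by (simp add: M algebra_simps)
  moreover have "\<theta> (z m - z (Suc m)) \<noteq> 0"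
    using genericD(1)[OF z, of m "Suc m"] m by simp
  ultimately show ?thesis
    using exchange_reverse[OF r1] r2 by simp
qed

subsection \<open>The rows of the identity and of the longest permutation\<close>

text \<open>When both levels carry the same variables, the cells \<open>(p, r)\<close> and
  \<open>(r, p)\<close> are reciprocal: the two numerators cancel the denominator. The diagonal and
  the new column remain.\<close>

lemma level_diagonal:
  assumes I: "I permutes {1..n}" and k: "Suc k \<le> n" and y: "generic n h y"
  shows "level h I \<mu> k y y = (\<Prod>p = 1..k. if I (Suc k) < I p
    then \<theta> (\<mu> (Suc k) - \<mu> p) * \<theta> (h + y (Suc k) - y p)
    else \<theta> (h + \<mu> (Suc k) - \<mu> p) * \<theta> (y (Suc k) - y p))"
proof -
  have lt: "I p < I r \<or> I r < I p" if "p \<noteq> r" for p r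
    using inj_eq[OF permutes_inj[OF I], of p r] that by (metis nat_neq_iff)
  have cell: "weight_factor h I \<mu> k y y p r * weight_factor h I \<mu> k y y r p = 1"
    if "p \<in> {1..k}" "r \<in> {1..k}" "p \<noteq> r" for p r
  proof -
    have nz: "\<theta> (y p - y r) \<noteq> 0" "\<theta> (h + y p - y r) \<noteq> 0" "\<theta> (y r - y p) \<noteq> 0" "\<theta> (h + y r - y p) \<noteq> 0"
      using genericD[OF y, of p r] genericD[OF y, of r p] that k by simp_all
    show ?thesis
      using lt[OF that(3)] that nz by (auto simp: weight_factor_def)
  qed
  have "level h I \<mu> k y y = (\<Prod>p = 1..k. \<Prod>r = 1..k. weight_factor h I \<mu> k y y p r) * (\<Prod>p = 1..k. weight_factor h I \<mu> k y y p (Suc k))"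
    unfolding level_def by (simp add: prod.distrib)
  also have "\<dots> = (\<Prod>p = 1..k. weight_factor h I \<mu> k y y p p * weight_factor h I \<mu> k y y p (Suc k))"
    using prod_antisym_cells[of "{1..k}" "weight_factor h I \<mu> k y y", OF _ cell] by (simp add: prod.distrib)
  also have "\<dots> = (\<Prod>p = 1..k. if I (Suc k) < I p
    then \<theta> (\<mu> (Suc k) - \<mu> p) * \<theta> (h + y (Suc k) - y p)
    else \<theta> (h + \<mu> (Suc k) - \<mu> p) * \<theta> (y (Suc k) - y p))"
    by (intro prod.cong refl) (auto simp: weight_factor_def add_diff_eq)
  finally show ?thesis .
qed

text \<open>The numerator of the cell \<open>(p, r)\<close> is \<open>\<theta> 0\<close>. All
  triangularity of the weights comes from this.\<close>

lemma level_eq_0: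
  assumes "p \<in> {1..k}" "r \<in> {1..Suc k}" "I p < I r" "s r = t p"
  shows "level h I \<mu> k s t = 0"
proof -
  have "weight_factor h I \<mu> k s t p r = 0"
    using assms by (auto simp: weight_factor_def)
  then have "(\<Prod>r = 1..Suc k. weight_factor h I \<mu> k s t p r) = 0"
    using assms by (intro prod_zero) auto
  then show ?thesis
    unfolding level_def using assms by (intro prod_zero) auto
qed

text \<open>By induction only \<open>\<pi> = id\<close> contributes. A permutation
  \<open>\<rho> \<noteq> id\<close> has some \<open>r\<close> with \<open>\<rho> r < r\<close>, and
  then the cell \<open>(\<rho> r, r)\<close> vanishes.\<close>

lemma weight_id:
  assumes y: "generic n h y"
  shows "k \<le> n \<Longrightarrow> \<rho> permutes {1..k} \<Longrightarrow> weight h id \<mu> y k (y \<circ> \<rho>) =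
    (if \<rho> = id then \<Prod>b = 1..k. \<Prod>a = 1..<b. \<theta> (h + \<mu> b - \<mu> a) * \<theta> (y b - y a) else 0)"
proof (induction k arbitrary: \<rho>)
  case (Suc k)
  let ?D = "\<lambda>k. \<Prod>b = 1..k. \<Prod>a = 1..<b. \<theta> (h + \<mu> b - \<mu> a) * \<theta> (y b - y a)"
  have "weight h id \<mu> y (Suc k) (y \<circ> \<rho>) =
    (\<Sum>\<pi> | \<pi> permutes {1..k}. if \<pi> = id then level h id \<mu> k (y \<circ> \<rho>) y * ?D k else 0)"
    unfolding weight.simps
  proof (intro sum.cong refl)
    fix \<pi> assume "\<pi> \<in> {\<pi>. \<pi> permutes {1..k}}"
    then have "weight h id \<mu> y k (y \<circ> \<pi>) = (if \<pi> = id then ?D k else 0)"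
      by (intro Suc.IH) (use Suc.prems in simp_all)
    then show "level h id \<mu> k (y \<circ> \<rho>) (y \<circ> \<pi>) * weight h id \<mu> y k (y \<circ> \<pi>) =
        (if \<pi> = id then level h id \<mu> k (y \<circ> \<rho>) y * ?D k else 0)"
      by (cases "\<pi> = id") (simp_all only: if_True if_False mult_zero_right comp_id simp_thms)
  qed
  also have "\<dots> = level h id \<mu> k (y \<circ> \<rho>) y * ?D k"
    by (simp add: permutes_id finite_permutations)
  also have "\<dots> = (if \<rho> = id then ?D (Suc k) else 0)"
  proof (cases "\<rho> = id")
    case True
    then show ?thesis
      using level_diagonal[OF permutes_id Suc.prems(1) y, of \<mu>] by (simp add: atLeastLessThanSuc_atLeastAtMost mult.commute)
  next
    case False
    obtain r where r: "r \<in> {1..Suc k}" "\<rho> r < r"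
      using False permutes_natset_ge[OF Suc.prems(2)] by (metis not_le)
    have "\<rho> r \<in> {1..Suc k}"
      using r permutes_in_image[OF Suc.prems(2)] by blast
    then have "level h id \<mu> k (y \<circ> \<rho>) y = 0"
      using r by (intro level_eq_0[of "\<rho> r" k r]) auto
    then show ?thesis using False by simp
  qed
  finally show ?case .
qed (auto simp: permutes_empty)

text \<open>In a nonvanishing summand \<open>\<pi>\<close>, \<open>level_eq_0\<close> forces
  \<open>K r \<le> K p\<close> whenever \<open>\<rho> r = \<pi> p\<close>, so the lower bound passes
  from \<open>\<rho>\<close> to \<open>\<pi>\<close>. In the application it holds with equality, but
  only the inequality is inherited. Induction fixes the first \<open>k\<close> values of
  \<open>K\<close>.\<close>

lemma weight_longest_nonzero:
  assumes K: "K permutes {1..n}"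
  shows "k \<le> n \<Longrightarrow> \<rho> permutes {1..k} \<Longrightarrow> weight h K \<mu> y k (y \<circ> \<rho>) \<noteq> 0 \<Longrightarrow>
    \<forall>p\<in>{1..k}. n + 1 \<le> K p + \<rho> p \<Longrightarrow> \<forall>p\<in>{1..k}. K p + p = n + 1"
proof (induction k arbitrary: \<rho>)
  case (Suc k)
  obtain \<pi> where \<pi>: "\<pi> permutes {1..k}" "level h K \<mu> k (y \<circ> \<rho>) (y \<circ> \<pi>) \<noteq> 0" "weight h K \<mu> y k (y \<circ> \<pi>) \<noteq> 0"
    using Suc.prems(3) unfolding weight.simps by (metis (mono_tags, lifting) mem_Collect_eq mult_eq_0_iff sum.neutral)
  have "n + 1 \<le> K p + \<pi> p" if p: "p \<in> {1..k}" for p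
  proof -
    define r where "r = inv \<rho> (\<pi> p)"
    have "\<pi> p \<in> {1..Suc k}" using p permutes_in_image[OF \<pi>(1), of p] by simp
    then have r: "r \<in> {1..Suc k}"
      unfolding r_def using permutes_in_image[OF permutes_inv[OF Suc.prems(2)]] by blast
    have \<rho>: "\<rho> r = \<pi> p" unfolding r_def by (rule permutes_inverses(1)[OF Suc.prems(2)])
    have "\<not> K p < K r"
      using level_eq_0[OF p r, of K "y \<circ> \<rho>" "y \<circ> \<pi>"] \<pi>(2) \<rho> by auto
    then show ?thesis using Suc.prems(4) r \<rho> by force
  qed
  then have IH: "\<forall>p\<in>{1..k}. K p + p = n + 1"
    using Suc.IH[OF _ \<pi>(1,3)] Suc.prems(1) by simp
  have "\<rho> (Suc k) \<in> {1..Suc k}" "K (Suc k) \<in> {1..n}"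
    using permutes_in_image[OF Suc.prems(2), of "Suc k"] permutes_in_image[OF K, of "Suc k"] Suc.prems(1) by simp_all
  moreover have "n + 1 \<le> K (Suc k) + \<rho> (Suc k)"
    using Suc.prems(4) by simp
  moreover have "K (Suc k) \<le> n - k"
  proof (rule ccontr)
    assume *: "\<not> K (Suc k) \<le> n - k"
    \<comment> \<open>The position among the first \<open>k\<close> that already carries the value
      \<open>K (Suc k)\<close>, if that value exceeds \<open>n - k\<close>.\<close>
    define p where "p = n + 1 - K (Suc k)"
    have p: "p \<in> {1..k}" using * \<open>K (Suc k) \<in> {1..n}\<close> by (auto simp: p_def)
    then have "K p + p = n + 1" using IH by blast
    then have "K p = K (Suc k)" using \<open>K (Suc k) \<in> {1..n}\<close> by (simp add: p_def)
    then have "p = Suc k" using inj_eq[OF permutes_inj[OF K]] by blast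
    then show False using p by simp
  qed
  ultimately have "K (Suc k) + Suc k = n + 1"
    using Suc.prems(1) by auto
  then show ?case using IH by (auto simp: le_Suc_eq)
qed simp

lemma weight_longest:
  assumes y: "generic n h y"
  shows "k \<le> n \<Longrightarrow> weight h (longest_perm n) \<mu> y k y =
    (\<Prod>b = 1..k. \<Prod>a = 1..<b. \<theta> (\<mu> b - \<mu> a) * \<theta> (h + y b - y a))"
proof (induction k)
  case (Suc k)
  have "level h (longest_perm n) \<mu> k y (y \<circ> \<pi>) = 0" if \<pi>: "\<pi> permutes {1..k}" "\<pi> \<noteq> id" for \<pi>
  proof -
    obtain p where p: "p \<in> {1..k}" "\<pi> p < p"
      using \<pi> permutes_natset_ge[OF \<pi>(1)] by (metis not_le)
    then have "\<pi> p \<in> {1..k}" using permutes_in_image[OF \<pi>(1)] by blast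
    then show ?thesis
      using p Suc.prems by (intro level_eq_0[of p k "\<pi> p"]) (auto simp: longest_perm_def)
  qed
  then have "weight h (longest_perm n) \<mu> y (Suc k) y =
    (\<Sum>\<pi> | \<pi> permutes {1..k}. if \<pi> = id then level h (longest_perm n) \<mu> k y y * weight h (longest_perm n) \<mu> y k y else 0)"
    unfolding weight.simps by (intro sum.cong) auto
  also have "\<dots> = level h (longest_perm n) \<mu> k y y * weight h (longest_perm n) \<mu> y k y"
    by (simp add: permutes_id finite_permutations)
  also have "level h (longest_perm n) \<mu> k y y = (\<Prod>a = 1..<Suc k. \<theta> (\<mu> (Suc k) - \<mu> a) * \<theta> (h + y (Suc k) - y a))"
    unfolding level_diagonal[OF longest_perm_permutes Suc.prems y] atLeastLessThanSuc_atLeastAtMost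
    using Suc.prems by (intro prod.cong) (auto simp: longest_perm_def)
  finally show ?case using Suc by (simp add: mult.commute)
qed simp

end

section \<open>The column recursion\<close>

text \<open>The swap permutes the pairs \<open>a < b\<close> other than \<open>(k, Suc k)\<close>
  and turns that one around. The balanced form avoids a division.\<close>

lemma prod_pairs_swap:
  fixes g :: "nat \<Rightarrow> nat \<Rightarrow> 'b::comm_monoid_mult"
  assumes k: "1 \<le> k" "Suc k \<le> n"
  shows "(\<Prod>b = 1..n. \<Prod>a = 1..<b. g (adj_swap k a) (adj_swap k b)) * g k (Suc k) =
    (\<Prod>b = 1..n. \<Prod>a = 1..<b. g a b) * g (Suc k) k"
proof -
  define S where "S = (SIGMA b:{1..n}. {1..<b}) - {(Suc k, k)}"
  have S: "(SIGMA b:{1..n}. {1..<b}) = insert (Suc k, k) S" "(Suc k, k) \<notin> S" "finite S"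
    using k by (auto simp: S_def)
  have split: "(\<Prod>b = 1..n. \<Prod>a = 1..<b. f a b) = f k (Suc k) * (\<Prod>(b, a)\<in>S. f a b)"
    for f :: "nat \<Rightarrow> nat \<Rightarrow> 'b"
  proof -
    have "(\<Prod>b = 1..n. \<Prod>a = 1..<b. f a b) = (\<Prod>(b, a)\<in>(SIGMA b:{1..n}. {1..<b}). f a b)"
      by (rule prod.Sigma) auto
    also have "\<dots> = f k (Suc k) * (\<Prod>(b, a)\<in>S. f a b)"
      unfolding S(1) using S(2,3) by simp
    finally show ?thesis .
  qed
  have "(\<Prod>(b, a)\<in>S. g (adj_swap k a) (adj_swap k b)) = (\<Prod>(b, a)\<in>S. g a b)"
    by (rule prod.reindex_bij_witness[of _ "map_prod (adj_swap k) (adj_swap k)" "map_prod (adj_swap k) (adj_swap k)"])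
      (use k in \<open>auto simp: S_def Transposition.transpose_def split: if_splits\<close>)
  then show ?thesis
    unfolding split by (simp add: mult_ac)
qed

lemma adj_swap_comp: "adj_swap m \<circ> (adj_swap m \<circ> f) = f" "g \<circ> adj_swap m \<circ> adj_swap m = g"
  by (simp_all add: fun_eq_iff)

context theta_function
begin

lemma restricted_weight_id:
  assumes J: "J permutes {1..n}" and z: "generic n h z"
  shows "restricted_weight n h id J z \<mu> =
    (if J = id then \<Prod>b = 1..n. \<Prod>a = 1..<b. \<theta> (h + \<mu> b - \<mu> a) * \<theta> (z b - z a) else 0)"
proof -
  have "z \<circ> id = z \<circ> J \<circ> inv J"
    by (simp add: comp_assoc permutes_inv_o(1)[OF J])
  then have "restricted_weight n h id J z \<mu> = weight h id \<mu> (z \<circ> J) n (z \<circ> J \<circ> inv J)"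
    by (simp only: restricted_weight_def)
  also have "\<dots> = (if inv J = id
    then \<Prod>b = 1..n. \<Prod>a = 1..<b. \<theta> (h + \<mu> b - \<mu> a) * \<theta> ((z \<circ> J) b - (z \<circ> J) a) else 0)"
    by (rule weight_id[OF generic_permute[OF z J] order_refl permutes_inv[OF J]])
  also have "inv J = id \<longleftrightarrow> J = id"
    using permutes_inv_inv[OF J] by auto
  finally show ?thesis by (cases "J = id") (simp_all only: if_True if_False comp_id simp_thms)
qed

text \<open>\<open>B\<close>, \<open>E\<close>, \<open>F\<close> are the three terms of the column
  recursion for row \<open>I\<close>; the suffix \<open>s\<close> marks the point
  \<open>(s J, z s)\<close>, the suffix \<open>t\<close> the row \<open>s I\<close>. All three obey
  the row recursion with the same coefficients \<open>c\<close>, hence so does the defect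
  \<open>d1 * E - d2 * B - d3 * F\<close>.\<close>

lemma column_step:
  fixes c3 :: complex
  assumes "c3 \<noteq> 0" "c1 * Bs = c2 * B + c3 * Bt" "c1 * Es = c2 * E + c3 * Et" "c1 * Fs = c2 * F + c3 * Ft"
    and "d1 * E = d2 * B + d3 * F" "d1 * Es = d2 * Bs + d3 * Fs"
  shows "d1 * Et = d2 * Bt + d3 * Ft"
proof -
  have "c3 * (d1 * Et) = d1 * (c3 * Et)" by simp
  also have "c3 * Et = c1 * Es - c2 * E" using assms(3) by simp
  also have "d1 * (c1 * Es - c2 * E) = c1 * (d1 * Es) - c2 * (d1 * E)" by (simp add: algebra_simps)
  also have "\<dots> = d2 * (c1 * Bs - c2 * B) + d3 * (c1 * Fs - c2 * F)"
    unfolding assms(5,6) by (simp add: algebra_simps)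
  also have "\<dots> = c3 * (d2 * Bt + d3 * Ft)"
    using assms(2,4) by (simp add: algebra_simps)
  finally show ?thesis using assms(1) by simp
qed

text \<open>The only term outside the row of \<open>id\<close> is \<open>X\<close>. The row
  recursion for \<open>id\<close>, taken at the swapped Kaehler parameters, expresses it through
  that row, where everything is a multiple of the diagonal product \<open>D\<close>.\<close>

lemma restricted_weight_column_id:
  assumes k: "1 \<le> k" "Suc k \<le> n" and \<mu>: "generic n h \<mu>"
    and J: "J permutes {1..n}" and z: "generic n h z"
  shows "\<theta> (h + \<mu> (Suc k) - \<mu> k) * \<theta> (z (J (Suc k)) - z (J k)) *
      restricted_weight n h (adj_swap k) J z (\<mu> \<circ> adj_swap k) =
    \<theta> h * \<theta> (\<mu> k - \<mu> (Suc k) + z (J (Suc k)) - z (J k)) * restricted_weight n h id J z \<mu> +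
    \<theta> (h + z (J (Suc k)) - z (J k)) * \<theta> (\<mu> (Suc k) - \<mu> k) * restricted_weight n h id (J \<circ> adj_swap k) z \<mu>"
proof -
  let ?s = "adj_swap k"
  define D where "D z \<mu> = (\<Prod>b = 1..n. \<Prod>a = 1..<b. \<theta> (h + \<mu> b - \<mu> a) * \<theta> (z b - z a))"
    for z \<mu> :: "nat \<Rightarrow> complex"
  have A_id: "restricted_weight n h id J z \<mu> = (if J = id then D z \<mu> else 0)"
    if "J permutes {1..n}" "generic n h z" for J z \<mu>
    using restricted_weight_id[OF that] by (simp add: D_def)
  define M where "M = \<mu> k - \<mu> (Suc k)"
  define X where "X = restricted_weight n h ?s J z (\<mu> \<circ> ?s)"
  have s: "?s permutes {1..n}" "?s \<noteq> id"
    using adj_swap_permutes[OF k] by (auto simp: fun_eq_iff intro!: exI[of _ k])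
  have Ds: "D z (\<mu> \<circ> ?s) * \<theta> (h - M) = D z \<mu> * \<theta> (h + M)"
    using prod_pairs_swap[OF k, of "\<lambda>a b. \<theta> (h + \<mu> b - \<mu> a)"]
    by (simp add: D_def prod.distrib M_def diff_diff_eq2 add_diff_eq mult_ac)
  have "D (z \<circ> ?s) \<mu> * \<theta> (z (Suc k) - z k) = D z \<mu> * \<theta> (z k - z (Suc k))" for \<mu>
    using prod_pairs_swap[OF k, of "\<lambda>a b. \<theta> (z b - z a)"]
    by (simp add: D_def prod.distrib mult_ac)
  moreover have nz: "\<theta> (z k - z (Suc k)) \<noteq> 0" "\<theta> (z (Suc k) - z k) \<noteq> 0"
    using genericD(1)[OF z] k by auto
  ultimately have Dz: "D (z \<circ> ?s) \<mu> = - D z \<mu>" for \<mu>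
    using diff_commute[of "z k" "z (Suc k)"]
      mult_right_cancel[of "\<theta> (z (Suc k) - z k)" "D (z \<circ> ?s) \<mu>" "- D z \<mu>"] by simp
  have "h + \<mu> (Suc k) - \<mu> k = h - M" "\<mu> (Suc k) - \<mu> k = - M" by (simp_all add: M_def)
  note M_simps = this
  have hM: "\<theta> (h + M) \<noteq> 0"
    using genericD(2)[OF \<mu>, of k "Suc k"] k by (simp add: M_def add_diff_eq)
  have row: "\<theta> (h + z k - z (Suc k)) * \<theta> M * restricted_weight n h id (?s \<circ> J) (z \<circ> ?s) (\<mu> \<circ> ?s) =
    \<theta> h * \<theta> (z (Suc k) - z k + M) * restricted_weight n h id J z (\<mu> \<circ> ?s) + \<theta> (h + M) * \<theta> (z k - z (Suc k)) * X"
    using restricted_weight_row[OF permutes_id J k z generic_permute[OF \<mu> s(1)], of M]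
    by (simp add: M_def X_def)
  have zs: "generic n h (z \<circ> ?s)" by (rule generic_permute[OF z s(1)])
  have sJ: "?s \<circ> J permutes {1..n}" "J \<circ> ?s permutes {1..n}"
    using J s(1) by (auto intro: permutes_compose)
  have eq: "?s \<circ> J = id \<longleftrightarrow> J = ?s" "J \<circ> ?s = id \<longleftrightarrow> J = ?s"
    by (metis adj_swap_comp(1) comp_id transpose_comp_involutory)
      (metis comp_assoc comp_id id_comp transpose_comp_involutory)
  consider "J = id" | "J = ?s" | "J \<noteq> id" "J \<noteq> ?s" by blast
  then show ?thesis
  proof cases
    case 1
    have "\<theta> h * \<theta> (z (Suc k) - z k + M) * D z (\<mu> \<circ> ?s) + \<theta> (h + M) * \<theta> (z k - z (Suc k)) * X = 0"
      using row A_id[OF sJ(1) zs] A_id[OF J z] s(2) by (simp add: 1)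
    then have "\<theta> h * \<theta> (z (Suc k) - z k + M) * (D z (\<mu> \<circ> ?s) * \<theta> (h - M)) + \<theta> (h + M) * \<theta> (z k - z (Suc k)) * X * \<theta> (h - M) = 0"
      by (metis (no_types, lifting) distrib_right mult.assoc mult_zero_left)
    then have "\<theta> (h + M) * (\<theta> h * \<theta> (z (Suc k) - z k + M) * D z \<mu> + \<theta> (z k - z (Suc k)) * X * \<theta> (h - M)) = 0"
      unfolding Ds by (simp add: algebra_simps)
    then have "\<theta> h * \<theta> (z (Suc k) - z k + M) * D z \<mu> + \<theta> (z k - z (Suc k)) * X * \<theta> (h - M) = 0"
      using hM by simp
    then have "\<theta> (h - M) * \<theta> (z (Suc k) - z k) * X = \<theta> h * \<theta> (z (Suc k) - z k + M) * D z \<mu>"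
      unfolding diff_commute[of "z k" "z (Suc k)"] by (simp add: algebra_simps)
    then show ?thesis
      using A_id[OF sJ(2) z] A_id[OF J z] s(2) unfolding M_simps X_def
      by (simp add: 1 M_def[symmetric] algebra_simps)
  next
    case 2
    have "\<theta> (h + z k - z (Suc k)) * \<theta> M * - D z (\<mu> \<circ> ?s) = \<theta> (h + M) * \<theta> (z k - z (Suc k)) * X"
      using row A_id[OF sJ(1) zs] A_id[OF J z] s(2) by (simp add: 2 Dz)
    then have "\<theta> (h + z k - z (Suc k)) * \<theta> M * - (D z (\<mu> \<circ> ?s) * \<theta> (h - M)) = \<theta> (h + M) * \<theta> (z k - z (Suc k)) * X * \<theta> (h - M)"
      by (metis (no_types, lifting) mult.assoc mult_minus_left)
    then have "\<theta> (h + M) * (\<theta> (h + z k - z (Suc k)) * - \<theta> M * D z \<mu>) = \<theta> (h + M) * (\<theta> (z k - z (Suc k)) * X * \<theta> (h - M))"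
      unfolding Ds by (simp add: algebra_simps)
    then have "\<theta> (h + z k - z (Suc k)) * - \<theta> M * D z \<mu> = \<theta> (z k - z (Suc k)) * X * \<theta> (h - M)"
      using mult_left_cancel[OF hM] by blast
    then show ?thesis
      using A_id[OF sJ(2) z] A_id[OF J z] s(2) unfolding M_simps X_def
      by (simp add: 2 minus algebra_simps)
  next
    case 3
    have "X = 0"
      using row A_id[OF sJ(1) zs] A_id[OF J z] eq 3 hM nz by simp
    then show ?thesis
      using A_id[OF sJ(2) z] A_id[OF J z] eq 3 unfolding X_def by simp
  qed
qed

lemma restricted_weight_column:
  assumes k: "1 \<le> k" "Suc k \<le> n" and \<mu>: "generic n h \<mu>"
    and I: "I permutes {1..n}" and J: "J permutes {1..n}" and z: "generic n h z"
  shows "\<theta> (h + \<mu> (Suc k) - \<mu> k) * \<theta> (z (J (Suc k)) - z (J k)) *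
      restricted_weight n h (I \<circ> adj_swap k) J z (\<mu> \<circ> adj_swap k) =
    \<theta> h * \<theta> (\<mu> k - \<mu> (Suc k) + z (J (Suc k)) - z (J k)) * restricted_weight n h I J z \<mu> +
    \<theta> (h + z (J (Suc k)) - z (J k)) * \<theta> (\<mu> (Suc k) - \<mu> k) * restricted_weight n h I (J \<circ> adj_swap k) z \<mu>"
  using I J z
proof (induction I arbitrary: J z rule: permutes_adjacent_induct)
  case id
  then show ?case using restricted_weight_column_id[OF k \<mu>] by (simp only: id_comp)
next
  case (adj m I J z)
  let ?s = "adj_swap m" and ?t = "adj_swap k"
  have s: "?s permutes {1..n}" and t: "?t permutes {1..n}"
    by (rule adj_swap_permutes[OF adj(1,2)], rule adj_swap_permutes[OF k])
  have sJ: "?s \<circ> J permutes {1..n}" and zs: "generic n h (z \<circ> ?s)"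
    by (rule permutes_compose[OF adj(5) s], rule generic_permute[OF adj(6) s])
  have It: "I \<circ> ?t permutes {1..n}" and Jt: "J \<circ> ?t permutes {1..n}" and \<mu>t: "generic n h (\<mu> \<circ> ?t)"
    by (rule permutes_compose[OF t adj(3)], rule permutes_compose[OF t adj(5)], rule generic_permute[OF \<mu> t])
  define M where "M = \<mu> (inv I (Suc m)) - \<mu> (inv I m)"
  \<comment> \<open>Right multiplication of \<open>I\<close> is undone by the swap of
    \<open>\<mu>\<close>, so the row recursions of \<open>I\<close> and of
    \<open>I \<circ> ?t\<close> have the same \<open>M\<close>.\<close>
  have inv: "(\<mu> \<circ> ?t) (inv (I \<circ> ?t) c) = \<mu> (inv I c)" for c
    by (simp add: o_inv_distrib permutes_bij[OF adj(3)])
  have ab: "inv I m \<in> {1..n}" "inv I (Suc m) \<in> {1..n}" "inv I (Suc m) \<noteq> inv I m"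
    using adj(1,2) permutes_in_image[OF permutes_inv[OF adj(3)]] inj_eq[OF permutes_inj[OF permutes_inv[OF adj(3)]]]
    by simp_all
  have nz: "\<theta> (h + M) * \<theta> (z m - z (Suc m)) \<noteq> 0"
    using genericD(2)[OF \<mu> ab(2,1,3)] genericD(1)[OF adj(6), of m "Suc m"] adj(1,2) by (simp add: M_def add_diff_eq)
  note r1 = restricted_weight_row[OF adj(3) adj(5) adj(1,2) adj(6) \<mu> M_def]
  note r2 = restricted_weight_row[OF It adj(5) adj(1,2) adj(6) \<mu>t, unfolded inv, OF M_def]
  note r3 = restricted_weight_row[OF adj(3) Jt adj(1,2) adj(6) \<mu> M_def]
  note h1 = adj(4)[OF adj(5,6)]
  note h2 = adj(4)[OF sJ zs]
  have e: "(z \<circ> ?s) ((?s \<circ> J) c) = z (J c)" for c by simp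
  from column_step[OF nz r1 r2 r3[folded comp_assoc] h1 h2[unfolded e comp_assoc, folded comp_assoc]]
  show ?case by (simp only: comp_assoc)
qed

end

section \<open>Mirror symmetry at generic points\<close>

lemma prod_pairs_minus_one:
  "(\<Prod>b = 1..n. \<Prod>a = 1..<b. - 1 :: complex) = (- 1) ^ (n * (n - 1) div 2)"
proof (induction n)
  case (Suc n)
  have "Suc n * n = n * (n - 1) + 2 * n"
    by (cases n) simp_all
  then have "Suc n * (Suc n - 1) div 2 = n * (n - 1) div 2 + n" by simp
  then show ?case using Suc by (simp add: power_add del: mult_Suc)
qed simp

lemma longest_perm_involution [simp]: "longest_perm n (longest_perm n i) = i"
  by (auto simp: longest_perm_def)

context theta_function
begin

theorem restricted_weight_mirror:
  assumes I: "I permutes {1..n}" and J: "J permutes {1..n}"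
    and z: "generic n h z" and \<mu>: "generic n h \<mu>"
  shows "restricted_weight n h I J z \<mu> = (- 1) ^ (n * (n - 1) div 2) *
    restricted_weight n h (longest_perm n \<circ> inv J) (longest_perm n \<circ> inv I) (\<mu> \<circ> longest_perm n) (\<lambda>i. - z i)"
proof -
  let ?\<sigma> = "longest_perm n"
  note \<sigma> = longest_perm_permutes[of n]
  define C where "C I J z = (- 1) ^ (n * (n - 1) div 2) *
    restricted_weight n h (?\<sigma> \<circ> inv J) (?\<sigma> \<circ> inv I) (\<mu> \<circ> ?\<sigma>) (\<lambda>i. - z i)" for I J z
  \<comment> \<open>The longest permutation cancels from all variables and survives only in the
    index of the weight.\<close>
  have C_weight: "C I J z = (- 1) ^ (n * (n - 1) div 2) *
    weight h (?\<sigma> \<circ> inv J) (\<lambda>i. - z i) (\<mu> \<circ> inv I) n (\<mu> \<circ> inv J)" for I J z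
  proof -
    have "\<mu> \<circ> ?\<sigma> \<circ> (?\<sigma> \<circ> f) = \<mu> \<circ> f" for f :: "nat \<Rightarrow> nat"
      by (simp add: fun_eq_iff)
    then show ?thesis by (simp only: C_def restricted_weight_def)
  qed
  \<comment> \<open>The column recursion of the dual weight: right multiplication by
    \<open>adj_swap m\<close> of \<open>?\<sigma> \<circ> inv J\<close> and
    \<open>?\<sigma> \<circ> inv I\<close> is left multiplication of \<open>J\<close> and
    \<open>I\<close>.\<close>
  have C_row: "\<theta> (h + z m - z (Suc m)) * \<theta> M * C I (adj_swap m \<circ> J) (z \<circ> adj_swap m) =
      \<theta> h * \<theta> (z (Suc m) - z m + M) * C I J z + \<theta> (h + M) * \<theta> (z m - z (Suc m)) * C (adj_swap m \<circ> I) J z"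
    if I: "I permutes {1..n}" and J: "J permutes {1..n}" and m: "1 \<le> m" "Suc m \<le> n" and z: "generic n h z"
      and M: "M = \<mu> (inv I (Suc m)) - \<mu> (inv I m)" for I J m z M
  proof -
    let ?s = "adj_swap m"
    have inv: "?\<sigma> \<circ> inv K \<circ> ?s = ?\<sigma> \<circ> inv (?s \<circ> K)" if "K permutes {1..n}" for K
      by (simp add: o_inv_distrib permutes_bij[OF that] comp_assoc)
    have per: "?\<sigma> \<circ> inv K permutes {1..n}" if "K permutes {1..n}" for K
      by (rule permutes_compose[OF permutes_inv[OF that] \<sigma>])
    have zs: "(\<lambda>i. - z i) \<circ> ?s = (\<lambda>i. - (z \<circ> ?s) i)"
      by (simp add: fun_eq_iff)
    have e: "(\<mu> \<circ> ?\<sigma>) ((?\<sigma> \<circ> inv I) c) = \<mu> (inv I c)" for c by simp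
    have args: "h + - z (Suc m) - - z m = h + z m - z (Suc m)"
      "- z m - - z (Suc m) + \<mu> (inv I (Suc m)) - \<mu> (inv I m) = z (Suc m) - z m + M"
      "- z (Suc m) - - z m = z m - z (Suc m)"
      "h + \<mu> (inv I (Suc m)) - \<mu> (inv I m) = h + M"
      by (simp_all add: M)
    have "\<theta> (h + z m - z (Suc m)) * \<theta> M *
        restricted_weight n h (?\<sigma> \<circ> inv (?s \<circ> J)) (?\<sigma> \<circ> inv I) (\<mu> \<circ> ?\<sigma>) (\<lambda>i. - (z \<circ> ?s) i) =
      \<theta> h * \<theta> (z (Suc m) - z m + M) * restricted_weight n h (?\<sigma> \<circ> inv J) (?\<sigma> \<circ> inv I) (\<mu> \<circ> ?\<sigma>) (\<lambda>i. - z i) +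
      \<theta> (h + M) * \<theta> (z m - z (Suc m)) *
        restricted_weight n h (?\<sigma> \<circ> inv J) (?\<sigma> \<circ> inv (?s \<circ> I)) (\<mu> \<circ> ?\<sigma>) (\<lambda>i. - z i)"
      using restricted_weight_column[OF m generic_minus[OF z] per[OF J] per[OF I] generic_permute[OF \<mu> \<sigma>]]
      unfolding inv[OF I] inv[OF J] zs e args M[symmetric] .
    from arg_cong[OF this, of "\<lambda>x. (- 1) ^ (n * (n - 1) div 2) * x"] show ?thesis
      unfolding C_def by (simp only: distrib_left mult_ac)
  qed
  have C_id: "C id J z = restricted_weight n h id J z \<mu>"
    if J: "J permutes {1..n}" and z: "generic n h z" for J z
  proof (cases "J = id")
    case True
    have "C id J z = (- 1) ^ (n * (n - 1) div 2) * weight h ?\<sigma> (\<lambda>i. - z i) \<mu> n \<mu>"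
      unfolding C_weight True by (simp only: inv_id comp_id)
    \<comment> \<open>One sign for each pair \<open>a < b\<close>; oddness absorbs it when
      \<open>- z\<close> is turned back into \<open>z\<close>.\<close>
    also have "\<dots> = (\<Prod>b = 1..n. \<Prod>a = 1..<b. - 1 * (\<theta> (- z b - - z a) * \<theta> (h + \<mu> b - \<mu> a)))"
      unfolding weight_longest[OF \<mu> order_refl] prod_pairs_minus_one[symmetric] prod.distrib ..
    also have "\<dots> = (\<Prod>b = 1..n. \<Prod>a = 1..<b. \<theta> (h + \<mu> b - \<mu> a) * \<theta> (z b - z a))"
    proof (intro prod.cong refl)
      fix a b
      show "- 1 * (\<theta> (- z b - - z a) * \<theta> (h + \<mu> b - \<mu> a)) = \<theta> (h + \<mu> b - \<mu> a) * \<theta> (z b - z a)"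
        using diff_commute[of "z a" "z b"] by simp
    qed
    also have "\<dots> = restricted_weight n h id J z \<mu>"
      unfolding restricted_weight_id[OF J z] by (simp only: True if_True simp_thms)
    finally show ?thesis .
  next
    case False
    have K: "?\<sigma> \<circ> inv J permutes {1..n}" by (rule permutes_compose[OF permutes_inv[OF J] \<sigma>])
    have range: "inv J p \<in> {1..n}" if "p \<in> {1..n}" for p
      using that permutes_in_image[OF permutes_inv[OF J]] by blast
    have "weight h (?\<sigma> \<circ> inv J) (\<lambda>i. - z i) \<mu> n (\<mu> \<circ> inv J) = 0"
    proof (rule ccontr)
      assume "weight h (?\<sigma> \<circ> inv J) (\<lambda>i. - z i) \<mu> n (\<mu> \<circ> inv J) \<noteq> 0"
      then have *: "\<forall>p\<in>{1..n}. (?\<sigma> \<circ> inv J) p + p = n + 1"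
        by (rule weight_longest_nonzero[OF K order_refl permutes_inv[OF J]])
          (use range in \<open>auto simp: longest_perm_def\<close>)
      have "inv J p = p" if "p \<in> {1..n}" for p
        using bspec[OF * that] range[OF that] that by (simp add: longest_perm_def)
      then have "inv J = id"
        using permutes_natset_le[OF permutes_inv[OF J]] by simp
      then show False using False permutes_inv_inv[OF J] by simp
    qed
    then show ?thesis
      unfolding restricted_weight_id[OF J z] C_weight using False by (simp only: inv_id comp_id if_False mult_zero_right)
  qed
  have "restricted_weight n h I J z \<mu> = C I J z"
    using I J z
  proof (induction I arbitrary: J z rule: permutes_adjacent_induct)
    case id
    show ?case by (rule C_id[OF id, symmetric])
  next
    case (adj m I J z)
    let ?s = "adj_swap m"
    have s: "?s permutes {1..n}" by (rule adj_swap_permutes[OF adj(1,2)])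
    define M where "M = \<mu> (inv I (Suc m)) - \<mu> (inv I m)"
    have ab: "inv I m \<in> {1..n}" "inv I (Suc m) \<in> {1..n}" "inv I (Suc m) \<noteq> inv I m"
      using adj(1,2) permutes_in_image[OF permutes_inv[OF adj(3)]] inj_eq[OF permutes_inj[OF permutes_inv[OF adj(3)]]]
      by simp_all
    have nz: "\<theta> (h + M) * \<theta> (z m - z (Suc m)) \<noteq> 0"
      using genericD(2)[OF \<mu> ab(2,1,3)] genericD(1)[OF adj(6), of m "Suc m"] adj(1,2) by (simp add: M_def add_diff_eq)
    note row = restricted_weight_row[OF adj(3) adj(5) adj(1,2) adj(6) \<mu> M_def]
    note C_row = C_row[OF adj(3) adj(5) adj(1,2) adj(6) M_def]
    have "\<theta> (h + M) * \<theta> (z m - z (Suc m)) * restricted_weight n h (?s \<circ> I) J z \<mu> =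
      \<theta> (h + M) * \<theta> (z m - z (Suc m)) * C (?s \<circ> I) J z"
      using row C_row
      unfolding adj(4)[OF adj(5,6)] adj(4)[OF permutes_compose[OF adj(5) s] generic_permute[OF adj(6) s]]
      by (simp only: add_left_cancel)
    then show ?case using mult_left_cancel[OF nz] by blast
  qed
  then show ?thesis unfolding C_def .
qed

end

section \<open>Comparison with the symmetrized weight functions\<close>

text \<open>Translates the index \<open>a\<close> of the increasing enumeration into the position
  that carries this value. Outside the range it is the identity, so that it is a permutation by
  which sums can be reindexed.\<close>

definition position :: "(nat \<Rightarrow> nat) \<Rightarrow> nat \<Rightarrow> nat \<Rightarrow> nat" where
  "position I k a = (if a \<in> {1..k} then inv I (idx I k a) else a)"

lemma bij_betw_idx:
  assumes "inj I"
  shows "bij_betw (idx I k) {1..k} (I ` {1..k})"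
proof -
  let ?xs = "sorted_list_of_set (I ` {1..k})"
  have len: "length ?xs = k"
    using card_image[OF inj_on_subset[OF assms subset_UNIV]] by simp
  have "bij_betw ((!) ?xs) {..<k} (I ` {1..k})"
    by (rule bij_betw_nth) (simp_all only: len distinct_sorted_list_of_set set_sorted_list_of_set finite_imageI finite_atLeastAtMost)
  moreover have "bij_betw (\<lambda>c. c - 1) {1..k} {..<k}"
    by (rule bij_betw_byWitness[where f' = Suc]) auto
  ultimately have "bij_betw ((!) ?xs \<circ> (\<lambda>c. c - 1)) {1..k} (I ` {1..k})"
    by (rule bij_betw_trans[rotated])
  then show ?thesis
    by (simp add: idx_def[abs_def] o_def)
qed

lemma idx_less_iff:
  assumes "inj I" "a \<in> {1..k}" "b \<in> {1..k}"
  shows "idx I k a < idx I k b \<longleftrightarrow> a < b"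
proof -
  let ?xs = "sorted_list_of_set (I ` {1..k})"
  have len: "length ?xs = k"
    using card_image[OF inj_on_subset[OF assms(1) subset_UNIV]] by simp
  have less: "idx I k a < idx I k b" if "a \<in> {1..k}" "b \<in> {1..k}" "a < b" for a b
    using that sorted_wrt_nth_less[OF strict_sorted_list_of_set, of "a - 1" "b - 1" "I ` {1..k}"] len
    by (auto simp: idx_def)
  show ?thesis
    using less[OF assms(2,3)] less[OF assms(3,2)] by (metis less_asym less_irrefl linorder_neqE_nat)
qed

lemma position_permutes:
  assumes "I permutes {1..n}"
  shows "position I k permutes {1..k}"
proof (rule bij_imp_permutes)
  note inj = permutes_inj[OF assms]
  have "inv_into UNIV I ` I ` {1..k} = {1..k}"
    using inj by (simp add: image_comp)
  then have "bij_betw (inv I) (I ` {1..k}) {1..k}"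
    using inj_on_subset[OF permutes_inj[OF permutes_inv[OF assms]] subset_UNIV]
    by (auto simp: bij_betw_def)
  then have "bij_betw (inv I \<circ> idx I k) {1..k} {1..k}"
    using bij_betw_trans[OF bij_betw_idx[OF inj]] by blast
  then show "bij_betw (position I k) {1..k} {1..k}"
    by (rule bij_betw_cong[THEN iffD1, rotated]) (simp add: position_def)
  show "position I k a = a" if "a \<notin> {1..k}" for a
    using that by (auto simp: position_def)
qed

lemma apply_position:
  assumes "I permutes {1..n}" "a \<in> {1..k}"
  shows "I (position I k a) = idx I k a"
  using assms permutes_inverses(1)[OF assms(1)] by (simp add: position_def)

lemma idx_full:
  assumes "I permutes {1..n}" "c \<in> {1..n}"
  shows "idx I n c = c"
proof -
  have "sorted_list_of_set {1..n} = [1..<Suc n]"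
    by (metis atLeastLessThanSuc_atLeastAtMost sorted_list_of_set_range)
  then show ?thesis
    using assms by (simp add: idx_def permutes_image del: upt_Suc)
qed

section \<open>Iterated symmetrization as a nested sum\<close>

lemma Sym_commute:
  assumes "k \<noteq> m"
  shows "Sym k (Sym m f) = Sym m (Sym k f)"
proof
  fix t
  show "Sym k (Sym m f) t = Sym m (Sym k f) t"
    unfolding Sym_def using assms
    by (subst sum.swap) (simp add: fun_upd_twist)
qed

lemma foldr_Sym_commute: "m \<notin> set ks \<Longrightarrow> foldr Sym ks (Sym m f) = Sym m (foldr Sym ks f)"
  by (induction ks) (auto simp: Sym_commute)

lemma Sym_fun_upd:
  assumes "n \<noteq> k"
  shows "Sym k (\<lambda>t. f (t(n := z))) t = Sym k f (t(n := z))"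
  unfolding Sym_def
proof (intro sum.cong refl)
  fix \<pi>
  have "(t(k := t k \<circ> \<pi>))(n := z) = (t(n := z))(k := (t(n := z)) k \<circ> \<pi>)"
    using assms by (simp add: fun_eq_iff)
  then show "f ((t(k := t k \<circ> \<pi>))(n := z)) = f ((t(n := z))(k := (t(n := z)) k \<circ> \<pi>))"
    by (rule arg_cong)
qed

lemma foldr_Sym_fun_upd:
  "n \<notin> set ks \<Longrightarrow> foldr Sym ks (\<lambda>t. f (t(n := z))) t = foldr Sym ks f (t(n := z))"
proof (induction ks arbitrary: t)
  case (Cons k ks)
  have "foldr Sym ks (\<lambda>t. f (t(n := z))) = (\<lambda>t. foldr Sym ks f (t(n := z)))"
    by (rule ext, rule Cons.IH) (use Cons.prems in simp)
  moreover have ne: "n \<noteq> k" using Cons.prems by simp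
  ultimately show ?case
    by (simp only: foldr.simps comp_apply Sym_fun_upd[OF ne])
qed simp

text \<open>The shape of an iterated symmetrization whose summand is a product of factors
  \<open>Y k\<close> of two neighbouring levels; \<open>s\<close> is the already permuted upper
  level.\<close>

primrec nested_sum ::
  "(nat \<Rightarrow> (nat \<Rightarrow> complex) \<Rightarrow> (nat \<Rightarrow> complex) \<Rightarrow> complex) \<Rightarrow> nat \<Rightarrow> chern_roots \<Rightarrow> (nat \<Rightarrow> complex) \<Rightarrow> complex" where
  "nested_sum Y 0 t s = 1"
| "nested_sum Y (Suc k) t s =
    (\<Sum>\<pi> | \<pi> permutes {1..k}. Y k s (t k \<circ> \<pi>) * nested_sum Y k t (t k \<circ> \<pi>))"

lemma nested_sum_cong:
  "(\<And>i. i < k \<Longrightarrow> t i = t' i) \<Longrightarrow> nested_sum Y k t s = nested_sum Y k t' s"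
  by (induction k arbitrary: s) auto

text \<open>\<open>g\<close> collects the factors that do not involve the levels below
  \<open>m\<close>, and so leaves the inner sums; in the step it absorbs the factor
  \<open>Y m\<close>.\<close>

lemma foldr_Sym_eq_nested_sum:
  assumes Y0: "\<And>s s'. Y 0 s s' = 1" and "1 \<le> m" and "\<And>k x t. k < m \<Longrightarrow> g (t(k := x)) = g t"
  shows "foldr Sym [1..<m] (\<lambda>t. (\<Prod>k = 1..<m. Y k (t (Suc k)) (t k)) * g t) t = nested_sum Y m t (t m) * g t"
  using assms(2,3)
proof (induction m arbitrary: g t rule: dec_induct)
  case base
  then show ?case by (simp add: Y0)
next
  case (step m)
  let ?F = "\<lambda>t. (\<Prod>k = 1..<Suc m. Y k (t (Suc k)) (t k)) * g t"
  have F: "?F = (\<lambda>t. (\<Prod>k = 1..<m. Y k (t (Suc k)) (t k)) * (Y m (t (Suc m)) (t m) * g t))"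
    using step(1) by (simp add: mult.assoc)
  have IH: "foldr Sym [1..<m] ?F t = nested_sum Y m t (t m) * (Y m (t (Suc m)) (t m) * g t)" for t
    unfolding F by (rule step.IH) (use step.prems in auto)
  \<comment> \<open>The fold applies \<open>Sym m\<close> first; commutation makes it the outermost
    sum.\<close>
  have "foldr Sym [1..<Suc m] ?F t = Sym m (foldr Sym [1..<m] ?F) t"
    using step(1) by (simp add: foldr_Sym_commute)
  also have "\<dots> = nested_sum Y (Suc m) t (t (Suc m)) * g t"
    unfolding Sym_def IH nested_sum.simps sum_distrib_right
  proof (intro sum.cong refl)
    fix \<pi>
    have "nested_sum Y m (t(m := t m \<circ> \<pi>)) (t m \<circ> \<pi>) = nested_sum Y m t (t m \<circ> \<pi>)"
      by (rule nested_sum_cong) simp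
    moreover have g: "g (t(m := t m \<circ> \<pi>)) = g t"
      by (rule step.prems) simp
    ultimately show "nested_sum Y m (t(m := t m \<circ> \<pi>)) ((t(m := t m \<circ> \<pi>)) m) *
        (Y m ((t(m := t m \<circ> \<pi>)) (Suc m)) ((t(m := t m \<circ> \<pi>)) m) * g (t(m := t m \<circ> \<pi>))) =
      Y m (t (Suc m)) (t m \<circ> \<pi>) * nested_sum Y m t (t m \<circ> \<pi>) * g t"
      by (simp add: g)
  qed
  finally show ?case .
qed

locale elliptic_parameter =
  fixes q :: complex
  assumes q: "q \<noteq> 0" "norm q < 1"

sublocale elliptic_parameter \<subseteq> theta_function "theta q"
  by unfold_locales (fact theta_minus, fact theta_three_term[OF q])

context elliptic_parameter
begin

definition level_quotient where
  "level_quotient I h \<mu> k t' t = (\<Prod>a = 1..k. \<Prod>c = 1..k + 1. psi q I h \<mu> k a c (t' c - t a)) /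
    (\<Prod>(a, b) \<in> {(a, b). 1 \<le> a \<and> a < b \<and> b \<le> k}. theta q (h + t a - t b) * theta q (t b - t a))"

text \<open>The enumeration \<open>idx\<close> is strictly increasing, so after relabelling the
  pairs \<open>a < b\<close> of the denominator are those with \<open>I p < I r\<close>.\<close>

lemma level_quotient_eq_level:
  assumes I: "I permutes {1..n}"
    and t': "\<And>c. c \<in> {1..Suc k} \<Longrightarrow> t' c = s' (position I (Suc k) c)"
    and t: "\<And>a. a \<in> {1..k} \<Longrightarrow> t a = s (position I k a)"
  shows "level_quotient I h \<mu> k t' t = level h I \<mu> k s' s"
proof -
  define N where "N p r = (if I r < I p then theta q (h + s' r - s p)
     else if r = p then theta q (s' p - s p + ((if I (Suc k) < I p then 0 else h) + \<mu> (Suc k) - \<mu> p))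
     else theta q (s' r - s p))" for p r
  define D where "D p r = (if I p < I r then theta q (h + s p - s r) * theta q (s r - s p) else 1)" for p r
  note inj = permutes_inj[OF I]
  have permute: "(\<Prod>p = 1..j. g p) = (\<Prod>a = 1..j. g (position I j a))" for j and g :: "nat \<Rightarrow> complex"
    by (rule prod.permute[OF position_permutes[OF I], unfolded o_def])
  have psi: "psi q I h \<mu> k a c (t' c - t a) = N (position I k a) (position I (Suc k) c)"
    if a: "a \<in> {1..k}" and c: "c \<in> {1..Suc k}" for a c
  proof -
    have idx: "idx I k a = I (position I k a)" "idx I (k + 1) c = I (position I (Suc k) c)" "j_ind I k a = position I k a"
      using apply_position[OF I a] apply_position[OF I c] a by (simp_all add: j_ind_def position_def)
    show ?thesis
      unfolding psi_def idx N_def t'[OF c] t[OF a] p_ind_def inj_eq[OF inj]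
      by (auto simp: algebra_simps)
  qed
  have num: "(\<Prod>a = 1..k. \<Prod>c = 1..k + 1. psi q I h \<mu> k a c (t' c - t a)) = (\<Prod>p = 1..k. \<Prod>r = 1..Suc k. N p r)"
  proof -
    have "(\<Prod>p = 1..k. \<Prod>r = 1..Suc k. N p r) = (\<Prod>p = 1..k. \<Prod>c = 1..Suc k. N p (position I (Suc k) c))"
      by (rule prod.cong[OF refl permute])
    also have "\<dots> = (\<Prod>a = 1..k. \<Prod>c = 1..Suc k. N (position I k a) (position I (Suc k) c))"
      by (rule permute)
    also have "\<dots> = (\<Prod>a = 1..k. \<Prod>c = 1..k + 1. psi q I h \<mu> k a c (t' c - t a))"
      by (intro prod.cong psi[symmetric]) auto
    finally show ?thesis by simp
  qed
  have den: "(\<Prod>(a, b) \<in> {(a, b). 1 \<le> a \<and> a < b \<and> b \<le> k}. theta q (h + t a - t b) * theta q (t b - t a)) =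
    (\<Prod>p = 1..k. \<Prod>r = 1..k. D p r)"
  proof -
    have "(\<Prod>p = 1..k. \<Prod>r = 1..k. D p r) = (\<Prod>p = 1..k. \<Prod>b = 1..k. D p (position I k b))"
      by (rule prod.cong[OF refl permute])
    also have "\<dots> = (\<Prod>a = 1..k. \<Prod>b = 1..k. D (position I k a) (position I k b))"
      by (rule permute)
    also have "\<dots> = (\<Prod>a = 1..k. \<Prod>b = 1..k. if a < b then theta q (h + t a - t b) * theta q (t b - t a) else 1)"
    proof (intro prod.cong refl)
      fix a b assume "a \<in> {1..k}" "b \<in> {1..k}"
      then show "D (position I k a) (position I k b) = (if a < b then theta q (h + t a - t b) * theta q (t b - t a) else 1)"
        using apply_position[OF I] idx_less_iff[OF inj] t by (simp add: D_def del: atLeastAtMost_iff)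
    qed
    also have "\<dots> = (\<Prod>(a, b)\<in>{1..k}\<times>{1..k}. if a < b then theta q (h + t a - t b) * theta q (t b - t a) else 1)"
      by (rule prod.cartesian_product)
    also have "\<dots> = (\<Prod>(a, b) \<in> {(a, b). 1 \<le> a \<and> a < b \<and> b \<le> k}. theta q (h + t a - t b) * theta q (t b - t a))"
      by (rule prod.mono_neutral_cong_right) (auto split: if_splits)
    finally show ?thesis ..
  qed
  have "level h I \<mu> k s' s = (\<Prod>p = 1..k. \<Prod>r = 1..Suc k. N p r / (if r \<le> k then D p r else 1))"
    unfolding level_def by (intro prod.cong refl) (simp add: weight_factor_def N_def D_def)
  also have "\<dots> = (\<Prod>p = 1..k. \<Prod>r = 1..Suc k. N p r) / (\<Prod>p = 1..k. \<Prod>r = 1..Suc k. if r \<le> k then D p r else 1)"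
    by (simp only: prod_dividef)
  also have "(\<Prod>p = 1..k. \<Prod>r = 1..Suc k. if r \<le> k then D p r else 1) = (\<Prod>p = 1..k. \<Prod>r = 1..k. D p r)"
    by simp
  finally show ?thesis
    unfolding level_quotient_def num den by simp
qed

text \<open>\<open>\<rho> k\<close> records the order in which the given Chern roots list the first
  \<open>k\<close> entries of \<open>y\<close>. The sum over all permutations absorbs both this
  order and the relabelling by \<open>position\<close>.\<close>

lemma nested_sum_eq_weight:
  assumes I: "I permutes {1..n}"
    and \<rho>: "\<And>k. k < n \<Longrightarrow> \<rho> k permutes {1..k}" "\<And>k a. k < n \<Longrightarrow> a \<in> {1..k} \<Longrightarrow> t k a = y (\<rho> k a)"
  shows "k \<le> n \<Longrightarrow> (\<And>c. c \<in> {1..k} \<Longrightarrow> s' c = s (position I k c)) \<Longrightarrow>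
    nested_sum (level_quotient I h \<mu>) k t s' = weight h I \<mu> y k s"
proof (induction k arbitrary: s' s)
  case (Suc k)
  then have k: "k < n" by simp
  note \<rho>k = \<rho>(1)[OF k]
  note pk = position_permutes[OF I, of k]
  have "weight h I \<mu> y (Suc k) s =
    (\<Sum>\<pi> | \<pi> permutes {1..k}. level h I \<mu> k s (y \<circ> (\<rho> k \<circ> \<pi> \<circ> inv (position I k))) * weight h I \<mu> y k (y \<circ> (\<rho> k \<circ> \<pi> \<circ> inv (position I k))))"
    unfolding weight.simps
  proof (rule sum.reindex_bij_witness[of _ "\<lambda>\<pi>. \<rho> k \<circ> \<pi> \<circ> inv (position I k)" "\<lambda>\<pi>. inv (\<rho> k) \<circ> \<pi> \<circ> position I k"])
    fix \<pi> assume "\<pi> \<in> {\<pi>. \<pi> permutes {1..k}}"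
    then have \<pi>: "\<pi> permutes {1..k}" by simp
    show e: "\<rho> k \<circ> (inv (\<rho> k) \<circ> \<pi> \<circ> position I k) \<circ> inv (position I k) = \<pi>"
      by (simp add: fun_eq_iff permutes_inverses[OF \<rho>k] permutes_inverses[OF pk])
    show "inv (\<rho> k) \<circ> (\<rho> k \<circ> \<pi> \<circ> inv (position I k)) \<circ> position I k = \<pi>"
      by (simp add: fun_eq_iff permutes_inverses[OF \<rho>k] permutes_inverses[OF pk])
    show "inv (\<rho> k) \<circ> \<pi> \<circ> position I k \<in> {\<pi>. \<pi> permutes {1..k}}"
      using permutes_compose[OF pk permutes_compose[OF \<pi> permutes_inv[OF \<rho>k]]] by (simp add: comp_assoc)
    show "\<rho> k \<circ> \<pi> \<circ> inv (position I k) \<in> {\<pi>. \<pi> permutes {1..k}}"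
      using permutes_compose[OF permutes_inv[OF pk] permutes_compose[OF \<pi> \<rho>k]] by (simp add: comp_assoc)
    show "level h I \<mu> k s (y \<circ> (\<rho> k \<circ> (inv (\<rho> k) \<circ> \<pi> \<circ> position I k) \<circ> inv (position I k))) *
        weight h I \<mu> y k (y \<circ> (\<rho> k \<circ> (inv (\<rho> k) \<circ> \<pi> \<circ> position I k) \<circ> inv (position I k))) =
      level h I \<mu> k s (y \<circ> \<pi>) * weight h I \<mu> y k (y \<circ> \<pi>)"
      unfolding e ..
  qed
  also have "\<dots> = nested_sum (level_quotient I h \<mu>) (Suc k) t s'"
    unfolding nested_sum.simps
  proof (intro sum.cong refl)
    fix \<pi> assume "\<pi> \<in> {\<pi>. \<pi> permutes {1..k}}"
    then have \<pi>: "\<pi> permutes {1..k}" by simp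
    have eq: "(t k \<circ> \<pi>) c = (y \<circ> (\<rho> k \<circ> \<pi> \<circ> inv (position I k))) (position I k c)" if "c \<in> {1..k}" for c
      using that \<rho>(2)[OF k, of "\<pi> c"] permutes_in_image[OF \<pi>, of c] by (simp add: permutes_inverses[OF pk])
    have "level_quotient I h \<mu> k s' (t k \<circ> \<pi>) = level h I \<mu> k s (y \<circ> (\<rho> k \<circ> \<pi> \<circ> inv (position I k)))"
      by (rule level_quotient_eq_level[OF I]) (fact Suc.prems(2), fact eq)
    moreover have "nested_sum (level_quotient I h \<mu>) k t (t k \<circ> \<pi>) = weight h I \<mu> y k (y \<circ> (\<rho> k \<circ> \<pi> \<circ> inv (position I k)))"
      by (rule Suc.IH) (use k in simp, fact eq)
    ultimately show "level h I \<mu> k s (y \<circ> (\<rho> k \<circ> \<pi> \<circ> inv (position I k))) * weight h I \<mu> y k (y \<circ> (\<rho> k \<circ> \<pi> \<circ> inv (position I k))) =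
      level_quotient I h \<mu> k s' (t k \<circ> \<pi>) * nested_sum (level_quotient I h \<mu>) k t (t k \<circ> \<pi>)" by simp
  qed
  finally show ?case ..
qed simp

text \<open>\<open>x\<close> is kept apart from \<open>z\<close> because for the opposite chamber
  the top variables are permuted, while the Chern roots are still evaluated at the original
  ones.\<close>

lemma W_eq_weight:
  assumes I: "I permutes {1..n}" and J: "J permutes {1..n}" and n: "1 \<le> n"
  shows "W q n I (z, h, \<mu>) (\<lambda>k l. x (idx J k l)) = weight h I \<mu> (x \<circ> J) n (z \<circ> I)"
proof -
  let ?Y = "level_quotient I h \<mu>"
  let ?t = "\<lambda>k l. x (idx J k l)"
  let ?F = "\<lambda>t. (\<Prod>k = 1..<n. ?Y k (t (Suc k)) (t k)) * 1"
  have empty: "{(a, b). 1 \<le> a \<and> a < b \<and> b \<le> (0::nat)} = {}" by auto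
  have Y0: "?Y 0 s s' = 1" for s s'
    unfolding level_quotient_def empty by simp
  have "{1..n - 1} = {1..<n}" using n by auto
  then have "U_fun q n I (z, h, \<mu>) = (\<lambda>t. ?F (t(n := z)))"
    by (simp add: U_fun_def Let_def level_quotient_def fun_eq_iff)
  then have "W q n I (z, h, \<mu>) ?t = foldr Sym [1..<n] ?F (?t(n := z))"
    using foldr_Sym_fun_upd[of n "[1..<n]" ?F z ?t] by (simp only: W_def set_upt atLeastLessThan_iff less_irrefl simp_thms)
  also have "\<dots> = nested_sum ?Y n (?t(n := z)) z * 1"
    using foldr_Sym_eq_nested_sum[of ?Y n "\<lambda>_. 1" "?t(n := z)", OF _ n] Y0 by simp
  also have "nested_sum ?Y n (?t(n := z)) z = nested_sum ?Y n ?t z"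
    by (rule nested_sum_cong) simp
  also have "\<dots> = weight h I \<mu> (x \<circ> J) n (z \<circ> I)"
  proof (rule nested_sum_eq_weight[OF I])
    show "position J k permutes {1..k}" for k by (rule position_permutes[OF J])
    show "x (idx J k a) = (x \<circ> J) (position J k a)" if "a \<in> {1..k}" for k a
      using apply_position[OF J that] by simp
    show "z c = (z \<circ> I) (position I n c)" if "c \<in> {1..n}" for c
      using apply_position[OF I that] idx_full[OF I that] by simp
  qed simp
  finally show ?thesis by simp
qed

end

section \<open>Continuity and the limit along generic points\<close>

lemma kappa_kappa [simp]: "kappa (kappa P) = P"
  by (simp add: kappa_def case_prod_beta)

lemma kappa_eq_iff [simp]: "kappa P = kappa Q \<longleftrightarrow> P = Q"
  by (metis kappa_kappa)

lemma continuous_on_kappa: "continuous_on S kappa"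
  unfolding kappa_def case_prod_beta by (intro continuous_intros)

lemma tendsto_at_kappa_iff:
  "(f \<longlongrightarrow> l) (at (kappa P) within G) \<longleftrightarrow> ((f \<circ> kappa) \<longlongrightarrow> l) (at P within kappa -` G)"
proof -
  have open_kappa: "open (kappa -` S)" if "open S" for S
    using that continuous_on_kappa by (rule open_vimage)
  \<comment> \<open>Stated for arbitrary \<open>P\<close> and \<open>G\<close>: since
    \<open>kappa\<close> is an involution, a second application gives the converse.\<close>
  have *: "eventually (\<lambda>x. Q (kappa x)) (at P within kappa -` G)" if "eventually Q (at (kappa P) within G)" for Q P G
  proof -
    from that[unfolded eventually_at_topological] obtain S
      where S: "open S" "kappa P \<in> S" "\<forall>x\<in>S. x \<noteq> kappa P \<longrightarrow> x \<in> G \<longrightarrow> Q x"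
      by (elim exE conjE)
    show ?thesis
      unfolding eventually_at_topological
    proof (intro exI conjI ballI impI)
      show "open (kappa -` S)" by (rule open_kappa[OF S(1)])
      show "P \<in> kappa -` S" using S(2) by simp
      fix x assume "x \<in> kappa -` S" "x \<noteq> P" "x \<in> kappa -` G"
      then show "Q (kappa x)" using S(3)[rule_format, of "kappa x"] by simp
    qed
  qed
  have "kappa -` (kappa -` G) = G"
    by (simp add: vimage_def)
  then have "eventually Q (at (kappa P) within G) \<longleftrightarrow> eventually (\<lambda>x. Q (kappa x)) (at P within kappa -` G)" for Q
    using *[of Q P G] *[of "\<lambda>x. Q (kappa x)" "kappa P" "kappa -` G"] by (simp only: kappa_kappa) blast
  then show ?thesis
    by (simp add: tendsto_def)
qed

text \<open>\<open>P\<close> itself may lie outside \<open>G\<close>. By continuity a point of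
  \<open>G\<close> whose value is too far from \<open>l\<close> has a neighbourhood of such points,
  and this neighbourhood meets \<open>D\<close> away from \<open>P\<close>.\<close>

lemma tendsto_within_dense_iff:
  fixes f :: "'a::topological_space \<Rightarrow> 'b::metric_space"
  assumes "open G" "continuous_on G f" "D \<subseteq> G"
    and dense: "\<And>V x. open V \<Longrightarrow> x \<in> V \<Longrightarrow> \<exists>x'\<in>V. x' \<in> D \<and> x' \<noteq> P"
  shows "(f \<longlongrightarrow> l) (at P within G) \<longleftrightarrow> (f \<longlongrightarrow> l) (at P within D)"
proof
  show "(f \<longlongrightarrow> l) (at P within G) \<Longrightarrow> (f \<longlongrightarrow> l) (at P within D)"
    using tendsto_within_subset[OF _ assms(3)] .
  assume lim: "(f \<longlongrightarrow> l) (at P within D)"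
  show "(f \<longlongrightarrow> l) (at P within G)"
  proof (rule tendstoI)
    fix e :: real assume "e > 0"
    then have "eventually (\<lambda>x. dist (f x) l < e / 2) (at P within D)"
      using lim by (intro tendstoD) auto
    then obtain U where U: "open U" "P \<in> U" "\<forall>x\<in>U. x \<noteq> P \<longrightarrow> x \<in> D \<longrightarrow> dist (f x) l < e / 2"
      unfolding eventually_at_topological by blast
    have "dist (f x) l \<le> e / 2" if "x \<in> U" "x \<in> G" for x
    proof (rule ccontr)
      assume *: "\<not> dist (f x) l \<le> e / 2"
      have "open (f -` {y. e / 2 < dist y l} \<inter> G)"
        using \<open>continuous_on G f\<close> \<open>open G\<close>
        by (intro continuous_on_open_vimage[THEN iffD1, rule_format] open_Collect_less continuous_intros) auto
      then have "open (U \<inter> (f -` {y. e / 2 < dist y l} \<inter> G))"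
        using U(1) by blast
      moreover have "x \<in> U \<inter> (f -` {y. e / 2 < dist y l} \<inter> G)"
        using that * by auto
      ultimately obtain x' where "x' \<in> U \<inter> (f -` {y. e / 2 < dist y l} \<inter> G)" "x' \<in> D" "x' \<noteq> P"
        using dense by blast
      then show False using U(3) by fastforce
    qed
    then show "eventually (\<lambda>x. dist (f x) l < e) (at P within G)"
      unfolding eventually_at_topological using U(1,2) \<open>e > 0\<close> by (intro exI[of _ U]) fastforce
  qed
qed

section \<open>Continuity of the restrictions and density of the generic points\<close>

context elliptic_parameter
begin

lemma continuous_on_theta [continuous_intros]:
  "continuous_on S g \<Longrightarrow> continuous_on S (\<lambda>x. theta q (g x))"
  using continuous_on_compose2[OF holomorphic_on_imp_continuous_on[OF holomorphic_theta[OF q(2)]]] by blast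

text \<open>The denominators contain only \<open>h\<close> and the entries of \<open>y\<close>. So
  one side of the theorem requires generic \<open>z\<close> and the other generic
  \<open>\<mu>\<close>.\<close>

lemma continuous_on_weight:
  fixes S :: "'a::topological_space set"
  assumes h: "continuous_on S h" and \<mu>: "\<And>i. continuous_on S (\<lambda>P. \<mu> P i)" and y: "\<And>i. continuous_on S (\<lambda>P. y P i)"
    and gen: "\<And>P. P \<in> S \<Longrightarrow> generic n (h P) (y P)"
  shows "k \<le> n \<Longrightarrow> (\<And>i. continuous_on S (\<lambda>P. s P i)) \<Longrightarrow>
    continuous_on S (\<lambda>P. weight (h P) I (\<mu> P) (y P) k (s P))"
proof (induction k arbitrary: s)
  case (Suc k)
  have lev: "continuous_on S (\<lambda>P. level (h P) I (\<mu> P) k (s P) (y P \<circ> \<pi>))" if \<pi>: "\<pi> permutes {1..k}" for \<pi>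
    unfolding level_def
  proof (intro continuous_on_prod)
    fix p r assume p: "p \<in> {1..k}" and r: "r \<in> {1..Suc k}"
    have nz: "theta q (h P + y P (\<pi> p) - y P (\<pi> r)) \<noteq> 0" "theta q (y P (\<pi> r) - y P (\<pi> p)) \<noteq> 0"
      if "P \<in> S" "r \<le> k" "I p < I r" for P
    proof -
      have \<pi>_pr: "\<pi> p \<in> {1..n}" "\<pi> r \<in> {1..n}" "\<pi> p \<noteq> \<pi> r" "\<pi> r \<noteq> \<pi> p"
        using p r that Suc.prems(1) permutes_in_image[OF \<pi>, of p] permutes_in_image[OF \<pi>, of r]
          inj_eq[OF permutes_inj[OF \<pi>], of p r] by auto
      show "theta q (h P + y P (\<pi> p) - y P (\<pi> r)) \<noteq> 0" "theta q (y P (\<pi> r) - y P (\<pi> p)) \<noteq> 0"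
        using genericD(2)[OF gen[OF \<open>P \<in> S\<close>] \<pi>_pr(1-3)] genericD(1)[OF gen[OF \<open>P \<in> S\<close>] \<pi>_pr(2,1,4)] .
    qed
    have num: "continuous_on S (\<lambda>P. if I r < I p then theta q (h P + s P r - y P (\<pi> p))
      else if r = p then theta q (s P p - y P (\<pi> p) + ((if I (Suc k) < I p then 0 else h P) + \<mu> P (Suc k) - \<mu> P p))
      else theta q (s P r - y P (\<pi> p)))"
      by (cases "I r < I p"; cases "r = p"; cases "I (Suc k) < I p"; simp only: if_True if_False simp_thms less_irrefl;
        intro continuous_intros h \<mu> y Suc.prems(2))
    have den: "continuous_on S (\<lambda>P. if r \<le> k \<and> I p < I r
      then theta q (h P + y P (\<pi> p) - y P (\<pi> r)) * theta q (y P (\<pi> r) - y P (\<pi> p)) else 1)"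
      by (cases "r \<le> k \<and> I p < I r"; simp only: if_True if_False simp_thms; intro continuous_intros h y)
    show "continuous_on S (\<lambda>P. weight_factor (h P) I (\<mu> P) k (s P) (y P \<circ> \<pi>) p r)"
      unfolding weight_factor_def comp_apply by (rule continuous_on_divide[OF num den]) (simp add: nz)
  qed
  show ?case
    unfolding weight.simps
  proof (intro continuous_on_sum continuous_on_mult)
    fix \<pi> assume "\<pi> \<in> {\<pi>. \<pi> permutes {1..k}}"
    then show "continuous_on S (\<lambda>P. level (h P) I (\<mu> P) k (s P) (y P \<circ> \<pi>))" using lev by blast
    show "continuous_on S (\<lambda>P. weight (h P) I (\<mu> P) (y P) k (y P \<circ> \<pi>))"
      by (rule Suc.IH) (use Suc.prems(1) y in simp_all)
  qed
qed simp

lemma mem_generic_params_iff: "P \<in> generic_params q n \<longleftrightarrow> generic n (fst (snd P)) (fst P)"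
  by (simp add: generic_params_def generic_def case_prod_beta)

lemma continuous_on_coordinates:
  "continuous_on S (\<lambda>P. fst P i)" "continuous_on S (\<lambda>P. fst (snd P))" "continuous_on S (\<lambda>P. snd (snd P) i)"
  for S :: "params set"
  by (intro continuous_intros continuous_on_product_then_coordinatewise[where f = fst]
    continuous_on_product_then_coordinatewise[where f = "\<lambda>P. snd (snd P)"])+

lemma open_generic_params: "open (generic_params q n)"
proof -
  have prod_eq: "generic n h z \<longleftrightarrow> (\<Prod>a = 1..n. \<Prod>b = 1..n. if a = b then 1 else theta q (z a - z b) * theta q (h + z a - z b)) \<noteq> 0"
    for h z by (auto simp: generic_def)
  have eq: "generic_params q n = {P. (\<Prod>a = 1..n. \<Prod>b = 1..n. if a = b then 1 else
      theta q (fst P a - fst P b) * theta q (fst (snd P) + fst P a - fst P b)) \<noteq> 0}"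
    by (intro set_eqI) (simp only: mem_generic_params_iff prod_eq mem_Collect_eq)
  have "continuous_on UNIV (\<lambda>P::params. if a = b then 1 else
      theta q (fst P a - fst P b) * theta q (fst (snd P) + fst P a - fst P b))" for a b
    by (cases "a = b") (auto intro!: continuous_intros continuous_on_coordinates)
  then show ?thesis
    unfolding eq by (intro open_Collect_neq continuous_on_prod continuous_on_const)
qed

lemma generic_dense:
  assumes "open V" "x \<in> V"
  shows "\<exists>x'\<in>V. x' \<in> generic_params q n \<inter> kappa -` generic_params q n \<and> x' \<noteq> P"
proof -
  obtain z h \<mu> where x: "x = (z, h, \<mu>)" by (cases x) auto
  \<comment> \<open>A real line through \<open>x\<close>. Its slopes make every excluded expression
    nonconstant in \<open>t\<close>: \<open>a - b\<close> is nonzero, and \<open>n + 1\<close>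
    exceeds every \<open>b - a\<close>. So only countably many \<open>t\<close> are bad, and the
    slope of \<open>h\<close> lets the line meet \<open>P\<close> at most once.\<close>
  define c where "c t = (\<lambda>a. z a + of_real t * of_nat a, h + of_real t * of_nat (n + 1), \<lambda>a. \<mu> a + of_real t * of_nat a)" for t
  define bad where "bad y = {t. \<not> generic n (h + of_real t * of_nat (n + 1)) (\<lambda>a. y a + of_real t * of_nat a)}" for y
  have zeros: "countable {t::real. theta q (u + of_real t * of_int d) = 0}" if "d \<noteq> 0" for u d
  proof -
    have "inj (\<lambda>t::real. u + of_real t * of_int d)"
      using that by (auto simp: inj_def)
    from countable_image_inj_Int_vimage[OF this countable_theta_zeros[OF q]] show ?thesis
      by (simp add: vimage_def)
  qed
  have "countable (bad y)" for y
  proof -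
    have "bad y \<subseteq> (\<Union>a\<in>{1..n}. \<Union>b\<in>{1..n} - {a}. {t. theta q (y a - y b + of_real t * of_int (int a - int b)) = 0} \<union>
      {t. theta q (h + y a - y b + of_real t * of_int (int (n + 1) + int a - int b)) = 0})"
      by (auto simp: bad_def generic_def algebra_simps)
    moreover have "countable \<dots>"
      by (intro countable_UN countable_Un zeros) auto
    ultimately show ?thesis by (rule countable_subset)
  qed
  moreover have "countable {t. c t = P}"
  proof (cases "\<exists>t0. c t0 = P")
    case True
    then obtain t0 where "c t0 = P" by blast
    then have "{t. c t = P} \<subseteq> {t0}"
      by (auto simp: c_def simp del: of_nat_Suc of_nat_add)
    then show ?thesis by (rule countable_subset) simp
  qed simp
  ultimately have "countable (bad z \<union> bad \<mu> \<union> {t. c t = P})" by simp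
  moreover have "open (c -` V)"
  proof -
    have "continuous_on UNIV c"
      unfolding c_def by (intro continuous_intros continuous_on_coordinatewise_then_product)
    with \<open>open V\<close> show ?thesis by (rule open_vimage)
  qed
  moreover have "0 \<in> c -` V" using assms(2) by (simp add: x c_def)
  ultimately obtain t where "t \<in> c -` V" "t \<notin> bad z \<union> bad \<mu> \<union> {t. c t = P}"
    using open_minus_countable by (metis empty_iff)
  then show ?thesis
    by (intro bexI[of _ "c t"]) (auto simp: bad_def c_def mem_generic_params_iff kappa_def)
qed

lemma Stab_restricted:
  assumes "I permutes {1..n}" "J permutes {1..n}" "1 \<le> n"
  shows "Stab q n I P (fixed_chern_roots J P) =
    weight (fst (snd P)) I (snd (snd P)) (fst P \<circ> J) n (fst P \<circ> I)"
  using W_eq_weight[OF assms, of "fst P" "fst (snd P)" "snd (snd P)" "fst P"]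
  by (simp add: Stab_def fixed_chern_roots_def case_prod_beta)

lemma Stab_dual_restricted:
  assumes I: "I permutes {1..n}" and J: "J permutes {1..n}" and n: "1 \<le> n"
  shows "Stab_dual q n (inv J) P (fixed_chern_roots (inv I) P) = (- 1) ^ (n * (n - 1) div 2) *
    weight (fst (snd P)) (longest_perm n \<circ> inv J) (\<lambda>i. - snd (snd P) i) (fst P \<circ> inv I) n (fst P \<circ> inv J)"
proof -
  let ?\<sigma> = "longest_perm n"
  have "inv ?\<sigma> = ?\<sigma>" by (rule inv_unique_comp) (auto simp: fun_eq_iff)
  moreover have "fst P \<circ> ?\<sigma> \<circ> (?\<sigma> \<circ> inv J) = fst P \<circ> inv J" by (simp add: fun_eq_iff)
  moreover have "?\<sigma> \<circ> inv J permutes {1..n}"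
    by (rule permutes_compose[OF permutes_inv[OF J] longest_perm_permutes])
  note W_eq_weight[OF this permutes_inv[OF I] n, of "fst P \<circ> ?\<sigma>" "fst (snd P)" "\<lambda>i. - snd (snd P) i" "fst P"]
  ultimately show ?thesis
    by (simp add: Stab_dual_def W_chamber_def fixed_chern_roots_def case_prod_beta)
qed

theorem restrict_mirror:
  assumes I: "I permutes {1..n}" and J: "J permutes {1..n}" and n: "1 \<le> n"
  shows "restrict_to_component q n J (Stab q n I) = restrict_to_component q n (inv I) (Stab_dual q n (inv J)) \<circ> kappa"
proof
  fix P
  let ?G = "generic_params q n"
  define f where "f P = Stab q n I P (fixed_chern_roots J P)" for P
  define g where "g P = Stab_dual q n (inv J) P (fixed_chern_roots (inv I) P)" for P
  have gen: "generic n (fst (snd P)) (fst P \<circ> \<pi>)" if "P \<in> ?G" "\<pi> permutes {1..n}" for P \<pi>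
    using that generic_permute by (cases P) (auto simp: mem_generic_params_iff)
  have f: "continuous_on ?G f"
    unfolding f_def Stab_restricted[OF I J n]
    by (rule continuous_on_weight[OF _ _ _ _ order_refl])
      (auto intro: continuous_on_coordinates gen[OF _ J])
  have g: "continuous_on ?G g"
    unfolding g_def Stab_dual_restricted[OF I J n]
    by (intro continuous_on_mult continuous_on_const continuous_on_weight[OF _ _ _ _ order_refl])
      (auto intro: continuous_intros continuous_on_coordinates gen[OF _ permutes_inv[OF I]])
  have gk: "continuous_on (kappa -` ?G) (g \<circ> kappa)"
    by (rule continuous_on_compose[OF continuous_on_kappa]) (rule continuous_on_subset[OF g], auto)
  have opk: "open (kappa -` ?G)"
    using open_generic_params continuous_on_kappa by (rule open_vimage)
  have fg: "f P = (g \<circ> kappa) P" if "P \<in> ?G \<inter> kappa -` ?G" for P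
  proof -
    obtain z h \<mu> where P: "P = (z, h, \<mu>)" by (cases P) auto
    have "generic n h z" "generic n h \<mu>"
      using that by (auto simp: P kappa_def mem_generic_params_iff)
    note restricted_weight_mirror[OF I J this]
    moreover have "\<mu> \<circ> longest_perm n \<circ> (longest_perm n \<circ> K) = \<mu> \<circ> K" for K :: "nat \<Rightarrow> nat"
      by (simp add: fun_eq_iff)
    ultimately show ?thesis
      by (simp add: f_def g_def Stab_restricted[OF I J n] Stab_dual_restricted[OF I J n] P kappa_def restricted_weight_def)
  qed
  \<comment> \<open>An equivalence for every \<open>l\<close> transfers the existence of the limit
    together with its value, and so also the default 0.\<close>
  have "(f \<longlongrightarrow> l) (at P within ?G) \<longleftrightarrow> (g \<longlongrightarrow> l) (at (kappa P) within ?G)" for l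
  proof -
    have "(f \<longlongrightarrow> l) (at P within ?G) \<longleftrightarrow> (f \<longlongrightarrow> l) (at P within ?G \<inter> kappa -` ?G)"
      by (rule tendsto_within_dense_iff[OF open_generic_params f]) (use generic_dense in auto)
    also have "\<dots> \<longleftrightarrow> ((g \<circ> kappa) \<longlongrightarrow> l) (at P within ?G \<inter> kappa -` ?G)"
      by (intro filterlim_cong refl) (auto simp: eventually_at_filter fg)
    also have "\<dots> \<longleftrightarrow> ((g \<circ> kappa) \<longlongrightarrow> l) (at P within kappa -` ?G)"
      by (rule tendsto_within_dense_iff[OF opk gk, symmetric]) (use generic_dense in auto)
    also have "\<dots> \<longleftrightarrow> (g \<longlongrightarrow> l) (at (kappa P) within ?G)"
      by (rule tendsto_at_kappa_iff[symmetric])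
    finally show ?thesis .
  qed
  then show "restrict_to_component q n J (Stab q n I) P =
      (restrict_to_component q n (inv I) (Stab_dual q n (inv J)) \<circ> kappa) P"
    unfolding restrict_to_component_def Let_def t2_space_class.Lim_def comp_apply f_def[symmetric] g_def[symmetric] by simp
qed

end

theorem theorem1p2:
  fixes q :: complex and n :: nat and I J :: "nat \<Rightarrow> nat"
  assumes "q \<noteq> 0" and "norm q < 1" and "n \<ge> 1"
    and "I permutes {1..n}" and "J permutes {1..n}"
  shows "restrict_to_component q n J (Stab q n I) =
    restrict_to_component q n (inv I) (Stab_dual q n (inv J)) \<circ> kappa"
proof -
  interpret elliptic_parameter q by unfold_locales (fact assms)+
  show ?thesis using assms by (intro restrict_mirror)
qed

end
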